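(* Say that a pair $(f,g)$ of real functions on $\mathbb{R}$ satisfies property (KC) if there exist $\alpha,\hat\alpha>0$ with $\alpha\hat\alpha=\pi/2$ such that either $f\in K_\alpha$ and $g\in K_{\hat\alpha}$, or $-f\in K_\alpha$ and $-g\in K_{\hat\alpha}$. Suppose that every pair $(f,g)$ of bounded real functions on $\mathbb{R}$ such that $f$ and $g$ are restrictions to $\mathbb{R}$ of entire functions, $f\in K_a$ and $g\in K_b$ for some $a,b>0$, and $i[f(P),g(Q)]\ge0$ with $i[f(P),g(Q)]\neq0$, satisfies (KC). Then every pair $(f,g)$ of real, bounded, measurable functions on $\mathbb{R}$ with $i[f(P),g(Q)]\ge 0$ and $i[f(P),g(Q)]\ne0$ satisfies (KC).
   Context: On $L^2(\mathbb{R})$, $Q$ is multiplication by $x$ and $P=-i\,d/dx$; $f(P)$ and $g(Q)$ are defined by the functional calculus (so $g(Q)$ is multiplication by $g$, and $f(P)=\mathcal{F}^{-1}f(\xi)\mathcal{F}$ with $\mathcal{F}$ the unitary Fourier transform $\hat\psi(\xi)=(2\pi)^{-1/2}\int e^{-i\xi x}\psi(x)\,dx$). $[A,B]=AB-BA$. Positivity of a bounded operator is in the quadratic form sense. Measurable functions are identified when they agree almost everywhere. For $\alpha>0$, $K_\alpha$ is the set of bounded real functions on $\mathbb{R}$ having an analytic continuation to the strip $\{|\mathrm{Im}\,z|<\alpha\}$ that satisfies $\mathrm{Im} f(z)\,\mathrm{Im}\,z\ge 0$ there. *)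

theory Defs
  imports "HOL-Analysis.Analysis"
begin

text \<open>
  Elements of $L^2(\mathbb{R})$ are handled through representatives \<open>real \<Rightarrow> complex\<close>; operators
  act on representatives, and equality in $L^2$ is equality almost everywhere.
\<close>

definition L2 :: "(real \<Rightarrow> complex) set" where
  "L2 = {\<psi>. \<psi> \<in> borel_measurable lebesgue \<and> integrable lebesgue (\<lambda>x. (norm (\<psi> x))\<^sup>2)}"

definition L2_inner :: "(real \<Rightarrow> complex) \<Rightarrow> (real \<Rightarrow> complex) \<Rightarrow> complex" where
  "L2_inner \<phi> \<psi> = (LINT x|lebesgue. cnj (\<phi> x) * \<psi> x)"

definition fourier_trunc :: "real \<Rightarrow> (real \<Rightarrow> complex) \<Rightarrow> real \<Rightarrow> complex" where
  "fourier_trunc R \<psi> \<xi> =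
     complex_of_real (1 / sqrt (2 * pi)) *
     (LINT x:{-R..R}|lebesgue. exp (- (\<i> * complex_of_real \<xi> * complex_of_real x)) * \<psi> x)"

text \<open>
  The unitary Fourier transform on $L^2$ as a limit in the mean: for \<open>\<psi>\<close> in $L^2$ the truncated
  integrals converge in $L^2$ norm (Plancherel). The choice is only among representatives of the
  limit, which is unique up to null sets.
\<close>

definition is_fourier_L2 :: "(real \<Rightarrow> complex) \<Rightarrow> (real \<Rightarrow> complex) \<Rightarrow> bool" where
  "is_fourier_L2 \<psi> \<phi> \<longleftrightarrow> \<phi> \<in> L2 \<and>
     ((\<lambda>R. \<integral>\<^sup>+\<xi>. ennreal ((norm (fourier_trunc R \<psi> \<xi> - \<phi> \<xi>))\<^sup>2) \<partial>lebesgue) \<longlongrightarrow> 0) at_top"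

definition fourier_L2 :: "(real \<Rightarrow> complex) \<Rightarrow> real \<Rightarrow> complex" where
  "fourier_L2 \<psi> = (SOME \<phi>. is_fourier_L2 \<psi> \<phi>)"

definition inv_fourier_L2 :: "(real \<Rightarrow> complex) \<Rightarrow> real \<Rightarrow> complex" where
  "inv_fourier_L2 \<phi> = (SOME \<psi>. \<psi> \<in> L2 \<and> (AE \<xi> in lebesgue. fourier_L2 \<psi> \<xi> = \<phi> \<xi>))"

type_synonym L2_op = "(real \<Rightarrow> complex) \<Rightarrow> real \<Rightarrow> complex"

definition fun_of_Q :: "(real \<Rightarrow> real) \<Rightarrow> L2_op" where
  "fun_of_Q g \<psi> = (\<lambda>x. complex_of_real (g x) * \<psi> x)"

definition fun_of_P :: "(real \<Rightarrow> real) \<Rightarrow> L2_op" where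
  "fun_of_P f \<psi> = inv_fourier_L2 (\<lambda>\<xi>. complex_of_real (f \<xi>) * fourier_L2 \<psi> \<xi>)"

definition commutator :: "L2_op \<Rightarrow> L2_op \<Rightarrow> L2_op" where
  "commutator A B \<psi> = (\<lambda>x. A (B \<psi>) x - B (A \<psi>) x)"

definition i_commutator_PQ :: "(real \<Rightarrow> real) \<Rightarrow> (real \<Rightarrow> real) \<Rightarrow> L2_op" where
  "i_commutator_PQ f g \<psi> = (\<lambda>x. \<i> * commutator (fun_of_P f) (fun_of_Q g) \<psi> x)"

definition positive_op :: "L2_op \<Rightarrow> bool" where
  "positive_op T \<longleftrightarrow> (\<forall>\<psi>\<in>L2. L2_inner \<psi> (T \<psi>) \<in> \<real> \<and> 0 \<le> Re (L2_inner \<psi> (T \<psi>)))"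

definition zero_op :: "L2_op \<Rightarrow> bool" where
  "zero_op T \<longleftrightarrow> (\<forall>\<psi>\<in>L2. AE x in lebesgue. T \<psi> x = 0)"

definition K_class :: "real \<Rightarrow> (real \<Rightarrow> real) set" where
  "K_class \<alpha> = {f. bounded (range f) \<and>
     (\<exists>F. F holomorphic_on {z. \<bar>Im z\<bar> < \<alpha>} \<and>
          (\<forall>x. F (complex_of_real x) = complex_of_real (f x)) \<and>
          (\<forall>z. \<bar>Im z\<bar> < \<alpha> \<longrightarrow> 0 \<le> Im (F z) * Im z))}"

definition restriction_of_entire :: "(real \<Rightarrow> real) \<Rightarrow> bool" where
  "restriction_of_entire f \<longleftrightarrow>
     (\<exists>F. F holomorphic_on UNIV \<and> (\<forall>x. F (complex_of_real x) = complex_of_real (f x)))"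

text \<open>
  Measurable functions are identified when they agree almost everywhere, so membership in
  \<open>K_class\<close> is required of some representatives \<open>f'\<close>, \<open>g'\<close>. For continuous functions, such as
  restrictions of entire ones, these representatives are the functions themselves.
\<close>

definition KC :: "(real \<Rightarrow> real) \<Rightarrow> (real \<Rightarrow> real) \<Rightarrow> bool" where
  "KC f g \<longleftrightarrow>
     (\<exists>f' g'. (AE x in lebesgue. f x = f' x) \<and> (AE x in lebesgue. g x = g' x) \<and>
       (\<exists>\<alpha> \<beta>. 0 < \<alpha> \<and> 0 < \<beta> \<and> \<alpha> * \<beta> = pi / 2 \<and>
         (f' \<in> K_class \<alpha> \<and> g' \<in> K_class \<beta> \<or>
          (\<lambda>x. - f' x) \<in> K_class \<alpha> \<and> (\<lambda>x. - g' x) \<in> K_class \<beta>)))"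

end

theory Submission
  imports Defs "HOL-Complex_Analysis.Complex_Analysis" "HOL-Real_Asymp.Real_Asymp"
begin

text \<open>
  Write \<open>T\<close> for the operator \<open>i[f(P), g(Q)]\<close>. Conjugation by \<open>exp(isQ)\<close> translates \<open>f\<close> and does
  not affect \<open>g(Q)\<close>, so convolving \<open>f\<close> with a positive kernel replaces the quadratic form of \<open>T\<close> by an
  average of its values on modulated vectors (\<open>cform_conv\<close>). Positivity survives, and since the form
  depends continuously on the modulation, so does \<open>T \<noteq> 0\<close> (\<open>czero_conv\<close>). The Fourier transform
  followed by complex conjugation exchanges \<open>P\<close> and \<open>Q\<close> without changing the sign of the form
  (\<open>cform_swap\<close>), so the same holds for \<open>g\<close>. Hence the pair may be mollified freely. What remains is to
  see that suitable mollifications are entire and lie in classes \<open>K_class a\<close>, \<open>K_class b\<close>, and to remove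
  the mollification at the end.

  \<^emph>\<open>Monotonicity.\<close> Averaging \<open>f\<close> with the weight \<open>S\<^sup>2 / (S\<^sup>2 + t\<^sup>2)\<close>, \<open>S \<ge> 1\<close>, gives a function that
  differs from an affine one of slope \<open>p\<close> by \<open>O(\<xi>\<^sup>2 / S)\<close>. On the domain of \<open>P\<^sup>2\<close> the averaged form of \<open>T\<close>
  is therefore \<open>p\<close> times the form of \<open>i[P, g(Q)]\<close>, up to \<open>O(1 / S)\<close>. It is also bounded below by the average for
  \<open>S = 1\<close>; so if \<open>p\<close> came arbitrarily close to \<open>0\<close> for large \<open>S\<close>, then \<open>T\<close> would vanish
  (\<open>slope_lower_bound\<close>). Thus \<open>p\<close> stays away from \<open>0\<close>, and for one
  sign \<open>c\<close> the form of \<open>c i[P, g(Q)]\<close>, which is formally multiplication by \<open>c g'\<close>, is nonnegative. Evaluated on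
  the vectors \<open>1 / (T - i(x - a))\<close> it says that all Poisson means of \<open>c g\<close> are increasing. By symmetry
  those of \<open>f\<close> are monotone too, with the same sign \<open>c\<close> (\<open>slope_sign\<close>).

  \<^emph>\<open>Mollification.\<close> If \<open>h\<close> is bounded and increasing and \<open>p\<close> is the Poisson kernel of width \<open>e\<close>, then the
  convolution of \<open>h\<close> and \<open>p\<close> lies in \<open>K_class e\<close>, because \<open>Im p(t + iy)\<close> is odd in \<open>t\<close> and has the sign of
  \<open>- t y\<close> (\<open>conv_poisson_K_class\<close>). A further convolution with a Gaussian
  makes the function entire. So the assumption of the theorem applies to the mollified pair, after both
  functions have been multiplied by \<open>c\<close>.

  \<^emph>\<open>Limit.\<close> Functions of \<open>K_class 1\<close> with a common bound \<open>M\<close> on the real axis form a normal family: their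
  continuations omit the real numbers of modulus greater than \<open>M\<close>, and the plane slit along these two rays is
  conformally a disc, so Montel's theorem applies (\<open>K_class_normal\<close>). After rescaling the strips of
  the mollified functions to width \<open>1\<close> one obtains \<open>f(x) = k(\<theta> x)\<close> almost everywhere, where \<open>k\<close> is in
  \<open>K_class 1\<close> up to the sign and \<open>\<theta>\<close> is a limit of reciprocal widths. If \<open>\<theta> = 0\<close>, then \<open>f\<close> is constant and \<open>T = 0\<close>; so \<open>\<theta> > 0\<close>,
  and the relation \<open>\<alpha>\<beta> = \<pi>/2\<close> passes to the limit (\<open>K_class_limit_pair\<close>).
\<close>

section \<open>Square integrable Borel functions\<close>

text \<open>
  Borel functions, as opposed to Lebesgue measurable ones, compose measurably with \<open>(x, y) \<mapsto> x - y\<close>, which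
  every use of Fubini's theorem below requires. The relation \<open>borel_rep\<close> leads back to Lebesgue measurable
  functions.
\<close>
definition sqint :: "(real \<Rightarrow> complex) set" where
  "sqint = {\<psi>. \<psi> \<in> borel_measurable borel \<and> integrable lborel (\<lambda>x. (cmod (\<psi> x))\<^sup>2)}"

definition ip :: "(real \<Rightarrow> complex) \<Rightarrow> (real \<Rightarrow> complex) \<Rightarrow> complex" where
  "ip \<phi> \<psi> = (LINT x|lborel. cnj (\<phi> x) * \<psi> x)"

definition nsq :: "(real \<Rightarrow> complex) \<Rightarrow> real" where
  "nsq \<psi> = (LINT x|lborel. (cmod (\<psi> x))\<^sup>2)"

definition L2lim :: "('i \<Rightarrow> real \<Rightarrow> complex) \<Rightarrow> (real \<Rightarrow> complex) \<Rightarrow> 'i filter \<Rightarrow> bool" where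
  "L2lim \<Phi> \<phi> F \<longleftrightarrow> ((\<lambda>i. nsq (\<lambda>x. \<Phi> i x - \<phi> x)) \<longlongrightarrow> 0) F"

lemma sqint_measurable [measurable_dest]: "\<psi> \<in> sqint \<Longrightarrow> \<psi> \<in> borel_measurable borel"
  by (simp add: sqint_def)

lemma sqint_integrable: "\<psi> \<in> sqint \<Longrightarrow> integrable lborel (\<lambda>x. (cmod (\<psi> x))\<^sup>2)"
  by (simp add: sqint_def)

lemma borel_measurable_cnj [measurable]:
  "f \<in> borel_measurable M \<Longrightarrow> (\<lambda>x. cnj (f x)) \<in> borel_measurable M"
  by (rule measurable_compose[OF _ borel_measurable_continuous_onI[OF continuous_on_cnj[OF continuous_on_id]]])

lemma sqint_dominated:
  assumes "\<psi> \<in> sqint" "\<eta> \<in> borel_measurable borel" "\<And>x. cmod (\<eta> x) \<le> C * cmod (\<psi> x)"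
  shows "\<eta> \<in> sqint"
proof -
  have "integrable lborel (\<lambda>x. (cmod (\<eta> x))\<^sup>2)"
  proof (rule Bochner_Integration.integrable_bound)
    show "integrable lborel (\<lambda>x. C\<^sup>2 * (cmod (\<psi> x))\<^sup>2)"
      by (intro integrable_mult_right sqint_integrable assms)
    show "(\<lambda>x. (cmod (\<eta> x))\<^sup>2) \<in> borel_measurable lborel"
      using assms(2) by measurable
    show "AE x in lborel. norm ((cmod (\<eta> x))\<^sup>2) \<le> norm (C\<^sup>2 * (cmod (\<psi> x))\<^sup>2)"
      using power_mono[OF assms(3), of _ 2] by (auto simp: power_mult_distrib)
  qed
  with assms show ?thesis by (simp add: sqint_def)
qed

lemma sqint_bounded_mult:
  assumes "\<psi> \<in> sqint" "h \<in> borel_measurable borel" "\<And>x. cmod (h x) \<le> C"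
  shows "(\<lambda>x. h x * \<psi> x) \<in> sqint"
proof (rule sqint_dominated[OF assms(1)])
  show "(\<lambda>x. h x * \<psi> x) \<in> borel_measurable borel"
    using assms(1,2) by measurable
  show "cmod (h x * \<psi> x) \<le> C * cmod (\<psi> x)" for x
    using assms(3) by (simp add: norm_mult mult_right_mono)
qed

lemma sqint_real_bounded_mult:
  assumes "\<psi> \<in> sqint" "h \<in> borel_measurable borel" "\<And>x. \<bar>h x\<bar> \<le> C"
  shows "(\<lambda>x. complex_of_real (h x) * \<psi> x) \<in> sqint"
  by (rule sqint_bounded_mult[where C = C]) (use assms in auto)

lemma sqint_cnj: "\<psi> \<in> sqint \<Longrightarrow> (\<lambda>x. cnj (\<psi> x)) \<in> sqint"
  by (rule sqint_dominated[where C = 1]) (auto dest: sqint_measurable)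

lemma sqint_cmult: "\<psi> \<in> sqint \<Longrightarrow> (\<lambda>x. c * \<psi> x) \<in> sqint"
  by (rule sqint_bounded_mult[where C = "cmod c"]) auto

lemma cmod_add_sq_le: "(cmod (a + b))\<^sup>2 \<le> 2 * (cmod a)\<^sup>2 + 2 * (cmod b)\<^sup>2"
proof -
  have "(cmod (a + b))\<^sup>2 \<le> (cmod a + cmod b)\<^sup>2"
    by (intro power_mono norm_triangle_ineq) auto
  also have "\<dots> \<le> 2 * (cmod a)\<^sup>2 + 2 * (cmod b)\<^sup>2"
    using zero_le_power2[of "cmod a - cmod b"] by (simp add: power2_eq_square algebra_simps)
  finally show ?thesis .
qed

lemma sqint_add:
  assumes "\<phi> \<in> sqint" "\<psi> \<in> sqint"
  shows "(\<lambda>x. \<phi> x + \<psi> x) \<in> sqint"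
proof -
  have "integrable lborel (\<lambda>x. (cmod (\<phi> x + \<psi> x))\<^sup>2)"
  proof (rule Bochner_Integration.integrable_bound)
    show "integrable lborel (\<lambda>x. 2 * (cmod (\<phi> x))\<^sup>2 + 2 * (cmod (\<psi> x))\<^sup>2)"
      by (intro Bochner_Integration.integrable_add integrable_mult_right sqint_integrable assms)
    show "(\<lambda>x. (cmod (\<phi> x + \<psi> x))\<^sup>2) \<in> borel_measurable lborel"
      using assms by measurable
  qed (use cmod_add_sq_le in auto)
  moreover have "(\<lambda>x. \<phi> x + \<psi> x) \<in> borel_measurable borel"
    using assms by measurable
  ultimately show ?thesis by (simp add: sqint_def)
qed

lemma sqint_diff:
  assumes "\<phi> \<in> sqint" "\<psi> \<in> sqint"
  shows "(\<lambda>x. \<phi> x - \<psi> x) \<in> sqint"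
  using sqint_add[OF assms(1) sqint_cmult[OF assms(2), of "-1"]] by simp

lemma nsq_nonneg [simp]: "0 \<le> nsq \<psi>"
  by (simp add: nsq_def)

lemma nsq_add_le:
  assumes "\<phi> \<in> sqint" "\<psi> \<in> sqint"
  shows "nsq (\<lambda>x. \<phi> x + \<psi> x) \<le> 2 * nsq \<phi> + 2 * nsq \<psi>"
proof -
  have "nsq (\<lambda>x. \<phi> x + \<psi> x) \<le> (LINT x|lborel. 2 * (cmod (\<phi> x))\<^sup>2 + 2 * (cmod (\<psi> x))\<^sup>2)"
    unfolding nsq_def
    by (intro integral_mono Bochner_Integration.integrable_add integrable_mult_right
        sqint_integrable sqint_add assms cmod_add_sq_le)
  also have "\<dots> = 2 * nsq \<phi> + 2 * nsq \<psi>"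
    unfolding nsq_def using sqint_integrable[OF assms(1)] sqint_integrable[OF assms(2)] by simp
  finally show ?thesis .
qed

lemma nsq_swap: "nsq (\<lambda>x. \<phi> x - \<psi> x) = nsq (\<lambda>x. \<psi> x - \<phi> x)"
  unfolding nsq_def by (simp add: norm_minus_commute)

lemma nsq_triangle:
  assumes "\<phi> \<in> sqint" "\<psi> \<in> sqint" "\<eta> \<in> sqint"
  shows "nsq (\<lambda>x. \<phi> x - \<eta> x) \<le> 2 * nsq (\<lambda>x. \<phi> x - \<psi> x) + 2 * nsq (\<lambda>x. \<psi> x - \<eta> x)"
  using nsq_add_le[OF sqint_diff[OF assms(1,2)] sqint_diff[OF assms(2,3)]] by simp

lemma nsq_mono:
  assumes "\<psi> \<in> sqint" "\<eta> \<in> borel_measurable borel" "0 \<le> C" "\<And>x. cmod (\<eta> x) \<le> C * cmod (\<psi> x)"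
  shows "nsq \<eta> \<le> C\<^sup>2 * nsq \<psi>"
proof -
  have "nsq \<eta> \<le> (LINT x|lborel. C\<^sup>2 * (cmod (\<psi> x))\<^sup>2)"
    unfolding nsq_def
    using power_mono[OF assms(4), of _ 2]
    by (intro integral_mono integrable_mult_right sqint_integrable assms sqint_dominated[OF assms(1,2,4)])
       (auto simp: power_mult_distrib)
  then show ?thesis by (simp add: nsq_def)
qed

lemma nsq_eq_0_AE:
  assumes "\<psi> \<in> sqint" "nsq \<psi> = 0"
  shows "AE x in lborel. \<psi> x = 0"
  using integral_nonneg_eq_0_iff_AE[OF sqint_integrable[OF assms(1)]] assms(2)
  by (auto simp: nsq_def)

lemma nsq_cong_AE:
  assumes "AE x in lborel. \<phi> x = \<psi> x" "\<phi> \<in> borel_measurable borel" "\<psi> \<in> borel_measurable borel"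
  shows "nsq \<phi> = nsq \<psi>"
  unfolding nsq_def using assms by (intro integral_cong_AE) auto

lemma ip_cong_AE:
  assumes "AE x in lborel. \<phi> x = \<phi>' x" "AE x in lborel. \<psi> x = \<psi>' x"
    and [measurable]: "\<phi> \<in> borel_measurable borel" "\<psi> \<in> borel_measurable borel"
    "\<phi>' \<in> borel_measurable borel" "\<psi>' \<in> borel_measurable borel"
  shows "ip \<phi> \<psi> = ip \<phi>' \<psi>'"
  unfolding ip_def using assms(1,2) by (intro integral_cong_AE) auto

lemma integrable_prod:
  assumes "\<phi> \<in> sqint" "\<psi> \<in> sqint"
  shows "integrable lborel (\<lambda>x. \<phi> x * \<psi> x)"
proof (rule Bochner_Integration.integrable_bound)
  show "integrable lborel (\<lambda>x. (cmod (\<phi> x))\<^sup>2 + (cmod (\<psi> x))\<^sup>2)"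
    by (intro Bochner_Integration.integrable_add sqint_integrable assms)
  show "(\<lambda>x. \<phi> x * \<psi> x) \<in> borel_measurable lborel"
    using assms by measurable
  have "a * b \<le> a\<^sup>2 + b\<^sup>2" if "0 \<le> a" "0 \<le> b" for a b :: real
  proof -
    have "0 \<le> a * b" using that by simp
    moreover have "0 \<le> a\<^sup>2 - 2 * (a * b) + b\<^sup>2"
      using zero_le_power2[of "a - b"] by (simp add: power2_eq_square algebra_simps)
    ultimately show ?thesis by linarith
  qed
  then show "AE x in lborel. norm (\<phi> x * \<psi> x) \<le> norm ((cmod (\<phi> x))\<^sup>2 + (cmod (\<psi> x))\<^sup>2)"
    by (auto simp: norm_mult)
qed

lemma integrable_ip:
  assumes "\<phi> \<in> sqint" "\<psi> \<in> sqint"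
  shows "integrable lborel (\<lambda>x. cnj (\<phi> x) * \<psi> x)"
  using integrable_prod[OF sqint_cnj[OF assms(1)] assms(2)] .

lemma cauchy_schwarz:
  assumes "\<phi> \<in> sqint" "\<psi> \<in> sqint"
  shows "(cmod (LINT x|lborel. \<phi> x * \<psi> x))\<^sup>2 \<le> nsq \<phi> * nsq \<psi>"
proof -
  define I where "I = (LINT x|lborel. cmod (\<phi> x) * cmod (\<psi> x))"
  have int: "integrable lborel (\<lambda>x. cmod (\<phi> x) * cmod (\<psi> x))"
    using integrable_norm[OF integrable_prod[OF assms]] by (simp add: norm_mult)
  have I0: "0 \<le> I" unfolding I_def by simp
  have quad: "0 \<le> t\<^sup>2 * nsq \<phi> - 2 * t * I + nsq \<psi>" for t
  proof -
    have "0 \<le> (LINT x|lborel. (t * cmod (\<phi> x) - cmod (\<psi> x))\<^sup>2)" by simp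
    also have "\<dots> = (LINT x|lborel. t\<^sup>2 * (cmod (\<phi> x))\<^sup>2 - 2 * t * (cmod (\<phi> x) * cmod (\<psi> x)) + (cmod (\<psi> x))\<^sup>2)"
      by (simp add: power2_eq_square algebra_simps)
    also have "\<dots> = t\<^sup>2 * nsq \<phi> - 2 * t * I + nsq \<psi>"
      unfolding nsq_def I_def using int sqint_integrable[OF assms(1)] sqint_integrable[OF assms(2)]
      by simp
    finally show ?thesis .
  qed
  have 2: "I\<^sup>2 \<le> nsq \<phi> * nsq \<psi>"
  proof (cases "nsq \<phi> = 0")
    case True
    have "I = 0"
    proof (rule ccontr)
      assume "I \<noteq> 0"
      then show False using quad[of "(nsq \<psi> + 1) / (2 * I)"] True by simp
    qed
    then show ?thesis using True by simp
  next
    case False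
    then have "0 < nsq \<phi>" using nsq_nonneg[of \<phi>] by linarith
    then show ?thesis using quad[of "I / nsq \<phi>"]
      by (simp add: power2_eq_square field_simps)
  qed
  have 1: "cmod (LINT x|lborel. \<phi> x * \<psi> x) \<le> I"
    unfolding I_def using integral_norm_bound[of lborel "\<lambda>x. \<phi> x * \<psi> x"] by (simp add: norm_mult)
  show ?thesis
    by (rule order_trans[OF power_mono[OF 1 norm_ge_zero] 2])
qed

lemma nsq_cnj: "nsq (\<lambda>x. cnj (\<psi> x)) = nsq \<psi>"
  by (simp add: nsq_def)

lemma ip_bound:
  assumes "\<phi> \<in> sqint" "\<psi> \<in> sqint"
  shows "cmod (ip \<phi> \<psi>) \<le> sqrt (nsq \<phi>) * sqrt (nsq \<psi>)"
proof -
  have "(cmod (ip \<phi> \<psi>))\<^sup>2 \<le> nsq \<phi> * nsq \<psi>"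
    using cauchy_schwarz[OF sqint_cnj[OF assms(1)] assms(2)] by (simp add: ip_def nsq_cnj)
  then show ?thesis
    unfolding real_sqrt_mult[symmetric] by (rule real_le_rsqrt)
qed

lemma ip_add_left: "\<phi> \<in> sqint \<Longrightarrow> \<phi>' \<in> sqint \<Longrightarrow> \<psi> \<in> sqint \<Longrightarrow> ip (\<lambda>x. \<phi> x + \<phi>' x) \<psi> = ip \<phi> \<psi> + ip \<phi>' \<psi>"
  unfolding ip_def by (simp add: distrib_right integrable_ip)

lemma ip_diff_left: "\<phi> \<in> sqint \<Longrightarrow> \<phi>' \<in> sqint \<Longrightarrow> \<psi> \<in> sqint \<Longrightarrow> ip (\<lambda>x. \<phi> x - \<phi>' x) \<psi> = ip \<phi> \<psi> - ip \<phi>' \<psi>"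
  unfolding ip_def by (simp add: left_diff_distrib integrable_ip)

lemma ip_diff_right: "\<phi> \<in> sqint \<Longrightarrow> \<psi>' \<in> sqint \<Longrightarrow> \<psi> \<in> sqint \<Longrightarrow> ip \<phi> (\<lambda>x. \<psi> x - \<psi>' x) = ip \<phi> \<psi> - ip \<phi> \<psi>'"
  unfolding ip_def by (simp add: right_diff_distrib integrable_ip)

lemma ip_cmult_left: "ip (\<lambda>x. c * \<phi> x) \<psi> = cnj c * ip \<phi> \<psi>"
  unfolding ip_def by (simp add: mult.assoc)

lemma ip_cmult_right: "ip \<phi> (\<lambda>x. c * \<psi> x) = c * ip \<phi> \<psi>"
proof -
  have "(\<lambda>x. cnj (\<phi> x) * (c * \<psi> x)) = (\<lambda>x. c * (cnj (\<phi> x) * \<psi> x))" by (simp add: mult_ac)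
  then show ?thesis unfolding ip_def by simp
qed

lemma ip_commute: "ip \<psi> \<phi> = cnj (ip \<phi> \<psi>)"
proof -
  have "cnj (ip \<phi> \<psi>) = (LINT x|lborel. cnj (cnj (\<phi> x) * \<psi> x))"
    unfolding ip_def by (rule Bochner_Integration.integral_cnj[symmetric])
  then show ?thesis by (simp add: ip_def mult.commute)
qed

lemma ip_real_mult: "ip (\<lambda>x. complex_of_real (g x) * \<phi> x) \<psi> = ip \<phi> (\<lambda>x. complex_of_real (g x) * \<psi> x)"
  unfolding ip_def by (simp add: mult_ac)

lemma ip_self: "ip \<psi> \<psi> = complex_of_real (nsq \<psi>)"
proof -
  have "ip \<psi> \<psi> = (LINT x|lborel. complex_of_real ((cmod (\<psi> x))\<^sup>2))"
    unfolding ip_def by (intro Bochner_Integration.integral_cong refl)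
      (simp add: complex_norm_square[symmetric] mult.commute del: of_real_power)
  then show ?thesis by (simp add: nsq_def del: of_real_power)
qed

lemma L2lim_unique_AE:
  assumes "L2lim \<Phi> \<phi> F" "L2lim \<Phi> \<psi> F" "F \<noteq> bot" "\<phi> \<in> sqint" "\<psi> \<in> sqint" "\<And>i. \<Phi> i \<in> sqint"
  shows "AE x in lborel. \<phi> x = \<psi> x"
proof -
  have "((\<lambda>i. 2 * nsq (\<lambda>x. \<Phi> i x - \<phi> x) + 2 * nsq (\<lambda>x. \<Phi> i x - \<psi> x)) \<longlongrightarrow> 2 * 0 + 2 * 0) F"
    using assms(1,2) unfolding L2lim_def by (intro tendsto_intros)
  moreover have "nsq (\<lambda>x. \<phi> x - \<psi> x) \<le> 2 * nsq (\<lambda>x. \<Phi> i x - \<phi> x) + 2 * nsq (\<lambda>x. \<Phi> i x - \<psi> x)" for i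
    using nsq_triangle[OF assms(4,6,5), of i] nsq_swap[of \<phi> "\<Phi> i"] by simp
  ultimately have "nsq (\<lambda>x. \<phi> x - \<psi> x) \<le> 0"
    using tendsto_lowerbound[of "\<lambda>i. 2 * nsq (\<lambda>x. \<Phi> i x - \<phi> x) + 2 * nsq (\<lambda>x. \<Phi> i x - \<psi> x)" 0 F] assms(3) by simp
  then have "nsq (\<lambda>x. \<phi> x - \<psi> x) = 0" by (simp add: order_antisym)
  then have "AE x in lborel. \<phi> x - \<psi> x = 0" by (intro nsq_eq_0_AE sqint_diff assms)
  then show ?thesis by simp
qed

lemma L2lim_ip:
  assumes "L2lim \<Phi> \<phi> F" "L2lim \<Psi> \<psi> F" "\<phi> \<in> sqint" "\<psi> \<in> sqint" "\<And>i. \<Phi> i \<in> sqint" "\<And>i. \<Psi> i \<in> sqint"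
  shows "((\<lambda>i. ip (\<Phi> i) (\<Psi> i)) \<longlongrightarrow> ip \<phi> \<psi>) F"
proof -
  define a where "a i = sqrt (nsq (\<lambda>x. \<Phi> i x - \<phi> x))" for i
  define b where "b i = sqrt (nsq (\<lambda>x. \<Psi> i x - \<psi> x))" for i
  have a: "(a \<longlongrightarrow> 0) F" and b: "(b \<longlongrightarrow> 0) F"
    using tendsto_real_sqrt[OF assms(1)[unfolded L2lim_def]] tendsto_real_sqrt[OF assms(2)[unfolded L2lim_def]]
    by (simp_all add: a_def[abs_def] b_def[abs_def])
  have "cmod (ip (\<Phi> i) (\<Psi> i) - ip \<phi> \<psi>) \<le> a i * b i + a i * sqrt (nsq \<psi>) + sqrt (nsq \<phi>) * b i" for i
  proof -
    have "cmod (ip (\<Phi> i) (\<Psi> i) - ip \<phi> \<psi>) = cmod (ip (\<lambda>x. \<Phi> i x - \<phi> x) (\<lambda>x. \<Psi> i x - \<psi> x)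
       + ip (\<lambda>x. \<Phi> i x - \<phi> x) \<psi> + ip \<phi> (\<lambda>x. \<Psi> i x - \<psi> x))"
      using assms(3-6) by (simp add: ip_diff_left ip_diff_right sqint_diff)
    also have "\<dots> \<le> cmod (ip (\<lambda>x. \<Phi> i x - \<phi> x) (\<lambda>x. \<Psi> i x - \<psi> x))
       + cmod (ip (\<lambda>x. \<Phi> i x - \<phi> x) \<psi>) + cmod (ip \<phi> (\<lambda>x. \<Psi> i x - \<psi> x))"
      by (rule order_trans[OF norm_triangle_ineq add_right_mono[OF norm_triangle_ineq]])
    also have "\<dots> \<le> a i * b i + a i * sqrt (nsq \<psi>) + sqrt (nsq \<phi>) * b i"
      unfolding a_def b_def by (intro add_mono ip_bound sqint_diff assms)
    finally show ?thesis .
  qed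
  then have le: "\<forall>i. norm (ip (\<Phi> i) (\<Psi> i) - ip \<phi> \<psi>) \<le> a i * b i + a i * sqrt (nsq \<psi>) + sqrt (nsq \<phi>) * b i"
    by simp
  have lim: "((\<lambda>i. a i * b i + a i * sqrt (nsq \<psi>) + sqrt (nsq \<phi>) * b i) \<longlongrightarrow> 0 * 0 + 0 * sqrt (nsq \<psi>) + sqrt (nsq \<phi>) * 0) F"
    by (intro tendsto_intros a b)
  have "((\<lambda>i. ip (\<Phi> i) (\<Psi> i) - ip \<phi> \<psi>) \<longlongrightarrow> 0) F"
    by (rule Lim_null_comparison[OF always_eventually[OF le]]) (use lim in simp)
  then show ?thesis by (simp add: LIM_zero_iff)
qed

lemma L2lim_nsq:
  assumes "L2lim \<Phi> \<phi> F" "\<phi> \<in> sqint" "\<And>i. \<Phi> i \<in> sqint"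
  shows "((\<lambda>i. nsq (\<Phi> i)) \<longlongrightarrow> nsq \<phi>) F"
  using tendsto_Re[OF L2lim_ip[OF assms(1,1,2,2,3,3)]] by (simp add: ip_self)

lemma L2lim_bounded_mult:
  assumes "L2lim \<Phi> \<phi> F" "\<phi> \<in> sqint" "\<And>i. \<Phi> i \<in> sqint" "h \<in> borel_measurable borel" "\<And>x. cmod (h x) \<le> C"
  shows "L2lim (\<lambda>i x. h x * \<Phi> i x) (\<lambda>x. h x * \<phi> x) F"
proof -
  have C: "0 \<le> C" using order_trans[OF norm_ge_zero assms(5)[of 0]] .
  have le: "nsq (\<lambda>x. h x * \<Phi> i x - h x * \<phi> x) \<le> C\<^sup>2 * nsq (\<lambda>x. \<Phi> i x - \<phi> x)" for i
  proof (rule nsq_mono[OF sqint_diff[OF assms(3,2)] _ C])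
    show "(\<lambda>x. h x * \<Phi> i x - h x * \<phi> x) \<in> borel_measurable borel"
      using assms(2,3,4) by measurable
    show "cmod (h x * \<Phi> i x - h x * \<phi> x) \<le> C * cmod (\<Phi> i x - \<phi> x)" for x
      using assms(5) by (metis mult_right_mono norm_ge_zero norm_mult right_diff_distrib)
  qed
  have lim: "((\<lambda>i. C\<^sup>2 * nsq (\<lambda>x. \<Phi> i x - \<phi> x)) \<longlongrightarrow> C\<^sup>2 * 0) F"
    using assms(1) unfolding L2lim_def by (intro tendsto_intros)
  have le': "\<forall>i. norm (nsq (\<lambda>x. h x * \<Phi> i x - h x * \<phi> x)) \<le> C\<^sup>2 * nsq (\<lambda>x. \<Phi> i x - \<phi> x)"
    using le by simp
  show ?thesis unfolding L2lim_def
    by (rule Lim_null_comparison[OF always_eventually[OF le']]) (use lim in simp)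
qed

lemma L2lim_dominated:
  fixes \<Phi> :: "nat \<Rightarrow> real \<Rightarrow> complex"
  assumes "w \<in> sqint" "\<And>n. \<Phi> n \<in> borel_measurable borel" "\<phi> \<in> borel_measurable borel"
    and "\<And>n x. cmod (\<Phi> n x - \<phi> x) \<le> cmod (w x)"
    and "AE x in lborel. (\<lambda>n. \<Phi> n x) \<longlonglongrightarrow> \<phi> x"
  shows "L2lim \<Phi> \<phi> sequentially"
proof -
  have "(\<lambda>n. LINT x|lborel. (cmod (\<Phi> n x - \<phi> x))\<^sup>2) \<longlonglongrightarrow> (LINT x|(lborel::real measure). 0)"
  proof (rule integral_dominated_convergence[where w = "\<lambda>x. (cmod (w x))\<^sup>2"])
    show "(\<lambda>x. (cmod (\<Phi> n x - \<phi> x))\<^sup>2) \<in> borel_measurable lborel" for n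
      using assms(2,3) by measurable
    show "AE x in lborel. (\<lambda>n. (cmod (\<Phi> n x - \<phi> x))\<^sup>2) \<longlonglongrightarrow> 0"
      using assms(5)
    proof (rule AE_mp, intro AE_I2 impI)
      fix x assume "(\<lambda>n. \<Phi> n x) \<longlonglongrightarrow> \<phi> x"
      from tendsto_power[OF tendsto_norm_zero[OF LIM_zero[OF this]], of 2]
      show "(\<lambda>n. (cmod (\<Phi> n x - \<phi> x))\<^sup>2) \<longlonglongrightarrow> 0" by simp
    qed
    show "AE x in lborel. norm ((cmod (\<Phi> n x - \<phi> x))\<^sup>2) \<le> (cmod (w x))\<^sup>2" for n
      using power_mono[OF assms(4), of _ _ 2] by auto
  qed (use sqint_integrable[OF assms(1)] in auto)
  then show ?thesis by (simp add: L2lim_def nsq_def)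
qed

lemma lorentz_integral:
  "integrable lborel (\<lambda>x::real. 1 / (1 + x\<^sup>2))" "(LINT x|lborel. 1 / (1 + x\<^sup>2)) = pi"
proof -
  have *: "- \<infinity> < (\<infinity> :: ereal)" by simp
  note FTC = interval_integral_FTC_nonneg[OF *, where f = "\<lambda>x::real. 1 / (1 + x\<^sup>2)" and F = arctan
      and A = "- pi / 2" and B = "pi / 2"]
  have nz: "1 + x\<^sup>2 \<noteq> 0" for x :: real
    by (smt (verit) zero_le_power2)
  have 1: "DERIV arctan x :> 1 / (1 + x\<^sup>2)" for x
    using DERIV_arctan[of x] by (simp add: inverse_eq_divide)
  have 2: "isCont (\<lambda>x::real. 1 / (1 + x\<^sup>2)) x" for x
    using nz by (intro continuous_intros) auto
  have 3: "((arctan \<circ> real_of_ereal) \<longlongrightarrow> - pi / 2) (at_right (- \<infinity>))"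
    using tendsto_arctan_at_bot by (simp add: ereal_tendsto_simps)
  have 4: "((arctan \<circ> real_of_ereal) \<longlongrightarrow> pi / 2) (at_left \<infinity>)"
    using tendsto_arctan_at_top by (simp add: ereal_tendsto_simps)
  have a: "set_integrable lborel (einterval (-\<infinity>) \<infinity>) (\<lambda>x::real. 1 / (1 + x\<^sup>2))"
    by (rule FTC(1)) (use 1 2 3 4 in auto)
  have b: "(LBINT x=-\<infinity>..\<infinity>. 1 / (1 + x\<^sup>2)) = pi / 2 - (- pi / 2)"
    by (rule FTC(2)) (use 1 2 3 4 in auto)
  show "integrable lborel (\<lambda>x::real. 1 / (1 + x\<^sup>2))"
    using a by (simp add: set_integrable_def)
  show "(LINT x|lborel. 1 / (1 + x\<^sup>2)) = pi"
    using b by (simp add: interval_integral_to_infinity_eq interval_lebesgue_integral_def set_lebesgue_integral_def)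
qed

lemma sqint_weight: "(\<lambda>x. 1 / (1 + \<i> * complex_of_real x)) \<in> sqint"
proof -
  have "(cmod (1 / (1 + \<i> * complex_of_real x)))\<^sup>2 = 1 / (1 + x\<^sup>2)" for x
    by (simp add: norm_divide power_divide cmod_power2)
  then show ?thesis
    using lorentz_integral(1) by (simp add: sqint_def)
qed

text \<open>
  The weight \<open>1 / (1 + ix)\<close> is square integrable, so by the Cauchy-Schwarz inequality it turns the given
  sequence into a Cauchy sequence in $L^1$, which has an almost everywhere convergent subsequence. Fatou's lemma then
  gives convergence in $L^2$.
\<close>
lemma L2_complete:
  fixes u :: "nat \<Rightarrow> real \<Rightarrow> complex"
  assumes u: "\<And>n. u n \<in> sqint"
    and cauchy: "\<And>e. e > 0 \<Longrightarrow> \<exists>N. \<forall>i\<ge>N. \<forall>j\<ge>N. nsq (\<lambda>x. u i x - u j x) < e"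
  obtains \<phi> where "\<phi> \<in> sqint" "L2lim u \<phi> sequentially"
proof -
  define w where "w x = 1 / (1 + \<i> * complex_of_real x)" for x
  have w: "w \<in> sqint" unfolding w_def by (rule sqint_weight)
  have wnz: "w x \<noteq> 0" for x
  proof -
    have "1 + \<i> * complex_of_real x \<noteq> 0"
      by (simp add: complex_eq_iff)
    then show ?thesis by (simp add: w_def)
  qed
  have [measurable]: "u n \<in> borel_measurable borel" for n using u by measurable
  have "\<exists>N. \<forall>i\<ge>N. \<forall>j\<ge>N. (LINT x|lborel. norm (u i x * w x - u j x * w x)) < e" if e: "e > 0" for e
  proof -
    define C where "C = sqrt (nsq w) + 1"
    have C: "0 < C" unfolding C_def by (simp add: add_nonneg_pos)
    obtain N where N: "\<And>i j. i \<ge> N \<Longrightarrow> j \<ge> N \<Longrightarrow> nsq (\<lambda>x. u i x - u j x) < (e / C)\<^sup>2"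
      using cauchy[of "(e / C)\<^sup>2"] e C by auto
    have "(LINT x|lborel. norm (u i x * w x - u j x * w x)) < e" if ij: "i \<ge> N" "j \<ge> N" for i j
    proof -
      have d: "(\<lambda>x. complex_of_real (cmod (u i x - u j x))) \<in> sqint"
        by (rule sqint_dominated[OF sqint_diff[OF u[of i] u[of j]], where C = 1]) (auto, measurable)
      have d2: "(\<lambda>x. complex_of_real (cmod (w x))) \<in> sqint"
        by (rule sqint_dominated[OF w, where C = 1]) (use w in \<open>auto intro: measurable_compose[OF sqint_measurable[OF w]]\<close>)
      have "(LINT x|lborel. norm (u i x * w x - u j x * w x)) =
          (LINT x|lborel. cmod (u i x - u j x) * cmod (w x))"
        by (simp add: norm_mult left_diff_distrib[symmetric])
      also have "\<dots> = cmod (ip (\<lambda>x. complex_of_real (cmod (u i x - u j x))) (\<lambda>x. complex_of_real (cmod (w x))))"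
        by (simp add: ip_def flip: of_real_mult)
      also have "\<dots> \<le> sqrt (nsq (\<lambda>x. u i x - u j x)) * sqrt (nsq w)"
        using ip_bound[OF d d2] by (simp add: nsq_def)
      also have "\<dots> \<le> (e / C) * sqrt (nsq w)"
        using real_less_lsqrt[OF _ N[OF ij]] e C by (intro mult_right_mono) (auto intro: less_imp_le)
      also have "\<dots> < (e / C) * C"
        using e C by (intro mult_strict_left_mono) (auto simp: C_def)
      finally show ?thesis using C by simp
    qed
    then show ?thesis by blast
  qed
  then obtain r where r: "strict_mono r" "AE x in lborel. Cauchy (\<lambda>i. u (r i) x * w x)"
    using cauchy_L1_AE_cauchy_subseq[of lborel "\<lambda>n x. u n x * w x"] integrable_prod[OF u w] by blast
  define \<phi> where "\<phi> x = lim (\<lambda>i. u (r i) x)" for x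
  have [measurable]: "\<phi> \<in> borel_measurable borel"
    unfolding \<phi>_def by measurable
  have conv: "AE x in lborel. (\<lambda>i. u (r i) x) \<longlonglongrightarrow> \<phi> x"
    using r(2)
  proof (rule AE_mp, intro AE_I2 impI)
    fix x assume "Cauchy (\<lambda>i. u (r i) x * w x)"
    then obtain l where "(\<lambda>i. u (r i) x * w x) \<longlonglongrightarrow> l"
      using Cauchy_convergent_iff convergent_def by blast
    from tendsto_divide[OF this tendsto_const[of "w x"] wnz] wnz[of x]
    have "convergent (\<lambda>i. u (r i) x)" by (auto simp: convergent_def)
    then show "(\<lambda>i. u (r i) x) \<longlonglongrightarrow> \<phi> x"
      by (simp add: \<phi>_def convergent_LIMSEQ_iff)
  qed
  have fatou: "(\<integral>\<^sup>+x. ennreal ((cmod (u n x - \<phi> x))\<^sup>2) \<partial>lborel) \<le> ennreal e"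
    if e: "0 < e" and N: "\<And>j. j \<ge> N \<Longrightarrow> nsq (\<lambda>x. u n x - u j x) < e" for n N e
  proof -
    have "(\<integral>\<^sup>+x. ennreal ((cmod (u n x - \<phi> x))\<^sup>2) \<partial>lborel) =
        (\<integral>\<^sup>+x. liminf (\<lambda>i. ennreal ((cmod (u n x - u (r i) x))\<^sup>2)) \<partial>lborel)"
    proof (rule nn_integral_cong_AE, rule AE_mp[OF conv], intro AE_I2 impI)
      fix x assume "(\<lambda>i. u (r i) x) \<longlonglongrightarrow> \<phi> x"
      then have "(\<lambda>i. ennreal ((cmod (u n x - u (r i) x))\<^sup>2)) \<longlonglongrightarrow> ennreal ((cmod (u n x - \<phi> x))\<^sup>2)"
        by (intro tendsto_ennrealI tendsto_intros)
      then show "ennreal ((cmod (u n x - \<phi> x))\<^sup>2) = liminf (\<lambda>i. ennreal ((cmod (u n x - u (r i) x))\<^sup>2))"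
        by (intro lim_imp_Liminf[symmetric]) auto
    qed
    also have "\<dots> \<le> liminf (\<lambda>i. \<integral>\<^sup>+x. ennreal ((cmod (u n x - u (r i) x))\<^sup>2) \<partial>lborel)"
      by (intro nn_integral_liminf) measurable
    also have "\<dots> = liminf (\<lambda>i. ennreal (nsq (\<lambda>x. u n x - u (r i) x)))"
      unfolding nsq_def by (subst nn_integral_eq_integral) (auto intro: sqint_integrable[OF sqint_diff[OF u u]])
    also have "\<dots> \<le> liminf (\<lambda>i. ennreal e)"
    proof (rule Liminf_mono, rule eventually_sequentiallyI)
      fix i assume "N \<le> i"
      then have "N \<le> r i" using seq_suble[OF r(1), of i] by linarith
      then show "ennreal (nsq (\<lambda>x. u n x - u (r i) x)) \<le> ennreal e"
        using N by (intro ennreal_leI) (auto intro: less_imp_le)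
    qed
    also have "\<dots> = ennreal e" by (simp add: Liminf_const)
    finally show ?thesis .
  qed
  have diff: "(\<lambda>x. u n x - \<phi> x) \<in> sqint \<and> nsq (\<lambda>x. u n x - \<phi> x) \<le> e"
    if "0 < e" "\<And>j. j \<ge> N \<Longrightarrow> nsq (\<lambda>x. u n x - u j x) < e" for n N e
  proof -
    have fat: "(\<integral>\<^sup>+x. ennreal ((cmod (u n x - \<phi> x))\<^sup>2) \<partial>lborel) \<le> ennreal e"
      by (rule fatou[of e N n]) (use that in auto)
    have int: "integrable lborel (\<lambda>x. (cmod (u n x - \<phi> x))\<^sup>2)"
      using le_less_trans[OF fat ennreal_less_top] by (intro integrableI_bounded) auto
    have "ennreal (nsq (\<lambda>x. u n x - \<phi> x)) \<le> ennreal e"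
      using fat int by (simp add: nsq_def nn_integral_eq_integral)
    with int that(1) show ?thesis by (simp add: sqint_def ennreal_le_iff)
  qed
  obtain N where N: "\<And>i j. i \<ge> N \<Longrightarrow> j \<ge> N \<Longrightarrow> nsq (\<lambda>x. u i x - u j x) < 1"
    using cauchy[of 1] by auto
  have "(\<lambda>x. u N x - \<phi> x) \<in> sqint" using diff[of 1 N N] N by auto
  then have "\<phi> \<in> sqint"
    using sqint_diff[OF u[of N]] by fastforce
  moreover have "L2lim u \<phi> sequentially"
    unfolding L2lim_def
  proof (rule LIMSEQ_I)
    fix e :: real assume e: "0 < e"
    obtain N where N: "\<And>i j. i \<ge> N \<Longrightarrow> j \<ge> N \<Longrightarrow> nsq (\<lambda>x. u i x - u j x) < e / 2"
      using cauchy[of "e / 2"] e by auto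
    then have "nsq (\<lambda>x. u n x - \<phi> x) \<le> e / 2" if "n \<ge> N" for n
      using diff[of "e / 2" N n] e that by auto
    then show "\<exists>no. \<forall>n\<ge>no. norm (nsq (\<lambda>x. u n x - \<phi> x) - 0) < e"
      using e by (intro exI[of _ N] allI impI) (force intro: le_less_trans)
  qed
  ultimately show ?thesis by (rule that)
qed

definition trunc :: "real \<Rightarrow> (real \<Rightarrow> complex) \<Rightarrow> real \<Rightarrow> complex" where
  "trunc R \<psi> x = (if \<bar>x\<bar> \<le> R then \<psi> x else 0)"

lemma trunc_measurable [measurable]: "\<psi> \<in> borel_measurable borel \<Longrightarrow> trunc R \<psi> \<in> borel_measurable borel"
  unfolding trunc_def[abs_def] by (rule measurable_If) auto

lemma trunc_sqint: "\<psi> \<in> sqint \<Longrightarrow> trunc R \<psi> \<in> sqint"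
  by (rule sqint_dominated[where C = 1]) (auto simp: trunc_def)

lemma trunc_integrable:
  assumes "\<psi> \<in> sqint" shows "integrable lborel (trunc R \<psi>)"
proof -
  have "(\<lambda>x. indicator {-R..R} x :: complex) \<in> sqint"
  proof -
    have "(cmod (indicator {-R..R} x))\<^sup>2 = (indicator {-R..R} x :: real)" for x
      by (simp add: indicator_def)
    moreover have "integrable lborel (indicator {-R..R} :: real \<Rightarrow> real)"
      by (intro integrable_real_indicator) (auto simp: emeasure_lborel_Icc_eq)
    ultimately show ?thesis by (simp add: sqint_def)
  qed
  from integrable_prod[OF this assms] show ?thesis
    by (rule back_subst[of "integrable lborel"]) (auto simp: trunc_def indicator_def abs_le_iff fun_eq_iff)
qed

lemma trunc_L2lim:
  assumes "\<psi> \<in> sqint" shows "L2lim (\<lambda>R. trunc R \<psi>) \<psi> at_top"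
  unfolding L2lim_def
proof (rule tendsto_at_topI_sequentially)
  fix X :: "nat \<Rightarrow> real" assume X: "filterlim X at_top sequentially"
  have "L2lim (\<lambda>n. trunc (X n) \<psi>) \<psi> sequentially"
  proof (rule L2lim_dominated[OF assms])
    show "\<psi> \<in> borel_measurable borel" "\<And>n. trunc (X n) \<psi> \<in> borel_measurable borel"
      using assms by measurable
    show "cmod (trunc (X n) \<psi> x - \<psi> x) \<le> cmod (\<psi> x)" for n x
      by (simp add: trunc_def)
    show "AE x in lborel. (\<lambda>n. trunc (X n) \<psi> x) \<longlonglongrightarrow> \<psi> x"
    proof (rule AE_I2)
      fix x
      have "eventually (\<lambda>n. trunc (X n) \<psi> x = \<psi> x) sequentially"
        using X[unfolded filterlim_at_top, rule_format, of "\<bar>x\<bar>"]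
        by (rule eventually_mono) (simp add: trunc_def)
      then show "(\<lambda>n. trunc (X n) \<psi> x) \<longlonglongrightarrow> \<psi> x" by (rule tendsto_eventually)
    qed
  qed
  then show "(\<lambda>n. nsq (\<lambda>x. trunc (X n) \<psi> x - \<psi> x)) \<longlonglongrightarrow> 0" by (simp add: L2lim_def)
qed

section \<open>Dominated Fubini exchange and the Poisson kernel\<close>

text \<open>
  The mass of \<open>D x\<close> may not depend on \<open>x\<close>: the typical \<open>D x\<close> is a kernel translated by \<open>x\<close>.
\<close>
lemma fubini_dom:
  fixes G :: "real \<Rightarrow> real \<Rightarrow> 'b :: {banach, second_countable_topology}"
  assumes meas: "(\<lambda>(x, y). G x y) \<in> borel_measurable (lborel \<Otimes>\<^sub>M lborel)"
    and A: "integrable lborel A" and D: "\<And>x. integrable lborel (D x)" "\<And>x. (LINT y|lborel. D x y) = K"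
    and le: "\<And>x y. norm (G x y) \<le> A x * D x y"
  shows "(LINT x|lborel. LINT y|lborel. G x y) = (LINT y|lborel. LINT x|lborel. G x y)"
    and "integrable lborel (\<lambda>x. LINT y|lborel. G x y)"
    and "integrable lborel (\<lambda>y. LINT x|lborel. G x y)"
proof -
  have Gx: "integrable lborel (G x)" for x
  proof (rule Bochner_Integration.integrable_bound)
    show "integrable lborel (\<lambda>y. A x * D x y)" using D by simp
    show "G x \<in> borel_measurable lborel"
      using measurable_compose[OF measurable_Pair1'[of x lborel lborel] meas] by simp
    show "AE y in lborel. norm (G x y) \<le> norm (A x * D x y)"
      unfolding real_norm_def by (intro AE_I2 order_trans[OF le abs_ge_self])
  qed
  have int: "integrable (lborel \<Otimes>\<^sub>M lborel) (\<lambda>(x, y). G x y)"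
  proof (rule lborel_pair.Fubini_integrable[OF meas])
    show "integrable lborel (\<lambda>x. LINT y|lborel. norm (case (x, y) of (x, y) \<Rightarrow> G x y))"
    proof (rule Bochner_Integration.integrable_bound)
      show "integrable lborel (\<lambda>x. A x * K)" using A by simp
      have "(\<lambda>p. norm (case_prod G p)) \<in> borel_measurable (lborel \<Otimes>\<^sub>M lborel)"
        using meas by (rule measurable_compose[OF _ borel_measurable_norm])
      then show "(\<lambda>x. LINT y|lborel. norm (case (x, y) of (x, y) \<Rightarrow> G x y)) \<in> borel_measurable lborel"
        using lborel.borel_measurable_lebesgue_integral[of "\<lambda>x y. norm (G x y)" lborel] by (simp add: case_prod_unfold)
      have "(LINT y|lborel. norm (G x y)) \<le> A x * K" for x
      proof -
        have "(LINT y|lborel. norm (G x y)) \<le> (LINT y|lborel. A x * D x y)"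
          using Gx D le by (intro integral_mono) auto
        then show ?thesis using D by simp
      qed
      then show "AE x in lborel. norm (LINT y|lborel. norm (case (x, y) of (x, y) \<Rightarrow> G x y)) \<le> norm (A x * K)"
        unfolding real_norm_def prod.case
        by (intro AE_I2) (simp add: abs_of_nonneg order_trans[OF _ abs_ge_self])
    qed
    show "AE x in lborel. integrable lborel (\<lambda>y. case (x, y) of (x, y) \<Rightarrow> G x y)"
      using Gx by simp
  qed
  show "(LINT x|lborel. LINT y|lborel. G x y) = (LINT y|lborel. LINT x|lborel. G x y)"
    using lborel_pair.Fubini_integral[OF int] by simp
  show "integrable lborel (\<lambda>x. LINT y|lborel. G x y)"
    using lborel_pair.integrable_fst'[OF int] by simp
  show "integrable lborel (\<lambda>y. LINT x|lborel. G x y)"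
    using lborel_pair.integrable_snd[OF int] by simp
qed

lemma half_line_FTC:
  fixes F f :: "real \<Rightarrow> complex"
  assumes F: "\<And>x. (F has_vector_derivative f x) (at x)" and cont: "continuous_on UNIV f"
    and int: "integrable lborel (\<lambda>x. indicator {0..} x *\<^sub>R f x)"
    and lim: "(F \<longlongrightarrow> 0) at_top"
  shows "(LINT x|lborel. indicator {0..} x *\<^sub>R f x) = - F 0"
proof -
  have 1: "(\<lambda>n. LINT x|lborel. indicator {0..real n} x *\<^sub>R f x) \<longlonglongrightarrow> (LINT x|lborel. indicator {0..} x *\<^sub>R f x)"
  proof (rule integral_dominated_convergence[where w = "\<lambda>x. norm (indicator {0..} x *\<^sub>R f x)"])
    have [measurable]: "f \<in> borel_measurable borel" using cont by (rule borel_measurable_continuous_onI)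
    show "(\<lambda>x. indicator {0..} x *\<^sub>R f x) \<in> borel_measurable lborel"
      "(\<lambda>x. indicator {0..real n} x *\<^sub>R f x) \<in> borel_measurable lborel" for n
      by measurable
    show "AE x in lborel. (\<lambda>n. indicator {0..real n} x *\<^sub>R f x) \<longlonglongrightarrow> indicator {0..} x *\<^sub>R f x"
    proof (rule AE_I2)
      fix x :: real
      have "eventually (\<lambda>n. indicator {0..real n} x *\<^sub>R f x = indicator {0..} x *\<^sub>R f x) sequentially"
        using eventually_ge_at_top[of "nat \<lceil>x\<rceil>"] by eventually_elim (auto simp: indicator_def)
      then show "(\<lambda>n. indicator {0..real n} x *\<^sub>R f x) \<longlonglongrightarrow> indicator {0..} x *\<^sub>R f x"
        by (rule tendsto_eventually)
    qed
    show "integrable lborel (\<lambda>x. norm (indicator {0..} x *\<^sub>R f x))"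
      using int by (rule integrable_norm)
  qed (auto simp: indicator_def)
  have 2: "(LINT x|lborel. indicator {0..real n} x *\<^sub>R f x) = F (real n) - F 0" for n
    by (rule integral_FTC_Icc) (auto intro: has_vector_derivative_at_within F continuous_on_subset[OF cont])
  have 3: "(\<lambda>n. F (real n) - F 0) \<longlonglongrightarrow> 0 - F 0"
    by (intro tendsto_intros filterlim_compose[OF lim filterlim_real_sequentially])
  show ?thesis using LIMSEQ_unique[OF 1] 3 by (simp add: 2)
qed

lemma exp_half_line_integrable:
  assumes "0 < a"
  shows "integrable lborel (\<lambda>x. indicator {0..} x *\<^sub>R exp (- a * x :: real))"
proof (rule integrableI_bounded)
  have "(\<integral>\<^sup>+x. ennreal (exp (- a * x)) * indicator {0 ..} x \<partial>lborel) = ennreal (0 - (- exp (- a * 0) / a))"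
  proof (rule nn_integral_FTC_atLeast)
    show "((\<lambda>x. - exp (- a * x) / a) \<longlongrightarrow> 0) at_top" using assms by real_asymp
  qed (use assms in \<open>auto intro!: derivative_eq_intros\<close>)
  moreover have "(\<integral>\<^sup>+x. ennreal (norm (indicator {0..} x *\<^sub>R exp (- a * x))) \<partial>lborel) =
     (\<integral>\<^sup>+x. ennreal (exp (- a * x)) * indicator {0 ..} x \<partial>lborel)"
    by (intro nn_integral_cong) (auto simp: indicator_def)
  ultimately show "(\<integral>\<^sup>+x. ennreal (norm (indicator {0..} x *\<^sub>R exp (- a * x))) \<partial>lborel) < \<infinity>"
    by simp
qed measurable

lemma power_exp_bound:
  assumes "0 < a" "0 \<le> (x::real)"
  shows "x ^ k * exp (- a * x) \<le> fact k * (2 / a) ^ k * exp (- (a / 2) * x)"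
proof -
  define y where "y = a / 2 * x"
  have y: "0 \<le> y" using assms by (simp add: y_def)
  have s: "(\<lambda>n. y ^ n / fact n) sums exp y"
    using exp_converges[of y] by (simp add: divide_inverse mult.commute scaleR_conv_of_real)
  have "(\<Sum>n\<in>{k}. y ^ n / fact n) \<le> (\<Sum>n. y ^ n / fact n)"
    using s y by (intro sum_le_suminf) (auto simp: sums_iff)
  then have "y ^ k \<le> fact k * exp y"
    using s by (simp add: sums_iff field_simps)
  then have "x ^ k \<le> fact k * (2 / a) ^ k * exp y"
    using assms by (simp add: y_def power_mult_distrib power_divide field_simps)
  then have "x ^ k * exp (- a * x) \<le> fact k * (2 / a) ^ k * exp y * exp (- a * x)"
    by (intro mult_right_mono) auto
  also have "\<dots> = fact k * (2 / a) ^ k * exp (- (a / 2) * x)"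
    by (simp add: y_def mult_exp_exp algebra_simps)
  finally show ?thesis .
qed

lemma half_line_power_exp_integrable:
  fixes l :: complex
  assumes "0 < Re l"
  shows "integrable lborel (\<lambda>x. indicator {0..} x *\<^sub>R (complex_of_real x ^ k * exp (- l * complex_of_real x)))"
proof (rule Bochner_Integration.integrable_bound)
  define a where "a = Re l"
  have a: "0 < a" using assms by (simp add: a_def)
  show "integrable lborel (\<lambda>x. fact k * (2 / a) ^ k * (indicator {0..} x *\<^sub>R exp (- (a / 2) * x :: real)))"
    using a by (intro integrable_mult_right exp_half_line_integrable) auto
  show "(\<lambda>x. indicator {0..} x *\<^sub>R (complex_of_real x ^ k * exp (- l * complex_of_real x))) \<in> borel_measurable lborel"
    by measurable
  have "norm (complex_of_real x ^ k * exp (- l * complex_of_real x)) \<le> fact k * (2 / a) ^ k * exp (- (a / 2) * x)"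
    if "0 \<le> x" for x
    using power_exp_bound[OF a that, of k] that by (simp add: norm_mult norm_power a_def)
  then show "AE x in lborel. norm (indicator {0..} x *\<^sub>R (complex_of_real x ^ k * exp (- l * complex_of_real x)))
       \<le> norm (fact k * (2 / a) ^ k * (indicator {0..} x *\<^sub>R exp (- (a / 2) * x)))"
    using a by (intro AE_I2) (auto simp: indicator_def norm_mult)
qed

lemma half_line_exp_integral:
  fixes l :: complex
  assumes "0 < Re l"
  shows "(LINT x|lborel. indicator {0..} x *\<^sub>R exp (- l * complex_of_real x)) = 1 / l"
    and "(LINT x|lborel. indicator {0..} x *\<^sub>R (complex_of_real x * exp (- l * complex_of_real x))) = 1 / l\<^sup>2"
proof -
  define a where "a = Re l"
  have a: "0 < a" using assms by (simp add: a_def)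
  have l0: "l \<noteq> 0" using assms by auto
  have lim: "((\<lambda>x. (p * complex_of_real x + q) * exp (- l * complex_of_real x)) \<longlongrightarrow> 0) at_top" for p q
  proof (rule Lim_null_comparison)
    show "((\<lambda>x. (cmod p * \<bar>x\<bar> + cmod q) * exp (- a * x)) \<longlongrightarrow> 0) at_top"
      using a by real_asymp
    have "norm ((p * complex_of_real x + q) * exp (- l * complex_of_real x)) \<le> (cmod p * \<bar>x\<bar> + cmod q) * exp (- a * x)" for x
      using norm_triangle_ineq[of "p * complex_of_real x" q]
      by (auto simp: norm_mult a_def intro!: mult_right_mono)
    then show "\<forall>\<^sub>F x in at_top. norm ((p * complex_of_real x + q) * exp (- l * complex_of_real x)) \<le> (cmod p * \<bar>x\<bar> + cmod q) * exp (- a * x)"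
      by simp
  qed
  have "(LINT x|lborel. indicator {0..} x *\<^sub>R exp (- l * complex_of_real x)) =
      - ((0 * complex_of_real 0 + (- 1 / l)) * exp (- l * complex_of_real 0))"
  proof (rule half_line_FTC)
    show "((\<lambda>x. (0 * complex_of_real x + (- 1 / l)) * exp (- l * complex_of_real x))
          has_vector_derivative exp (- l * complex_of_real x)) (at x)" for x
      using l0 by (auto intro!: has_vector_derivative_real_field derivative_eq_intros simp: field_simps)
    show "continuous_on UNIV (\<lambda>x. exp (- l * complex_of_real x))"
      by (intro continuous_intros)
    show "integrable lborel (\<lambda>x. indicator {0..} x *\<^sub>R exp (- l * complex_of_real x))"
      using half_line_power_exp_integrable[OF assms, of 0] by simp
  qed (rule lim)
  then show "(LINT x|lborel. indicator {0..} x *\<^sub>R exp (- l * complex_of_real x)) = 1 / l"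
    by simp
  have "(LINT x|lborel. indicator {0..} x *\<^sub>R (complex_of_real x * exp (- l * complex_of_real x))) =
      - (((- 1 / l) * complex_of_real 0 + (- 1 / l\<^sup>2)) * exp (- l * complex_of_real 0))"
  proof (rule half_line_FTC)
    show "((\<lambda>x. ((- 1 / l) * complex_of_real x + (- 1 / l\<^sup>2)) * exp (- l * complex_of_real x))
          has_vector_derivative complex_of_real x * exp (- l * complex_of_real x)) (at x)" for x
      using l0 by (auto intro!: has_vector_derivative_real_field derivative_eq_intros simp: field_simps power2_eq_square)
    show "continuous_on UNIV (\<lambda>x. complex_of_real x * exp (- l * complex_of_real x))"
      by (intro continuous_intros)
    show "integrable lborel (\<lambda>x. indicator {0..} x *\<^sub>R (complex_of_real x * exp (- l * complex_of_real x)))"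
      using half_line_power_exp_integrable[OF assms, of 1] by simp
  qed (rule lim)
  then show "(LINT x|lborel. indicator {0..} x *\<^sub>R (complex_of_real x * exp (- l * complex_of_real x))) = 1 / l\<^sup>2"
    by simp
qed

text \<open>
  The Poisson kernel of the upper half plane at height \<open>e\<close>, a probability density for \<open>e > 0\<close>.
\<close>
definition poisson :: "real \<Rightarrow> real \<Rightarrow> real" where
  "poisson e t = e / (pi * (e\<^sup>2 + t\<^sup>2))"

lemma poisson_measurable [measurable]: "poisson e \<in> borel_measurable borel"
  unfolding poisson_def[abs_def] by measurable

lemma poisson_pos: "0 < e \<Longrightarrow> 0 < poisson e t"
  unfolding poisson_def by (intro divide_pos_pos mult_pos_pos) (auto intro: add_pos_nonneg)

lemma poisson_nonneg: "0 < e \<Longrightarrow> 0 \<le> poisson e t"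
  using poisson_pos[of e t] by simp

lemma poisson_even [simp]: "poisson e (- t) = poisson e t"
  by (simp add: poisson_def)

lemma poisson_scale: "0 < e \<Longrightarrow> poisson e t = poisson 1 (t / e) / e"
proof -
  assume e: "0 < e"
  have "1 + (t / e)\<^sup>2 = (e\<^sup>2 + t\<^sup>2) / e\<^sup>2"
    using e by (simp add: power_divide add_divide_distrib)
  then have "poisson 1 (t / e) = e\<^sup>2 / (pi * (e\<^sup>2 + t\<^sup>2))"
    by (simp add: poisson_def)
  moreover have "e\<^sup>2 / X / e = e / X" for X
    using e by (simp add: power2_eq_square)
  ultimately show ?thesis by (simp add: poisson_def)
qed

lemma poisson_integral:
  assumes "0 < e"
  shows "integrable lborel (poisson e)" "(LINT t|lborel. poisson e t) = 1"
proof -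
  have "has_bochner_integral lborel (poisson 1) 1"
  proof -
    have "poisson 1 = (\<lambda>t. 1 / (1 + t\<^sup>2) / pi)"
      by (rule ext) (simp add: poisson_def mult.commute)
    moreover have "has_bochner_integral lborel (\<lambda>t::real. 1 / (1 + t\<^sup>2)) pi"
      using lorentz_integral by (simp add: has_bochner_integral_iff)
    ultimately show ?thesis
      using has_bochner_integral_divide_zero[where M = lborel and f = "\<lambda>t::real. 1 / (1 + t\<^sup>2)" and x = pi and c = pi] by simp
  qed
  then have "has_bochner_integral lborel (\<lambda>t. poisson 1 (0 + (1 / e) * t)) (1 /\<^sub>R \<bar>1 / e\<bar>)"
    using assms by (subst lborel_has_bochner_integral_real_affine_iff[symmetric]) auto
  then have "has_bochner_integral lborel (\<lambda>t. poisson 1 (t / e) / e) (e / e)"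
    using assms by (intro has_bochner_integral_divide_zero) auto
  then have "has_bochner_integral lborel (poisson e) 1"
    using assms by (simp add: poisson_scale[OF assms, abs_def])
  then show "integrable lborel (poisson e)" "(LINT t|lborel. poisson e t) = 1"
    by (auto simp: has_bochner_integral_iff)
qed

lemma poisson_shift:
  assumes "0 < e"
  shows "integrable lborel (\<lambda>y. poisson e (x - y))" "(LINT y|lborel. poisson e (x - y)) = 1"
    "integrable lborel (\<lambda>y. poisson e (y - x))" "(LINT y|lborel. poisson e (y - x)) = 1"
proof -
  show 1: "integrable lborel (\<lambda>y. poisson e (x - y))"
    using lborel_integrable_real_affine[OF poisson_integral(1)[OF assms], of "-1" x] by simp
  show 2: "(LINT y|lborel. poisson e (x - y)) = 1"
    using poisson_integral(2)[OF assms] lborel_integral_real_affine[of "-1" "poisson e" x] by simp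
  have "poisson e (y - x) = poisson e (x - y)" for y
    using poisson_even[of e "x - y"] by simp
  then show "integrable lborel (\<lambda>y. poisson e (y - x))" "(LINT y|lborel. poisson e (y - x)) = 1"
    using 1 2 by simp_all
qed

text \<open>
  The weight \<open>exp (- e \<bar>s\<bar>)\<close> will make Fourier integrals absolutely convergent. Its own transform is an
  approximate identity, which is how the Plancherel identity arises as \<open>e \<rightarrow> 0\<close>.
\<close>
lemma abs_exp_transform:
  assumes "0 < e"
  shows "integrable lborel (\<lambda>s. exp (- (\<i> * complex_of_real t * complex_of_real s)) * complex_of_real (exp (- e * \<bar>s\<bar>)))" (is ?I)
    and "(LINT s|lborel. exp (- (\<i> * complex_of_real t * complex_of_real s)) * complex_of_real (exp (- e * \<bar>s\<bar>)))
      = complex_of_real (2 * pi * poisson e t)" (is ?E)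
proof -
  define l where "l = complex_of_real e + \<i> * complex_of_real t"
  define l' where "l' = complex_of_real e - \<i> * complex_of_real t"
  have re: "0 < Re l" "0 < Re l'" using assms by (auto simp: l_def l'_def)
  define f where "f s = indicator {0..} s *\<^sub>R exp (- l * complex_of_real s)" for s :: real
  define g where "g s = indicator {0..} s *\<^sub>R exp (- l' * complex_of_real s)" for s :: real
  have f: "has_bochner_integral lborel f (1 / l)" and g: "has_bochner_integral lborel g (1 / l')"
    using half_line_power_exp_integrable[OF re(1), of 0] half_line_exp_integral(1)[OF re(1)]
      half_line_power_exp_integrable[OF re(2), of 0] half_line_exp_integral(1)[OF re(2)]
    by (auto simp: has_bochner_integral_iff f_def[abs_def] g_def[abs_def])
  have g': "has_bochner_integral lborel (\<lambda>s. g (0 + (-1) * s)) ((1 / l') /\<^sub>R \<bar>-1\<bar>)"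
    using g by (subst lborel_has_bochner_integral_real_affine_iff[symmetric]) auto
  have sum: "has_bochner_integral lborel (\<lambda>s. f s + g (0 + (-1) * s)) (1 / l + (1 / l') /\<^sub>R \<bar>-1\<bar>)"
    by (rule has_bochner_integral_add[OF f g'])
  have ae: "AE s in lborel. f s + g (0 + (-1) * s) = exp (- (\<i> * complex_of_real t * complex_of_real s)) * complex_of_real (exp (- e * \<bar>s\<bar>))"
    using AE_lborel_singleton[of 0]
  proof (rule AE_mp, intro AE_I2 impI)
    fix s :: real assume "s \<noteq> 0"
    then show "f s + g (0 + (-1) * s) = exp (- (\<i> * complex_of_real t * complex_of_real s)) * complex_of_real (exp (- e * \<bar>s\<bar>))"
      by (cases "0 < s")
        (auto simp: f_def g_def l_def l'_def indicator_def exp_of_real[symmetric] mult_exp_exp algebra_simps)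
  qed
  have m: "f \<in> borel_measurable borel" "g \<in> borel_measurable borel"
    unfolding f_def[abs_def] g_def[abs_def] by measurable
  have res: "has_bochner_integral lborel (\<lambda>s. exp (- (\<i> * complex_of_real t * complex_of_real s)) * complex_of_real (exp (- e * \<bar>s\<bar>))) (1 / l + (1 / l') /\<^sub>R \<bar>-1\<bar>)"
    by (rule iffD1[OF has_bochner_integral_cong_AE[OF _ _ ae] sum]) (use m in measurable)
  have "1 / l + 1 / l' = complex_of_real (2 * pi * poisson e t)"
  proof -
    have "l * l' = complex_of_real (e\<^sup>2 + t\<^sup>2)"
      by (simp add: l_def l'_def algebra_simps power2_eq_square)
    moreover have "l + l' = complex_of_real (2 * e)" by (simp add: l_def l'_def)
    moreover have "l \<noteq> 0" "l' \<noteq> 0" using re by auto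
    ultimately show ?thesis
      by (simp add: poisson_def add_frac_eq add.commute mult.commute)
  qed
  with res show ?I ?E by (auto simp: has_bochner_integral_iff)
qed

section \<open>The Plancherel identity on integrable functions\<close>

text \<open>
  If \<open>f\<close> is not integrable, then its integral is \<open>0\<close> by convention.
\<close>
lemma integral_norm_le:
  fixes f :: "'a \<Rightarrow> 'b :: {banach, second_countable_topology}"
  assumes "integrable M g" "\<And>x. norm (f x) \<le> g x"
  shows "norm (integral\<^sup>L M f) \<le> integral\<^sup>L M g"
proof (cases "integrable M f")
  case True
  have "norm (integral\<^sup>L M f) \<le> (LINT x|M. norm (f x))"
    by (rule integral_norm_bound)
  also have "\<dots> \<le> integral\<^sup>L M g"
    using True assms by (intro integral_mono) auto
  finally show ?thesis .
next
  case False
  have "0 \<le> integral\<^sup>L M g"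
    using order_trans[OF norm_ge_zero assms(2)] by (intro Bochner_Integration.integral_nonneg) auto
  then show ?thesis using False by (simp add: not_integrable_integral_eq)
qed

text \<open>
  The Fourier integral, meant for integrable functions; \<open>FT\<close> below is its extension to $L^2$.
\<close>
definition ft1 :: "(real \<Rightarrow> complex) \<Rightarrow> real \<Rightarrow> complex" where
  "ft1 h \<xi> = complex_of_real (1 / sqrt (2 * pi)) *
     (LINT x|lborel. exp (- (\<i> * complex_of_real \<xi> * complex_of_real x)) * h x)"

lemma ft1_integrable:
  assumes "integrable lborel h"
  shows "integrable lborel (\<lambda>x. exp (- (\<i> * complex_of_real \<xi> * complex_of_real x)) * h x)"
proof (rule Bochner_Integration.integrable_bound[OF assms])
  have [measurable]: "h \<in> borel_measurable borel" using assms by auto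
  show "(\<lambda>x. exp (- (\<i> * complex_of_real \<xi> * complex_of_real x)) * h x) \<in> borel_measurable lborel"
    by measurable
qed (simp add: norm_mult)

lemma ft1_measurable [measurable]:
  assumes [measurable]: "h \<in> borel_measurable borel"
  shows "ft1 h \<in> borel_measurable borel"
  unfolding ft1_def[abs_def] by measurable

lemma ft1_bound:
  assumes "integrable lborel h"
  shows "cmod (ft1 h \<xi>) \<le> 1 / sqrt (2 * pi) * (LINT x|lborel. cmod (h x))"
proof -
  have "cmod (LINT x|lborel. exp (- (\<i> * complex_of_real \<xi> * complex_of_real x)) * h x) \<le> (LINT x|lborel. cmod (h x))"
    using integral_norm_bound[of lborel "\<lambda>x. exp (- (\<i> * complex_of_real \<xi> * complex_of_real x)) * h x"]
    by (simp add: norm_mult)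
  then show ?thesis
    unfolding ft1_def norm_mult norm_of_real by (simp add: divide_right_mono)
qed

lemma ft1_add:
  "integrable lborel h \<Longrightarrow> integrable lborel k \<Longrightarrow> ft1 (\<lambda>x. h x + k x) \<xi> = ft1 h \<xi> + ft1 k \<xi>"
  unfolding ft1_def by (simp add: ring_distribs ft1_integrable)

lemma ft1_diff:
  "integrable lborel h \<Longrightarrow> integrable lborel k \<Longrightarrow> ft1 (\<lambda>x. h x - k x) \<xi> = ft1 h \<xi> - ft1 k \<xi>"
  unfolding ft1_def by (simp add: ring_distribs ft1_integrable)

lemma ft1_cmult: "ft1 (\<lambda>x. c * h x) \<xi> = c * ft1 h \<xi>"
  unfolding ft1_def by (simp add: mult.left_commute[of _ c])

lemma cnj_ft1:
  "cnj (ft1 h \<xi>) = complex_of_real (1 / sqrt (2 * pi)) *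
     (LINT x|lborel. exp (\<i> * complex_of_real \<xi> * complex_of_real x) * cnj (h x))"
proof -
  have "cnj (LINT x|lborel. exp (- (\<i> * complex_of_real \<xi> * complex_of_real x)) * h x)
     = (LINT x|lborel. cnj (exp (- (\<i> * complex_of_real \<xi> * complex_of_real x)) * h x))"
    by (rule Bochner_Integration.integral_cnj[symmetric])
  then show ?thesis by (simp add: ft1_def exp_cnj)
qed

lemma ft1_multiplication:
  assumes "integrable lborel h" "integrable lborel k"
  shows "(LINT \<xi>|lborel. ft1 h \<xi> * k \<xi>) = (LINT x|lborel. h x * ft1 k x)"
proof -
  have [measurable]: "h \<in> borel_measurable borel" "k \<in> borel_measurable borel" using assms by auto
  have "(LINT \<xi>|lborel. LINT x|lborel. exp (- (\<i> * complex_of_real \<xi> * complex_of_real x)) * h x * k \<xi>) =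
     (LINT x|lborel. LINT \<xi>|lborel. exp (- (\<i> * complex_of_real \<xi> * complex_of_real x)) * h x * k \<xi>)"
  proof (rule fubini_dom(1)[where A = "\<lambda>\<xi>. cmod (k \<xi>)" and D = "\<lambda>_ x. cmod (h x)"])
    show "(\<lambda>(\<xi>, x). exp (- (\<i> * complex_of_real \<xi> * complex_of_real x)) * h x * k \<xi>)
        \<in> borel_measurable (lborel \<Otimes>\<^sub>M lborel)"
      by measurable
  qed (use assms in \<open>auto simp: norm_mult\<close>)
  then have *: "(LINT \<xi>|lborel. (LINT x|lborel. exp (- (\<i> * complex_of_real \<xi> * complex_of_real x)) * h x) * k \<xi>) =
     (LINT x|lborel. h x * (LINT \<xi>|lborel. exp (- (\<i> * complex_of_real x * complex_of_real \<xi>)) * k \<xi>))"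
    by (simp add: mult_ac flip: Bochner_Integration.integral_mult_right_zero Bochner_Integration.integral_mult_left_zero)
  show ?thesis
    unfolding ft1_def
    using arg_cong[OF *, of "\<lambda>z. complex_of_real (1 / sqrt (2 * pi)) * z"]
    by (simp add: mult_ac)
qed

lemma ft1_weighted_integral:
  assumes h: "integrable lborel h" and e: "0 < e"
  shows "integrable lborel (\<lambda>\<xi>. (cmod (ft1 h \<xi>))\<^sup>2 * exp (- e * \<bar>\<xi>\<bar>))"
    and "complex_of_real (LINT \<xi>|lborel. (cmod (ft1 h \<xi>))\<^sup>2 * exp (- e * \<bar>\<xi>\<bar>)) =
      (LINT x|lborel. h x * (LINT y|lborel. cnj (h y) * complex_of_real (poisson e (x - y))))"
proof -
  have [measurable]: "h \<in> borel_measurable borel" using h by auto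
  define c where "c = 1 / sqrt (2 * pi)"
  define B where "B = c * (LINT x|lborel. cmod (h x))"
  have ftb: "cmod (ft1 h \<xi>) \<le> B" for \<xi>
    unfolding B_def c_def by (rule ft1_bound[OF h])
  have B0: "0 \<le> B" unfolding B_def c_def by simp
  have cc: "complex_of_real c * complex_of_real c = complex_of_real (1 / (2 * pi))"
    unfolding c_def of_real_mult[symmetric] by simp
  have expint: "integrable lborel (\<lambda>\<xi>. exp (- e * \<bar>\<xi>\<bar>))"
    using integrable_norm[OF abs_exp_transform(1)[OF e, of 0]] by simp
  define k where "k \<xi> = cnj (ft1 h \<xi>) * complex_of_real (exp (- e * \<bar>\<xi>\<bar>))" for \<xi>
  have k: "integrable lborel k"
  proof (rule Bochner_Integration.integrable_bound)
    show "integrable lborel (\<lambda>\<xi>. B * exp (- e * \<bar>\<xi>\<bar>))" using expint by simp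
    show "k \<in> borel_measurable lborel" unfolding k_def[abs_def] by measurable
    show "AE \<xi> in lborel. norm (k \<xi>) \<le> norm (B * exp (- e * \<bar>\<xi>\<bar>))"
      using ftb B0 by (auto simp: k_def norm_mult intro!: mult_right_mono)
  qed
  show "integrable lborel (\<lambda>\<xi>. (cmod (ft1 h \<xi>))\<^sup>2 * exp (- e * \<bar>\<xi>\<bar>))"
  proof (rule Bochner_Integration.integrable_bound)
    show "integrable lborel (\<lambda>\<xi>. B\<^sup>2 * exp (- e * \<bar>\<xi>\<bar>))" using expint by simp
    show "(\<lambda>\<xi>. (cmod (ft1 h \<xi>))\<^sup>2 * exp (- e * \<bar>\<xi>\<bar>)) \<in> borel_measurable lborel" by measurable
    show "AE \<xi> in lborel. norm ((cmod (ft1 h \<xi>))\<^sup>2 * exp (- e * \<bar>\<xi>\<bar>)) \<le> norm (B\<^sup>2 * exp (- e * \<bar>\<xi>\<bar>))"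
      using ftb by (auto intro!: mult_right_mono power_mono)
  qed
  have ftk: "ft1 k x = (LINT y|lborel. cnj (h y) * complex_of_real (poisson e (x - y)))" for x
  proof -
    have "(LINT \<xi>|lborel. exp (- (\<i> * complex_of_real x * complex_of_real \<xi>)) * k \<xi>) =
      (LINT \<xi>|lborel. complex_of_real c * (LINT y|lborel. exp (- (\<i> * complex_of_real x * complex_of_real \<xi>)) * exp (\<i> * complex_of_real \<xi> * complex_of_real y) * cnj (h y) * complex_of_real (exp (- e * \<bar>\<xi>\<bar>))))"
      unfolding k_def cnj_ft1 c_def[symmetric]
      by (simp add: mult_ac flip: Bochner_Integration.integral_mult_right_zero Bochner_Integration.integral_mult_left_zero)
    also have "\<dots> = (LINT \<xi>|lborel. complex_of_real c * (LINT y|lborel. exp (- (\<i> * complex_of_real (x - y) * complex_of_real \<xi>)) * complex_of_real (exp (- e * \<bar>\<xi>\<bar>)) * cnj (h y)))"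
      by (simp add: mult_exp_exp algebra_simps)
    also have "\<dots> = complex_of_real c * (LINT \<xi>|lborel. LINT y|lborel. exp (- (\<i> * complex_of_real (x - y) * complex_of_real \<xi>)) * complex_of_real (exp (- e * \<bar>\<xi>\<bar>)) * cnj (h y))"
      by simp
    also have "(LINT \<xi>|lborel. LINT y|lborel. exp (- (\<i> * complex_of_real (x - y) * complex_of_real \<xi>)) * complex_of_real (exp (- e * \<bar>\<xi>\<bar>)) * cnj (h y)) =
       (LINT y|lborel. LINT \<xi>|lborel. exp (- (\<i> * complex_of_real (x - y) * complex_of_real \<xi>)) * complex_of_real (exp (- e * \<bar>\<xi>\<bar>)) * cnj (h y))"
    proof (rule fubini_dom(1)[where A = "\<lambda>\<xi>. exp (- e * \<bar>\<xi>\<bar>)" and D = "\<lambda>_ y. cmod (h y)"])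
      show "(\<lambda>(\<xi>, y). exp (- (\<i> * complex_of_real (x - y) * complex_of_real \<xi>)) * complex_of_real (exp (- e * \<bar>\<xi>\<bar>)) * cnj (h y))
        \<in> borel_measurable (lborel \<Otimes>\<^sub>M lborel)"
        by measurable
    qed (use expint h in \<open>auto simp: norm_mult\<close>)
    also have "\<dots> = (LINT y|lborel. complex_of_real (2 * pi) * (cnj (h y) * complex_of_real (poisson e (x - y))))"
      by (intro Bochner_Integration.integral_cong refl)
        (simp only: Bochner_Integration.integral_mult_left_zero abs_exp_transform(2)[OF e], simp)
    also have "complex_of_real c * \<dots> = complex_of_real c * (complex_of_real (2 * pi) * (LINT y|lborel. cnj (h y) * complex_of_real (poisson e (x - y))))"
      by simp
    finally have "ft1 k x = complex_of_real c * complex_of_real c * complex_of_real (2 * pi) * (LINT y|lborel. cnj (h y) * complex_of_real (poisson e (x - y)))"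
      unfolding ft1_def c_def[symmetric] by (simp add: mult.assoc)
    also have "complex_of_real c * complex_of_real c * complex_of_real (2 * pi) = 1"
      by (simp only: cc) simp
    finally show ?thesis by simp
  qed
  have "complex_of_real (LINT \<xi>|lborel. (cmod (ft1 h \<xi>))\<^sup>2 * exp (- e * \<bar>\<xi>\<bar>)) =
     (LINT \<xi>|lborel. complex_of_real ((cmod (ft1 h \<xi>))\<^sup>2 * exp (- e * \<bar>\<xi>\<bar>)))"
    by (simp del: of_real_mult of_real_power)
  also have "\<dots> = (LINT \<xi>|lborel. ft1 h \<xi> * k \<xi>)"
    by (intro Bochner_Integration.integral_cong refl)
      (simp add: k_def complex_norm_square[symmetric] mult.assoc[symmetric] del: of_real_power)
  also have "\<dots> = (LINT x|lborel. h x * ft1 k x)"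
    by (rule ft1_multiplication[OF h k])
  finally show "complex_of_real (LINT \<xi>|lborel. (cmod (ft1 h \<xi>))\<^sup>2 * exp (- e * \<bar>\<xi>\<bar>)) =
      (LINT x|lborel. h x * (LINT y|lborel. cnj (h y) * complex_of_real (poisson e (x - y))))"
    by (simp add: ftk)
qed

text \<open>
  By the previous formula the left side is a double integral of \<open>h x * cnj (h y) * poisson e (x - y)\<close>. Since
  \<open>2 \<bar>h x\<bar> \<bar>h y\<bar> \<le> \<bar>h x\<bar>\<^sup>2 + \<bar>h y\<bar>\<^sup>2\<close> and the kernel has mass \<open>1\<close> in either variable, it is at most the squared norm.
\<close>
lemma ft1_weighted_le:
  assumes h: "integrable lborel h" "h \<in> sqint" and e: "0 < e"
  shows "(LINT \<xi>|lborel. (cmod (ft1 h \<xi>))\<^sup>2 * exp (- e * \<bar>\<xi>\<bar>)) \<le> nsq h"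
proof -
  have [measurable]: "h \<in> borel_measurable borel" using h by auto
  define D where "D x = (LINT y|lborel. (cmod (h y))\<^sup>2 * poisson e (x - y))" for x
  have "(LINT y|lborel. LINT x|lborel. (cmod (h y))\<^sup>2 * poisson e (x - y)) = (LINT x|lborel. D x)"
    and D: "integrable lborel D"
    unfolding D_def
    by (rule fubini_dom[where A = "\<lambda>y. (cmod (h y))\<^sup>2" and D = "\<lambda>y x. poisson e (x - y)"];
        use e h sqint_integrable poisson_shift[OF e] poisson_nonneg[OF e] in auto)+
  then have Dint: "(LINT x|lborel. D x) = nsq h"
    using poisson_shift[OF e] by (simp add: nsq_def)
  have ipy: "integrable lborel (\<lambda>y. (cmod (h y))\<^sup>2 * poisson e (x - y))" for x
  proof (rule Bochner_Integration.integrable_bound)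
    show "integrable lborel (\<lambda>y. (cmod (h y))\<^sup>2 * poisson e 0)" using h by (simp add: sqint_integrable)
    show "(\<lambda>y. (cmod (h y))\<^sup>2 * poisson e (x - y)) \<in> borel_measurable lborel" by measurable
    have "poisson e t \<le> poisson e 0" for t
      using e unfolding poisson_def by (intro divide_left_mono) (auto intro!: mult_pos_pos add_pos_nonneg)
    then show "AE y in lborel. norm ((cmod (h y))\<^sup>2 * poisson e (x - y)) \<le> norm ((cmod (h y))\<^sup>2 * poisson e 0)"
      using poisson_nonneg[OF e] by (auto simp: abs_mult intro!: mult_left_mono)
  qed
  have pt: "cmod (h x * (LINT y|lborel. cnj (h y) * complex_of_real (poisson e (x - y)))) \<le> (cmod (h x))\<^sup>2 / 2 + D x / 2" for x
  proof -
    have "cmod (h x * (LINT y|lborel. cnj (h y) * complex_of_real (poisson e (x - y)))) =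
       cmod (LINT y|lborel. h x * (cnj (h y) * complex_of_real (poisson e (x - y))))"
      by simp
    also have "\<dots> \<le> (LINT y|lborel. (cmod (h x))\<^sup>2 / 2 * poisson e (x - y) + (cmod (h y))\<^sup>2 * poisson e (x - y) / 2)"
    proof (rule integral_norm_le)
      show "integrable lborel (\<lambda>y. (cmod (h x))\<^sup>2 / 2 * poisson e (x - y) + (cmod (h y))\<^sup>2 * poisson e (x - y) / 2)"
        using poisson_shift[OF e] ipy by simp
      have "a * b * p \<le> a\<^sup>2 / 2 * p + b\<^sup>2 * p / 2" if "0 \<le> p" for a b p :: real
      proof -
        have "0 \<le> (a - b)\<^sup>2 * p" using that by simp
        then show ?thesis by (simp add: power2_eq_square algebra_simps)
      qed
      then show "norm (h x * (cnj (h y) * complex_of_real (poisson e (x - y)))) \<le> (cmod (h x))\<^sup>2 / 2 * poisson e (x - y) + (cmod (h y))\<^sup>2 * poisson e (x - y) / 2" for y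
        using poisson_nonneg[OF e] by (auto simp: norm_mult mult.assoc[symmetric])
    qed
    also have "\<dots> = (cmod (h x))\<^sup>2 / 2 + D x / 2"
      using poisson_shift[OF e] ipy by (simp add: D_def)
    finally show ?thesis .
  qed
  have "(LINT \<xi>|lborel. (cmod (ft1 h \<xi>))\<^sup>2 * exp (- e * \<bar>\<xi>\<bar>)) \<le>
     cmod (complex_of_real (LINT \<xi>|lborel. (cmod (ft1 h \<xi>))\<^sup>2 * exp (- e * \<bar>\<xi>\<bar>)))"
    by simp
  also have "\<dots> \<le> (LINT x|lborel. (cmod (h x))\<^sup>2 / 2 + D x / 2)"
    unfolding ft1_weighted_integral(2)[OF h(1) e]
    by (rule integral_norm_le) (use pt D h sqint_integrable in auto)
  also have "\<dots> = nsq h" using D h sqint_integrable Dint by (simp add: nsq_def)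
  finally show ?thesis .
qed

lemma inv_Suc_tendsto: "(\<lambda>n. 1 / real (Suc n)) \<longlonglongrightarrow> 0"
  using LIMSEQ_inverse_real_of_nat by (simp add: inverse_eq_divide)

lemma exp_weight_tendsto: "(\<lambda>n. exp (- (1 / real (Suc n)) * \<bar>x\<bar>)) \<longlonglongrightarrow> 1"
proof -
  have "(\<lambda>n. exp (- (1 / real (Suc n)) * \<bar>x\<bar>)) \<longlonglongrightarrow> exp (- 0 * \<bar>x\<bar>)"
    by (intro tendsto_intros inv_Suc_tendsto)
  then show ?thesis by simp
qed

text \<open>
  The weights increase to \<open>1\<close>, so monotone convergence turns the weighted estimate into Bessel's inequality.
\<close>
lemma ft1_bessel:
  assumes h: "integrable lborel h" "h \<in> sqint"
  shows "ft1 h \<in> sqint"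
    and "(\<lambda>n. LINT \<xi>|lborel. (cmod (ft1 h \<xi>))\<^sup>2 * exp (- (1 / real (Suc n)) * \<bar>\<xi>\<bar>)) \<longlonglongrightarrow> nsq (ft1 h)"
    and "nsq (ft1 h) \<le> nsq h"
proof -
  have [measurable]: "h \<in> borel_measurable borel" using h by auto
  let ?s = "\<lambda>n \<xi>. (cmod (ft1 h \<xi>))\<^sup>2 * exp (- (1 / real (Suc n)) * \<bar>\<xi>\<bar>)"
  have int: "integrable lborel (?s n)" for n
    by (rule ft1_weighted_integral(1)[OF h(1)]) simp
  have le: "integral\<^sup>L lborel (?s n) \<le> nsq h" for n
    by (rule ft1_weighted_le[OF h]) simp
  have mono: "mono (\<lambda>n. ?s n \<xi>)" for \<xi>
    by (intro monoI mult_left_mono) (auto intro!: mult_right_mono frac_le)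
  have lim: "(\<lambda>n. ?s n \<xi>) \<longlonglongrightarrow> (cmod (ft1 h \<xi>))\<^sup>2" for \<xi>
    using tendsto_mult[OF tendsto_const exp_weight_tendsto, of "(cmod (ft1 h \<xi>))\<^sup>2" \<xi>] by simp
  have incs: "incseq (\<lambda>n. integral\<^sup>L lborel (?s n))"
    by (intro monoI integral_mono int monoD[OF mono])
  then obtain L where L: "(\<lambda>n. integral\<^sup>L lborel (?s n)) \<longlonglongrightarrow> L"
    using incseq_convergent[OF incs, of "nsq h"] le by blast
  have m: "(\<lambda>\<xi>. (cmod (ft1 h \<xi>))\<^sup>2) \<in> borel_measurable lborel" by measurable
  have mc: "integrable lborel (\<lambda>\<xi>. (cmod (ft1 h \<xi>))\<^sup>2)" "nsq (ft1 h) = L"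
    unfolding nsq_def
    using integrable_monotone_convergence[OF int _ _ L m] integral_monotone_convergence[OF int _ _ L m]
      mono lim by auto
  then show 1: "ft1 h \<in> sqint" by (simp add: sqint_def)
  show 2: "(\<lambda>n. integral\<^sup>L lborel (?s n)) \<longlonglongrightarrow> nsq (ft1 h)" using L mc by simp
  show "nsq (ft1 h) \<le> nsq h" using LIMSEQ_le_const2[OF 2] le by blast
qed

lemma poisson_approx_identity:
  fixes k :: "real \<Rightarrow> complex"
  assumes k: "continuous_on UNIV k" "\<And>x. cmod (k x) \<le> B"
  shows "(\<lambda>n. LINT y|lborel. k y * complex_of_real (poisson (1 / real (Suc n)) (x - y))) \<longlonglongrightarrow> k x"
proof -
  have [measurable]: "k \<in> borel_measurable borel" by (rule borel_measurable_continuous_onI[OF k(1)])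
  have eq: "(LINT y|lborel. k y * complex_of_real (poisson e (x - y))) = (LINT v|lborel. k (x - e * v) * complex_of_real (poisson 1 v))"
    if e: "0 < e" for e
  proof -
    have p: "poisson e (e * v) = poisson 1 v / e" for v
      using poisson_scale[OF e, of "e * v"] e by simp
    have "(LINT y|lborel. k y * complex_of_real (poisson e (x - y))) =
        e *\<^sub>R (LINT v|lborel. k (x - e * v) * complex_of_real (poisson 1 v) / complex_of_real e)"
      using lborel_integral_real_affine[of "- e" "\<lambda>y. k y * complex_of_real (poisson e (x - y))" x] e
      by (simp add: p)
    then show ?thesis
      using e by (simp only: Bochner_Integration.integral_divide_zero) (simp add: scaleR_conv_of_real)
  qed
  have "(\<lambda>n. LINT v|lborel. k (x - 1 / real (Suc n) * v) * complex_of_real (poisson 1 v)) \<longlonglongrightarrow>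
     (LINT v|lborel. k x * complex_of_real (poisson 1 v))"
  proof (rule integral_dominated_convergence[where w = "\<lambda>v. B * poisson 1 v"])
    show "AE v in lborel. (\<lambda>n. k (x - 1 / real (Suc n) * v) * complex_of_real (poisson 1 v)) \<longlonglongrightarrow> k x * complex_of_real (poisson 1 v)"
    proof (rule AE_I2)
      fix v
      have "(\<lambda>n. x - 1 / real (Suc n) * v) \<longlonglongrightarrow> x - 0 * v"
        by (intro tendsto_intros inv_Suc_tendsto)
      then have "(\<lambda>n. k (x - 1 / real (Suc n) * v)) \<longlonglongrightarrow> k x"
        using continuous_on_tendsto_compose[OF k(1), of "\<lambda>n. x - 1 / real (Suc n) * v" x sequentially] by simp
      then show "(\<lambda>n. k (x - 1 / real (Suc n) * v) * complex_of_real (poisson 1 v)) \<longlonglongrightarrow> k x * complex_of_real (poisson 1 v)"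
        by (intro tendsto_intros)
    qed
    show "AE v in lborel. norm (k (x - 1 / real (Suc n) * v) * complex_of_real (poisson 1 v)) \<le> B * poisson 1 v" for n
      using k(2) poisson_nonneg[of 1] by (auto simp: norm_mult intro!: mult_right_mono)
  qed (use poisson_integral(1)[of 1] in auto)
  moreover have "(LINT v|lborel. k x * complex_of_real (poisson 1 v)) = k x"
    using poisson_integral(2)[of 1] by simp
  ultimately have "(\<lambda>n. LINT v|lborel. k (x - 1 / real (Suc n) * v) * complex_of_real (poisson 1 v)) \<longlonglongrightarrow> k x"
    by (simp only:)
  then show ?thesis by (simp add: eq)
qed

text \<open>
  For continuous bounded \<open>h\<close> the Poisson means converge pointwise to \<open>h\<close>, so the weighted integrals
  converge to the squared norm.
\<close>
lemma ft1_plancherel_continuous: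
  assumes h: "integrable lborel h" "h \<in> sqint" "continuous_on UNIV h" "\<And>x. cmod (h x) \<le> B"
  shows "nsq (ft1 h) = nsq h"
proof -
  have [measurable]: "h \<in> borel_measurable borel" using h by auto
  have B: "0 \<le> B" using order_trans[OF norm_ge_zero h(4)[of 0]] .
  let ?e = "\<lambda>n. 1 / real (Suc n)"
  let ?k = "\<lambda>n x. LINT y|lborel. cnj (h y) * complex_of_real (poisson (?e n) (x - y))"
  have "(\<lambda>n. LINT x|lborel. h x * ?k n x) \<longlonglongrightarrow> (LINT x|lborel. h x * cnj (h x))"
  proof (rule integral_dominated_convergence[where w = "\<lambda>x. cmod (h x) * B"])
    show "AE x in lborel. (\<lambda>n. h x * ?k n x) \<longlonglongrightarrow> h x * cnj (h x)"
      by (intro AE_I2 tendsto_mult[OF tendsto_const] poisson_approx_identity[where B = B])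
        (use h in \<open>auto intro: continuous_on_cnj\<close>)
    show "AE x in lborel. norm (h x * ?k n x) \<le> cmod (h x) * B" for n
    proof (rule AE_I2)
      fix x
      have "norm (?k n x) \<le> (LINT y|lborel. B * poisson (?e n) (x - y))"
        using poisson_shift[of "?e n"] poisson_nonneg[of "?e n"] h(4)
        by (intro integral_norm_le) (auto simp: norm_mult intro!: mult_right_mono)
      then have "norm (?k n x) \<le> B" using poisson_shift[of "?e n"] by simp
      then show "norm (h x * ?k n x) \<le> cmod (h x) * B" by (simp add: norm_mult mult_left_mono)
    qed
  qed (use h in auto)
  moreover have "(\<lambda>n. LINT x|lborel. h x * ?k n x) = (\<lambda>n. complex_of_real (LINT \<xi>|lborel. (cmod (ft1 h \<xi>))\<^sup>2 * exp (- ?e n * \<bar>\<xi>\<bar>)))"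
    by (intro ext ft1_weighted_integral(2)[OF h(1), symmetric]) simp
  moreover have "(LINT x|lborel. h x * cnj (h x)) = complex_of_real (nsq h)"
    using ip_self[of h] by (simp add: ip_def mult.commute)
  ultimately have "(\<lambda>n. complex_of_real (LINT \<xi>|lborel. (cmod (ft1 h \<xi>))\<^sup>2 * exp (- ?e n * \<bar>\<xi>\<bar>))) \<longlonglongrightarrow> complex_of_real (nsq h)"
    by simp
  then have "(\<lambda>n. LINT \<xi>|lborel. (cmod (ft1 h \<xi>))\<^sup>2 * exp (- ?e n * \<bar>\<xi>\<bar>)) \<longlonglongrightarrow> nsq h"
    unfolding tendsto_of_real_iff .
  with ft1_bessel(2)[OF h(1,2)] show ?thesis by (rule LIMSEQ_unique)
qed

text \<open>
  A measurable function is almost everywhere a limit of continuous functions. If it is bounded and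
  vanishes off an interval, the continuous functions can be cut off accordingly, and then the convergence is dominated.
\<close>
lemma sqint_dense_continuous:
  assumes h: "h \<in> sqint" and e: "0 < e"
  obtains k B where "integrable lborel k" "k \<in> sqint" "continuous_on UNIV k" "\<And>x. cmod (k x) \<le> B"
    "nsq (\<lambda>x. k x - h x) < e"
proof -
  have [measurable]: "h \<in> borel_measurable borel" using h by auto
  define H where "H n x = (if \<bar>x\<bar> \<le> real n \<and> cmod (h x) \<le> real n then h x else 0)" for n x
  have Hm [measurable]: "H n \<in> borel_measurable borel" for n
    unfolding H_def[abs_def] by (rule measurable_If) auto
  have "L2lim H h sequentially"
  proof (rule L2lim_dominated[OF h])
    show "cmod (H n x - h x) \<le> cmod (h x)" for n x by (simp add: H_def)
    show "AE x in lborel. (\<lambda>n. H n x) \<longlonglongrightarrow> h x"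
    proof (rule AE_I2)
      fix x
      have "eventually (\<lambda>n. H n x = h x) sequentially"
        using eventually_ge_at_top[of "nat \<lceil>max \<bar>x\<bar> (cmod (h x))\<rceil>"]
        by eventually_elim (auto simp: H_def)
      then show "(\<lambda>n. H n x) \<longlonglongrightarrow> h x" by (rule tendsto_eventually)
    qed
  qed auto
  from order_tendstoD(2)[OF this[unfolded L2lim_def], of "e / 4"] e
  have "eventually (\<lambda>n. nsq (\<lambda>x. H n x - h x) < e / 4) sequentially"
    by simp
  then obtain n0 where n0: "\<And>n. n \<ge> n0 \<Longrightarrow> nsq (\<lambda>x. H n x - h x) < e / 4"
    by (auto simp: eventually_sequentially)
  define n where "n = Suc n0"
  have n: "nsq (\<lambda>x. H n x - h x) < e / 4" "1 \<le> n" using n0[of n] by (auto simp: n_def)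
  have Hs: "H n \<in> sqint"
    by (rule sqint_dominated[OF h, where C = 1]) (auto simp: H_def)
  have "H n \<in> borel_measurable lebesgue"
    using measurable_completion[of "H n" lborel borel] Hm[of n] by simp
  then have "H n measurable_on UNIV"
    by (intro lebesgue_measurable_imp_measurable_on) auto
  then obtain N g where N: "negligible N" and g: "\<And>m. continuous_on UNIV (g m)"
      "\<And>x. x \<notin> N \<Longrightarrow> (\<lambda>m. g m x) \<longlonglongrightarrow> H n x"
    by (auto simp: measurable_on_def)
  \<comment> \<open>Cutting off in space and in value keeps the approximants continuous and dominated.\<close>
  define cut where "cut x = max 0 (min 1 (real n + 1 - \<bar>x\<bar>))" for x :: real
  define k where "k m x = complex_of_real (cut x * (real n / max (real n) (cmod (g m x)))) * g m x" for m x
  have kc: "continuous_on UNIV (k m)" for m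
    unfolding k_def cut_def using n(2) by (intro continuous_intros g) auto
  have [measurable]: "k m \<in> borel_measurable borel" for m
    by (rule borel_measurable_continuous_onI[OF kc])
  have kb: "cmod (k m x) \<le> real n * (if \<bar>x\<bar> \<le> real n + 1 then 1 else 0)" for m x
  proof -
    have a: "0 \<le> cut x" "cut x \<le> (if \<bar>x\<bar> \<le> real n + 1 then 1 else 0)" by (auto simp: cut_def)
    have b: "real n / max (real n) (cmod (g m x)) * cmod (g m x) \<le> real n"
    proof -
      have "cmod (g m x) \<le> max (real n) (cmod (g m x))" "0 < max (real n) (cmod (g m x))"
        using n(2) by auto
      then show ?thesis
        by (simp add: pos_divide_le_eq mult_left_mono)
    qed
    have "cmod (k m x) = cut x * (real n / max (real n) (cmod (g m x)) * cmod (g m x))"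
      using a n(2) by (simp add: k_def norm_mult norm_divide)
    also have "\<dots> \<le> (if \<bar>x\<bar> \<le> real n + 1 then 1 else 0) * real n"
      using a b by (intro mult_mono) auto
    finally show ?thesis by (simp add: mult.commute)
  qed
  define w where "w x = complex_of_real (2 * real n) * indicator {- (real n + 1)..real n + 1} x" for x
  have w: "w \<in> sqint"
  proof -
    have "(cmod (w x))\<^sup>2 = (2 * real n)\<^sup>2 * indicator {- (real n + 1)..real n + 1} x" for x
      by (simp add: w_def indicator_def)
    moreover have "integrable lborel (indicator {- (real n + 1)..real n + 1} :: real \<Rightarrow> real)"
      by (intro integrable_real_indicator) (auto simp: emeasure_lborel_Icc_eq)
    moreover have "w \<in> borel_measurable borel" unfolding w_def[abs_def] by measurable
    ultimately show ?thesis by (simp add: sqint_def)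
  qed
  have kw: "cmod (k m x) \<le> cmod (w x)" for m x
    using kb[of m x] by (auto simp: w_def indicator_def norm_mult abs_le_iff split: if_splits)
  have "L2lim k (H n) sequentially"
  proof (rule L2lim_dominated[OF w])
    fix m x
    have "cmod (k m x - H n x) \<le> cmod (k m x) + cmod (H n x)" by (rule norm_triangle_ineq4)
    also have "\<dots> \<le> cmod (w x)"
      using kb[of m x] by (auto simp: w_def indicator_def norm_mult H_def abs_le_iff split: if_splits)
    finally show "cmod (k m x - H n x) \<le> cmod (w x)" .
  next
    have "AE x in lebesgue. x \<notin> N"
      using N by (auto simp: negligible_iff_null_sets intro: AE_not_in)
    then have "AE x in lborel. x \<notin> N" by (simp add: AE_completion_iff)
    then show "AE x in lborel. (\<lambda>m. k m x) \<longlonglongrightarrow> H n x"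
    proof (rule AE_mp, intro AE_I2 impI)
      fix x assume x: "x \<notin> N"
      have mx: "max (real n) (cmod (H n x)) = real n" by (simp add: H_def)
      have "(\<lambda>m. k m x) \<longlonglongrightarrow> complex_of_real (cut x * (real n / max (real n) (cmod (H n x)))) * H n x"
        unfolding k_def using n(2) by (intro tendsto_intros g x) auto
      moreover have "complex_of_real (cut x * (real n / max (real n) (cmod (H n x)))) * H n x = H n x"
        unfolding mx using n(2) by (auto simp: H_def cut_def)
      ultimately show "(\<lambda>m. k m x) \<longlonglongrightarrow> H n x" by simp
    qed
  qed auto
  from order_tendstoD(2)[OF this[unfolded L2lim_def], of "e / 4"] e
  have "eventually (\<lambda>m. nsq (\<lambda>x. k m x - H n x) < e / 4) sequentially"
    by simp
  then obtain m where m: "nsq (\<lambda>x. k m x - H n x) < e / 4"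
    using eventually_happens by (auto simp: eventually_sequentially)
  have ks: "k m \<in> sqint"
    by (rule sqint_dominated[OF w, where C = 1]) (auto simp: kw)
  have "integrable lborel (k m)"
  proof -
    have "trunc (real n + 1) (k m) = k m"
    proof
      fix x
      show "trunc (real n + 1) (k m) x = k m x"
        using kb[of m x] by (auto simp: trunc_def)
    qed
    then show ?thesis using trunc_integrable[OF ks, of "real n + 1"] by simp
  qed
  moreover have "cmod (k m x) \<le> real n" for x using kb[of m x] by (auto split: if_splits)
  moreover have "nsq (\<lambda>x. k m x - h x) < e"
    using nsq_triangle[OF ks Hs h] m n by simp
  ultimately show ?thesis using that ks kc by blast
qed

text \<open>
  Bessel's inequality makes \<open>ft1\<close> continuous for the $L^2$ norm, so the identity extends from
  continuous functions by density.
\<close>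
lemma ft1_plancherel:
  assumes h: "integrable lborel h" "h \<in> sqint"
  shows "nsq (ft1 h) = nsq h"
proof -
  have "\<exists>k. integrable lborel k \<and> k \<in> sqint \<and> nsq (ft1 k) = nsq k \<and> nsq (\<lambda>x. k x - h x) < 1 / real (Suc n)" for n
  proof -
    obtain k B where k: "integrable lborel k" "k \<in> sqint" "continuous_on UNIV k" "\<And>x. cmod (k x) \<le> B"
      "nsq (\<lambda>x. k x - h x) < 1 / real (Suc n)"
      using sqint_dense_continuous[OF h(2), of "1 / real (Suc n)"] by auto
    then show ?thesis using ft1_plancherel_continuous[OF k(1-4)] by blast
  qed
  then obtain k where k: "\<And>n. integrable lborel (k n)" "\<And>n. k n \<in> sqint" "\<And>n. nsq (ft1 (k n)) = nsq (k n)"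
    "\<And>n. nsq (\<lambda>x. k n x - h x) < 1 / real (Suc n)" by metis
  have lim: "L2lim k h sequentially"
    unfolding L2lim_def
    by (rule tendsto_sandwich[OF _ _ tendsto_const inv_Suc_tendsto]) (use k(4) in \<open>auto intro!: always_eventually less_imp_le\<close>)
  have "ft1 (\<lambda>x. k n x - h x) = (\<lambda>x. ft1 (k n) x - ft1 h x)" for n
    by (rule ext, rule ft1_diff[OF k(1) h(1)])
  then have "nsq (\<lambda>x. ft1 (k n) x - ft1 h x) \<le> nsq (\<lambda>x. k n x - h x)" for n
    using ft1_bessel(3)[OF Bochner_Integration.integrable_diff[OF k(1)[of n] h(1)] sqint_diff[OF k(2) h(2)]]
    by simp
  then have "L2lim (\<lambda>n. ft1 (k n)) (ft1 h) sequentially"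
    using lim unfolding L2lim_def
    by (intro tendsto_sandwich[OF _ _ tendsto_const lim[unfolded L2lim_def]]) (auto intro!: always_eventually)
  from L2lim_nsq[OF this] have 1: "(\<lambda>n. nsq (k n)) \<longlonglongrightarrow> nsq (ft1 h)"
    using ft1_bessel(1) h k by simp
  show ?thesis
    by (rule LIMSEQ_unique[OF 1 L2lim_nsq[OF lim h(2) k(2)]])
qed

section \<open>The Fourier transform on square integrable functions\<close>

definition FT :: "(real \<Rightarrow> complex) \<Rightarrow> real \<Rightarrow> complex" where
  "FT \<psi> = (SOME \<phi>. \<phi> \<in> sqint \<and> L2lim (\<lambda>R. ft1 (trunc R \<psi>)) \<phi> at_top)"

lemma ft1_trunc_sqint: "\<psi> \<in> sqint \<Longrightarrow> ft1 (trunc R \<psi>) \<in> sqint"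
  by (intro ft1_bessel(1) trunc_integrable trunc_sqint)

lemma nsq_ft1_diff:
  assumes "integrable lborel h" "h \<in> sqint" "integrable lborel k" "k \<in> sqint"
  shows "nsq (\<lambda>x. ft1 h x - ft1 k x) = nsq (\<lambda>x. h x - k x)"
proof -
  have "ft1 (\<lambda>x. h x - k x) = (\<lambda>x. ft1 h x - ft1 k x)"
    by (rule ext, rule ft1_diff) (use assms in auto)
  then show ?thesis
    using ft1_plancherel[OF Bochner_Integration.integrable_diff[OF assms(1,3)] sqint_diff[OF assms(2,4)]] by simp
qed

text \<open>
  The Plancherel identity turns the truncations of \<open>\<psi>\<close>, which converge, into a Cauchy family of transforms.
\<close>
lemma FT_exists:
  assumes \<psi>: "\<psi> \<in> sqint"
  shows "\<exists>\<phi>. \<phi> \<in> sqint \<and> L2lim (\<lambda>R. ft1 (trunc R \<psi>)) \<phi> at_top"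
proof -
  have d: "nsq (\<lambda>x. ft1 (trunc R \<psi>) x - ft1 (trunc S \<psi>) x) \<le>
      2 * nsq (\<lambda>x. trunc R \<psi> x - \<psi> x) + 2 * nsq (\<lambda>x. trunc S \<psi> x - \<psi> x)" for R S
    using nsq_triangle[OF trunc_sqint[OF \<psi>] \<psi> trunc_sqint[OF \<psi>], of R S] nsq_swap[of \<psi> "trunc S \<psi>"]
    by (simp add: nsq_ft1_diff trunc_sqint trunc_integrable \<psi>)
  have ev: "\<exists>R0. \<forall>R\<ge>R0. nsq (\<lambda>x. trunc R \<psi> x - \<psi> x) < e" if "0 < e" for e
    using order_tendstoD(2)[OF trunc_L2lim[OF \<psi>, unfolded L2lim_def] that]
    by (simp add: eventually_at_top_linorder)
  have "\<exists>N::nat. \<forall>i\<ge>N. \<forall>j\<ge>N. nsq (\<lambda>x. ft1 (trunc (real i) \<psi>) x - ft1 (trunc (real j) \<psi>) x) < e"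
    if e: "0 < e" for e
  proof -
    obtain R0 where R0: "\<And>R. R \<ge> R0 \<Longrightarrow> nsq (\<lambda>x. trunc R \<psi> x - \<psi> x) < e / 4"
      using ev[of "e / 4"] e by auto
    have "nsq (\<lambda>x. ft1 (trunc (real i) \<psi>) x - ft1 (trunc (real j) \<psi>) x) < e"
      if "i \<ge> nat \<lceil>R0\<rceil>" "j \<ge> nat \<lceil>R0\<rceil>" for i j
      using d[of "real i" "real j"] R0[of "real i"] R0[of "real j"] that by linarith
    then show ?thesis by blast
  qed
  then obtain \<phi> where \<phi>: "\<phi> \<in> sqint" "L2lim (\<lambda>n. ft1 (trunc (real n) \<psi>)) \<phi> sequentially"
    using L2_complete[of "\<lambda>n. ft1 (trunc (real n) \<psi>)"] ft1_trunc_sqint[OF \<psi>] by metis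
  have "((\<lambda>R. nsq (\<lambda>x. ft1 (trunc R \<psi>) x - \<phi> x)) \<longlongrightarrow> 0) at_top"
  proof (rule tendstoI)
    fix e :: real assume e: "0 < e"
    obtain R0 where R0: "\<And>R. R \<ge> R0 \<Longrightarrow> nsq (\<lambda>x. trunc R \<psi> x - \<psi> x) < e / 10"
      using ev[of "e / 10"] e by auto
    have "eventually (\<lambda>n. nsq (\<lambda>x. ft1 (trunc (real n) \<psi>) x - \<phi> x) < e / 10) sequentially"
      using order_tendstoD(2)[OF \<phi>(2)[unfolded L2lim_def], of "e / 10"] e by simp
    then have "eventually (\<lambda>n. nsq (\<lambda>x. ft1 (trunc (real n) \<psi>) x - \<phi> x) < e / 10 \<and> real n \<ge> R0) sequentially"
      using filterlim_real_sequentially[unfolded filterlim_at_top, rule_format, of R0]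
      by eventually_elim auto
    then obtain n where n: "nsq (\<lambda>x. ft1 (trunc (real n) \<psi>) x - \<phi> x) < e / 10" "real n \<ge> R0"
      by (auto simp: eventually_sequentially)
    have "nsq (\<lambda>x. ft1 (trunc R \<psi>) x - \<phi> x) < e" if "R \<ge> R0" for R
      using nsq_triangle[OF ft1_trunc_sqint[OF \<psi>] ft1_trunc_sqint[OF \<psi>] \<phi>(1), of R "real n"]
        d[of R "real n"] R0[OF that] R0[OF n(2)] n(1) by linarith
    then show "\<forall>\<^sub>F R in at_top. dist (nsq (\<lambda>x. ft1 (trunc R \<psi>) x - \<phi> x)) 0 < e"
      by (intro eventually_mono[OF eventually_ge_at_top[of R0]]) (simp add: dist_real_def)
  qed
  with \<phi>(1) show ?thesis by (auto simp: L2lim_def)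
qed

lemma FT_sqint: "\<psi> \<in> sqint \<Longrightarrow> FT \<psi> \<in> sqint"
  and FT_L2lim: "\<psi> \<in> sqint \<Longrightarrow> L2lim (\<lambda>R. ft1 (trunc R \<psi>)) (FT \<psi>) at_top"
  using someI_ex[OF FT_exists] by (simp_all add: FT_def)

lemma FT_unique:
  assumes "\<psi> \<in> sqint" "\<phi> \<in> sqint" "L2lim (\<lambda>R. ft1 (trunc R \<psi>)) \<phi> at_top"
  shows "AE x in lborel. FT \<psi> x = \<phi> x"
  using L2lim_unique_AE[OF FT_L2lim[OF assms(1)] assms(3)] assms by (simp add: FT_sqint ft1_trunc_sqint)

lemma FT_measurable [measurable]: "\<psi> \<in> sqint \<Longrightarrow> FT \<psi> \<in> borel_measurable borel"
  by (rule sqint_measurable[OF FT_sqint])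

lemma FT_eq_ft1:
  assumes "integrable lborel h" "h \<in> sqint"
  shows "AE x in lborel. FT h x = ft1 h x"
proof (rule FT_unique[OF assms(2) ft1_bessel(1)[OF assms]])
  show "L2lim (\<lambda>R. ft1 (trunc R h)) (ft1 h) at_top"
    using trunc_L2lim[OF assms(2)] assms
    by (simp add: L2lim_def nsq_ft1_diff trunc_integrable trunc_sqint)
qed

lemma FT_plancherel:
  assumes "\<psi> \<in> sqint" shows "nsq (FT \<psi>) = nsq \<psi>"
proof (rule tendsto_unique)
  show "((\<lambda>R. nsq (ft1 (trunc R \<psi>))) \<longlongrightarrow> nsq (FT \<psi>)) at_top"
    by (intro L2lim_nsq FT_L2lim FT_sqint ft1_trunc_sqint assms)
  show "((\<lambda>R. nsq (ft1 (trunc R \<psi>))) \<longlongrightarrow> nsq \<psi>) at_top"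
    using L2lim_nsq[OF trunc_L2lim[OF assms] assms trunc_sqint[OF assms]]
    by (simp add: ft1_plancherel trunc_integrable trunc_sqint assms)
qed simp

lemma L2lim_add:
  assumes "L2lim \<Phi> \<phi> F" "L2lim \<Psi> \<psi> F" "\<phi> \<in> sqint" "\<psi> \<in> sqint" "\<And>i. \<Phi> i \<in> sqint" "\<And>i. \<Psi> i \<in> sqint"
  shows "L2lim (\<lambda>i x. \<Phi> i x + \<Psi> i x) (\<lambda>x. \<phi> x + \<psi> x) F"
proof -
  have "nsq (\<lambda>x. \<Phi> i x + \<Psi> i x - (\<phi> x + \<psi> x)) \<le> 2 * nsq (\<lambda>x. \<Phi> i x - \<phi> x) + 2 * nsq (\<lambda>x. \<Psi> i x - \<psi> x)" for i
    using nsq_add_le[OF sqint_diff[OF assms(5)[of i] assms(3)] sqint_diff[OF assms(6)[of i] assms(4)]]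
    by (simp add: algebra_simps)
  then have le: "\<forall>i. norm (nsq (\<lambda>x. \<Phi> i x + \<Psi> i x - (\<phi> x + \<psi> x))) \<le> 2 * nsq (\<lambda>x. \<Phi> i x - \<phi> x) + 2 * nsq (\<lambda>x. \<Psi> i x - \<psi> x)"
    by simp
  have "((\<lambda>i. 2 * nsq (\<lambda>x. \<Phi> i x - \<phi> x) + 2 * nsq (\<lambda>x. \<Psi> i x - \<psi> x)) \<longlongrightarrow> 2 * 0 + 2 * 0) F"
    using assms(1,2) unfolding L2lim_def by (intro tendsto_intros)
  then show ?thesis unfolding L2lim_def
    by (intro Lim_null_comparison[OF always_eventually[OF le]]) simp
qed

lemma FT_add:
  assumes "\<phi> \<in> sqint" "\<psi> \<in> sqint"
  shows "AE x in lborel. FT (\<lambda>x. \<phi> x + \<psi> x) x = FT \<phi> x + FT \<psi> x"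
proof (rule FT_unique)
  have "ft1 (trunc R (\<lambda>x. \<phi> x + \<psi> x)) = (\<lambda>x. ft1 (trunc R \<phi>) x + ft1 (trunc R \<psi>) x)" for R
  proof
    fix x
    have "trunc R (\<lambda>x. \<phi> x + \<psi> x) = (\<lambda>x. trunc R \<phi> x + trunc R \<psi> x)" by (auto simp: trunc_def)
    then show "ft1 (trunc R (\<lambda>x. \<phi> x + \<psi> x)) x = ft1 (trunc R \<phi>) x + ft1 (trunc R \<psi>) x"
      using ft1_add[OF trunc_integrable[OF assms(1)] trunc_integrable[OF assms(2)], of R R x] by simp
  qed
  then show "L2lim (\<lambda>R. ft1 (trunc R (\<lambda>x. \<phi> x + \<psi> x))) (\<lambda>x. FT \<phi> x + FT \<psi> x) at_top"
    using L2lim_add[OF FT_L2lim[OF assms(1)] FT_L2lim[OF assms(2)]] assms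
    by (simp add: FT_sqint ft1_trunc_sqint)
qed (use assms in \<open>auto intro: sqint_add FT_sqint\<close>)

lemma FT_cmult:
  assumes "\<psi> \<in> sqint"
  shows "AE x in lborel. FT (\<lambda>x. c * \<psi> x) x = c * FT \<psi> x"
proof (rule FT_unique)
  have "ft1 (trunc R (\<lambda>x. c * \<psi> x)) = (\<lambda>x. c * ft1 (trunc R \<psi>) x)" for R
  proof
    fix x
    have "trunc R (\<lambda>x. c * \<psi> x) = (\<lambda>x. c * trunc R \<psi> x)" by (auto simp: trunc_def)
    then show "ft1 (trunc R (\<lambda>x. c * \<psi> x)) x = c * ft1 (trunc R \<psi>) x"
      by (simp add: ft1_cmult)
  qed
  then show "L2lim (\<lambda>R. ft1 (trunc R (\<lambda>x. c * \<psi> x))) (\<lambda>x. c * FT \<psi> x) at_top"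
    using L2lim_bounded_mult[OF FT_L2lim[OF assms], where h = "\<lambda>_. c" and C = "cmod c"] assms
    by (simp add: FT_sqint ft1_trunc_sqint)
qed (use assms in \<open>auto intro: sqint_cmult FT_sqint\<close>)

lemma FT_diff:
  assumes "\<phi> \<in> sqint" "\<psi> \<in> sqint"
  shows "AE x in lborel. FT (\<lambda>x. \<phi> x - \<psi> x) x = FT \<phi> x - FT \<psi> x"
  using FT_add[OF assms(1) sqint_cmult[OF assms(2), of "-1"]] FT_cmult[OF assms(2), of "-1"]
  by eventually_elim simp

lemma FT_L2_continuous:
  assumes "L2lim \<Psi> \<psi> F" "\<psi> \<in> sqint" "\<And>i. \<Psi> i \<in> sqint"
  shows "L2lim (\<lambda>i. FT (\<Psi> i)) (FT \<psi>) F"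
proof -
  have "nsq (\<lambda>x. FT (\<Psi> i) x - FT \<psi> x) = nsq (\<lambda>x. \<Psi> i x - \<psi> x)" for i
  proof -
    have "nsq (\<lambda>x. FT (\<Psi> i) x - FT \<psi> x) = nsq (FT (\<lambda>x. \<Psi> i x - \<psi> x))"
      using FT_diff[OF assms(3)[of i] assms(2)] FT_measurable[OF assms(3)] FT_measurable[OF assms(2)]
        FT_measurable[OF sqint_diff[OF assms(3)[of i] assms(2)]]
      by (intro nsq_cong_AE) auto
    then show ?thesis by (simp add: FT_plancherel sqint_diff assms)
  qed
  then show ?thesis using assms(1) by (simp add: L2lim_def)
qed

lemma L2lim_cnj: "L2lim \<Phi> \<phi> F \<Longrightarrow> L2lim (\<lambda>i x. cnj (\<Phi> i x)) (\<lambda>x. cnj (\<phi> x)) F"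
proof -
  have "nsq (\<lambda>x. cnj (\<Phi> i x) - cnj (\<phi> x)) = nsq (\<lambda>x. \<Phi> i x - \<phi> x)" for i
    using nsq_cnj[of "\<lambda>x. \<Phi> i x - \<phi> x"] by simp
  then show "L2lim \<Phi> \<phi> F \<Longrightarrow> L2lim (\<lambda>i x. cnj (\<Phi> i x)) (\<lambda>x. cnj (\<phi> x)) F"
    by (simp add: L2lim_def)
qed

text \<open>
  Fubini's theorem gives this for truncated functions, and both sides are continuous in $L^2$.
\<close>
lemma FT_multiplication:
  assumes "\<phi> \<in> sqint" "\<psi> \<in> sqint"
  shows "(LINT x|lborel. FT \<phi> x * \<psi> x) = (LINT x|lborel. \<phi> x * FT \<psi> x)"
proof (rule tendsto_unique)
  show "((\<lambda>R. ip (\<lambda>x. cnj (ft1 (trunc R \<phi>) x)) (trunc R \<psi>)) \<longlongrightarrow> (LINT x|lborel. FT \<phi> x * \<psi> x)) at_top"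
    using L2lim_ip[OF L2lim_cnj[OF FT_L2lim[OF assms(1)]] trunc_L2lim[OF assms(2)]] assms
    by (simp add: ip_def sqint_cnj FT_sqint ft1_trunc_sqint trunc_sqint)
  have "ip (\<lambda>x. cnj (ft1 (trunc R \<phi>) x)) (trunc R \<psi>) = ip (\<lambda>x. cnj (trunc R \<phi> x)) (ft1 (trunc R \<psi>))" for R
    unfolding ip_def using ft1_multiplication[OF trunc_integrable[OF assms(1)] trunc_integrable[OF assms(2)], of R R]
    by simp
  then show "((\<lambda>R. ip (\<lambda>x. cnj (ft1 (trunc R \<phi>) x)) (trunc R \<psi>)) \<longlongrightarrow> (LINT x|lborel. \<phi> x * FT \<psi> x)) at_top"
    using L2lim_ip[OF L2lim_cnj[OF trunc_L2lim[OF assms(1)]] FT_L2lim[OF assms(2)]] assms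
    by (simp add: ip_def sqint_cnj FT_sqint ft1_trunc_sqint trunc_sqint)
qed simp

text \<open>
  The conjugate of the transform of the conjugate, that is the Fourier integral with \<open>exp (i \<xi> x)\<close>. In this form it
  inherits all properties of \<open>FT\<close>.
\<close>
definition invFT :: "(real \<Rightarrow> complex) \<Rightarrow> real \<Rightarrow> complex" where
  "invFT \<phi> x = cnj (FT (\<lambda>x. cnj (\<phi> x)) x)"

lemma invFT_sqint: "\<phi> \<in> sqint \<Longrightarrow> invFT \<phi> \<in> sqint"
  unfolding invFT_def[abs_def] by (intro sqint_cnj FT_sqint)

lemma nsq_invFT: "\<phi> \<in> sqint \<Longrightarrow> nsq (invFT \<phi>) = nsq \<phi>"
  unfolding invFT_def[abs_def] by (simp add: nsq_cnj FT_plancherel sqint_cnj)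

lemma FT_adjoint:
  assumes "\<phi> \<in> sqint" "\<psi> \<in> sqint"
  shows "ip (FT \<psi>) \<phi> = ip \<psi> (invFT \<phi>)"
proof -
  have "cnj (ip (FT \<psi>) \<phi>) = (LINT x|lborel. FT \<psi> x * cnj (\<phi> x))"
    unfolding ip_def by (subst Bochner_Integration.integral_cnj[symmetric]) simp
  also have "\<dots> = (LINT x|lborel. \<psi> x * FT (\<lambda>x. cnj (\<phi> x)) x)"
    using FT_multiplication[OF assms(2) sqint_cnj[OF assms(1)]] .
  also have "\<dots> = cnj (ip \<psi> (invFT \<phi>))"
    unfolding ip_def invFT_def by (subst Bochner_Integration.integral_cnj[symmetric]) simp
  finally show ?thesis by simp
qed

text \<open>
  Surjectivity of the Fourier transform comes for free: \<open>FT\<close> and its adjoint \<open>invFT\<close> are both isometric,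
  so with \<open>\<eta> = invFT \<phi>\<close> the squared norm of \<open>FT \<eta> - \<phi>\<close> equals \<open>\<parallel>\<phi>\<parallel>\<^sup>2 - 2 \<parallel>\<eta>\<parallel>\<^sup>2 + \<parallel>\<phi>\<parallel>\<^sup>2 = 0\<close>.
\<close>
lemma FT_invFT:
  assumes "\<phi> \<in> sqint" shows "AE x in lborel. FT (invFT \<phi>) x = \<phi> x"
proof -
  define \<eta> where "\<eta> = invFT \<phi>"
  have \<eta>: "\<eta> \<in> sqint" "FT \<eta> \<in> sqint" using assms by (auto simp: \<eta>_def invFT_sqint FT_sqint)
  have 1: "ip (FT \<eta>) \<phi> = complex_of_real (nsq \<phi>)"
    using FT_adjoint[OF assms \<eta>(1)] nsq_invFT[OF assms] by (simp add: \<eta>_def ip_self)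
  have "complex_of_real (nsq (\<lambda>x. FT \<eta> x - \<phi> x)) = ip (\<lambda>x. FT \<eta> x - \<phi> x) (\<lambda>x. FT \<eta> x - \<phi> x)"
    by (simp add: ip_self)
  also have "\<dots> = ip (FT \<eta>) (FT \<eta>) - ip \<phi> (FT \<eta>) - (ip (FT \<eta>) \<phi> - ip \<phi> \<phi>)"
    using \<eta> assms by (simp add: ip_diff_left ip_diff_right sqint_diff)
  also have "ip \<phi> (FT \<eta>) = complex_of_real (nsq \<phi>)"
    using 1 ip_commute[of "\<phi>" "FT \<eta>"] by simp
  also have "ip (FT \<eta>) (FT \<eta>) = complex_of_real (nsq \<phi>)"
    using \<eta> assms by (simp add: ip_self FT_plancherel nsq_invFT \<eta>_def)
  finally have "nsq (\<lambda>x. FT \<eta> x - \<phi> x) = 0" by (simp add: 1 ip_self)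
  then have "AE x in lborel. FT \<eta> x - \<phi> x = 0"
    using \<eta> assms by (intro nsq_eq_0_AE sqint_diff)
  then show ?thesis by (simp add: \<eta>_def)
qed

lemma invFT_FT:
  assumes "\<psi> \<in> sqint" shows "AE x in lborel. invFT (FT \<psi>) x = \<psi> x"
proof -
  have "complex_of_real (nsq (\<lambda>x. invFT (FT \<psi>) x - \<psi> x)) =
    ip (invFT (FT \<psi>)) (invFT (FT \<psi>)) - ip \<psi> (invFT (FT \<psi>)) - (ip (invFT (FT \<psi>)) \<psi> - ip \<psi> \<psi>)"
    using assms by (simp add: ip_diff_left ip_diff_right sqint_diff invFT_sqint FT_sqint flip: ip_self)
  moreover have "ip \<psi> (invFT (FT \<psi>)) = complex_of_real (nsq \<psi>)"
    using FT_adjoint[OF FT_sqint[OF assms] assms] assms by (simp add: ip_self FT_plancherel)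
  moreover from this have "ip (invFT (FT \<psi>)) \<psi> = complex_of_real (nsq \<psi>)"
    using ip_commute[of "invFT (FT \<psi>)" \<psi>] by simp
  moreover have "ip (invFT (FT \<psi>)) (invFT (FT \<psi>)) = complex_of_real (nsq \<psi>)"
    using assms by (simp add: ip_self nsq_invFT FT_plancherel FT_sqint)
  ultimately have "nsq (\<lambda>x. invFT (FT \<psi>) x - \<psi> x) = 0" by (simp add: ip_self)
  then have "AE x in lborel. invFT (FT \<psi>) x - \<psi> x = 0"
    using assms by (intro nsq_eq_0_AE sqint_diff invFT_sqint FT_sqint)
  then show ?thesis by simp
qed

lemma FT_parseval:
  assumes "\<phi> \<in> sqint" "\<psi> \<in> sqint"
  shows "ip (FT \<phi>) (FT \<psi>) = ip \<phi> \<psi>"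
proof -
  have "ip (FT \<phi>) (FT \<psi>) = ip \<phi> (invFT (FT \<psi>))"
    using FT_adjoint[OF FT_sqint[OF assms(2)] assms(1)] .
  also have "\<dots> = ip \<phi> \<psi>"
    using invFT_FT[OF assms(2)] assms sqint_measurable[OF invFT_sqint[OF FT_sqint[OF assms(2)]]]
    by (intro ip_cong_AE) auto
  finally show ?thesis .
qed

text \<open>
  Modulation translates the Fourier transform; see \<open>FT_modul\<close>.
\<close>
definition modul :: "real \<Rightarrow> (real \<Rightarrow> complex) \<Rightarrow> real \<Rightarrow> complex" where
  "modul s \<psi> x = exp (- (\<i> * complex_of_real s * complex_of_real x)) * \<psi> x"

lemma modul_sqint: "\<psi> \<in> sqint \<Longrightarrow> modul s \<psi> \<in> sqint"
  unfolding modul_def[abs_def] by (rule sqint_bounded_mult[where C = 1]) auto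

lemma sqint_shift:
  assumes "\<psi> \<in> sqint" shows "(\<lambda>x. \<psi> (x + s)) \<in> sqint"
proof -
  have [measurable]: "\<psi> \<in> borel_measurable borel" using assms by (rule sqint_measurable)
  have "(\<lambda>x. \<psi> (x + s)) \<in> borel_measurable borel" by measurable
  moreover have "integrable lborel (\<lambda>x. (cmod (\<psi> (x + s)))\<^sup>2)"
    using lborel_integrable_real_affine[OF sqint_integrable[OF assms], of 1 s] by (simp add: add.commute)
  ultimately show ?thesis by (simp add: sqint_def)
qed

lemma nsq_shift:
  assumes "\<psi> \<in> borel_measurable borel" shows "nsq (\<lambda>x. \<psi> (x + s)) = nsq \<psi>"
  using lborel_integral_real_affine[of 1 "\<lambda>x. (cmod (\<psi> x))\<^sup>2" s] by (simp add: nsq_def add.commute)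

lemma FT_modul:
  assumes "\<psi> \<in> sqint"
  shows "AE \<xi> in lborel. FT (modul s \<psi>) \<xi> = FT \<psi> (\<xi> + s)"
proof (rule FT_unique)
  have eq: "ft1 (trunc R (modul s \<psi>)) = (\<lambda>\<xi>. ft1 (trunc R \<psi>) (\<xi> + s))" for R
  proof
    fix \<xi>
    have "exp (- (\<i> * complex_of_real (\<xi> + s) * complex_of_real x)) =
        exp (- (\<i> * complex_of_real \<xi> * complex_of_real x)) * exp (- (\<i> * complex_of_real s * complex_of_real x))" for x
      by (simp add: exp_add[symmetric] algebra_simps)
    then have "exp (- (\<i> * complex_of_real \<xi> * complex_of_real x)) * trunc R (modul s \<psi>) x =
        exp (- (\<i> * complex_of_real (\<xi> + s) * complex_of_real x)) * trunc R \<psi> x" for x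
      by (simp add: trunc_def modul_def)
    then show "ft1 (trunc R (modul s \<psi>)) \<xi> = ft1 (trunc R \<psi>) (\<xi> + s)"
      by (simp add: ft1_def)
  qed
  have "nsq (\<lambda>x. ft1 (trunc R \<psi>) (x + s) - FT \<psi> (x + s)) = nsq (\<lambda>x. ft1 (trunc R \<psi>) x - FT \<psi> x)" for R
    by (rule nsq_shift[of "\<lambda>x. ft1 (trunc R \<psi>) x - FT \<psi> x"]) (use assms in measurable)
  then show "L2lim (\<lambda>R. ft1 (trunc R (modul s \<psi>))) (\<lambda>\<xi>. FT \<psi> (\<xi> + s)) at_top"
    using FT_L2lim[OF assms] by (simp add: L2lim_def eq)
qed (use assms in \<open>auto intro: modul_sqint sqint_shift FT_sqint\<close>)

section \<open>The commutator as a quadratic form\<close>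

definition borel_rep :: "(real \<Rightarrow> complex) \<Rightarrow> (real \<Rightarrow> complex) \<Rightarrow> bool" where
  "borel_rep \<psi> \<psi>' \<longleftrightarrow> \<psi>' \<in> sqint \<and> (AE x in lborel. \<psi> x = \<psi>' x)"

lemma lebesgue_measurable_if_AE_borel:
  fixes \<psi> :: "real \<Rightarrow> 'a :: euclidean_space"
  assumes "\<psi>' \<in> borel_measurable borel" "AE x in lborel. \<psi> x = \<psi>' x"
  shows "\<psi> \<in> borel_measurable lebesgue"
proof (rule borel_measurable_AE)
  show "\<psi>' \<in> borel_measurable lebesgue"
    using measurable_completion[of \<psi>' lborel borel] assms(1) by simp
  show "AE x in lebesgue. \<psi>' x = \<psi> x"
    using assms(2) by (intro AE_completion) (auto elim: AE_mp)
qed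

lemma integrable_lebesgue_cong_borel:
  fixes f :: "real \<Rightarrow> 'a :: euclidean_space"
  assumes "f' \<in> borel_measurable borel" "AE x in lborel. f x = f' x"
  shows "integrable lebesgue f \<longleftrightarrow> integrable lborel f'" "integral\<^sup>L lebesgue f = integral\<^sup>L lborel f'"
proof -
  have m: "f \<in> borel_measurable lebesgue" "f' \<in> borel_measurable lebesgue" "f' \<in> borel_measurable lborel"
    using lebesgue_measurable_if_AE_borel[OF assms] measurable_completion[of f' lborel borel] assms(1) by auto
  have ae: "AE x in lebesgue. f x = f' x" by (rule AE_completion[OF assms(2)])
  show "integrable lebesgue f \<longleftrightarrow> integrable lborel f'"
    using integrable_cong_AE[OF m(1,2) ae] integrable_completion[OF m(3)] by simp
  show "integral\<^sup>L lebesgue f = integral\<^sup>L lborel f'"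
    using integral_cong_AE[OF m(1,2) ae] integral_completion[OF m(3)] by simp
qed

lemma real_borel_rep:
  assumes "f \<in> borel_measurable lebesgue" "\<And>x. \<bar>f x :: real\<bar> \<le> M"
  obtains f' where "f' \<in> borel_measurable borel" "\<And>x. \<bar>f' x\<bar> \<le> M" "AE x in lborel. f x = f' x"
proof -
  obtain h where h: "h \<in> borel_measurable lborel" "AE x in lborel. f x = h x"
    using completion_ex_borel_measurable_real[OF assms(1)] by blast
  show thesis
  proof (rule that)
    show "(\<lambda>x. max (- M) (min M (h x))) \<in> borel_measurable borel"
      using h(1) by measurable
    show "\<bar>max (- M) (min M (h x))\<bar> \<le> M" for x
      using assms(2)[of 0] by auto
    show "AE x in lborel. f x = max (- M) (min M (h x))"
      using h(2) by eventually_elim (use assms(2) in \<open>auto simp: abs_le_iff min_def max_def\<close>, (smt (verit) assms(2))+)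
  qed
qed

lemma L2_borel_rep:
  assumes "\<psi> \<in> L2" obtains \<psi>' where "borel_rep \<psi> \<psi>'"
proof -
  have m: "\<psi> \<in> borel_measurable lebesgue" and i: "integrable lebesgue (\<lambda>x. (cmod (\<psi> x))\<^sup>2)"
    using assms by (auto simp: L2_def)
  obtain u v where u: "u \<in> borel_measurable lborel" "AE x in lborel. Re (\<psi> x) = u x"
    and v: "v \<in> borel_measurable lborel" "AE x in lborel. Im (\<psi> x) = v x"
    using completion_ex_borel_measurable_real[of "\<lambda>x. Re (\<psi> x)" lborel]
      completion_ex_borel_measurable_real[of "\<lambda>x. Im (\<psi> x)" lborel] m by auto
  define \<psi>' where "\<psi>' x = complex_of_real (u x) + \<i> * complex_of_real (v x)" for x
  have m': "\<psi>' \<in> borel_measurable borel" unfolding \<psi>'_def[abs_def] using u(1) v(1) by measurable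
  have ae: "AE x in lborel. \<psi> x = \<psi>' x"
    using u(2) v(2) by eventually_elim (simp add: \<psi>'_def complex_eq_iff)
  then have ae2: "AE x in lborel. (cmod (\<psi> x))\<^sup>2 = (cmod (\<psi>' x))\<^sup>2"
    by eventually_elim simp
  have "integrable lborel (\<lambda>x. (cmod (\<psi>' x))\<^sup>2)"
    using integrable_lebesgue_cong_borel(1)[OF _ ae2] m' i by simp
  with m' ae show thesis by (intro that[of \<psi>']) (simp add: borel_rep_def sqint_def)
qed

lemma borel_rep_L2: "borel_rep \<psi> \<psi>' \<Longrightarrow> \<psi> \<in> L2"
proof -
  assume r: "borel_rep \<psi> \<psi>'"
  then have m': "\<psi>' \<in> borel_measurable borel" and ae: "AE x in lborel. \<psi> x = \<psi>' x"
    by (auto simp: borel_rep_def)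
  from ae have ae2: "AE x in lborel. (cmod (\<psi> x))\<^sup>2 = (cmod (\<psi>' x))\<^sup>2"
    by eventually_elim simp
  show "\<psi> \<in> L2"
    using lebesgue_measurable_if_AE_borel[OF m' ae] integrable_lebesgue_cong_borel(1)[OF _ ae2] m' r
    by (simp add: L2_def borel_rep_def sqint_def)
qed

lemma borel_rep_self: "\<psi> \<in> sqint \<Longrightarrow> borel_rep \<psi> \<psi>"
  by (simp add: borel_rep_def)

lemma fourier_trunc_eq:
  assumes "borel_rep \<psi> \<psi>'"
  shows "fourier_trunc R \<psi> \<xi> = ft1 (trunc R \<psi>') \<xi>"
proof -
  have m: "\<psi>' \<in> borel_measurable borel" and ae: "AE x in lborel. \<psi> x = \<psi>' x"
    using assms by (auto simp: borel_rep_def)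
  have "(LINT x:{-R..R}|lebesgue. exp (- (\<i> * complex_of_real \<xi> * complex_of_real x)) * \<psi> x) =
     (LINT x|lborel. exp (- (\<i> * complex_of_real \<xi> * complex_of_real x)) * trunc R \<psi>' x)"
    unfolding set_lebesgue_integral_def
  proof (rule integrable_lebesgue_cong_borel(2))
    show "(\<lambda>x. exp (- (\<i> * complex_of_real \<xi> * complex_of_real x)) * trunc R \<psi>' x) \<in> borel_measurable borel"
      using m by measurable
    show "AE x in lborel. indicat_real {- R..R} x *\<^sub>R (exp (- (\<i> * complex_of_real \<xi> * complex_of_real x)) * \<psi> x) =
        exp (- (\<i> * complex_of_real \<xi> * complex_of_real x)) * trunc R \<psi>' x"
      using ae by eventually_elim (auto simp: trunc_def indicator_def)
  qed
  then show ?thesis by (simp add: fourier_trunc_def ft1_def)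
qed

lemma is_fourier_L2_iff:
  assumes "borel_rep \<psi> \<psi>'" "borel_rep \<phi> \<phi>'"
  shows "is_fourier_L2 \<psi> \<phi> \<longleftrightarrow> L2lim (\<lambda>R. ft1 (trunc R \<psi>')) \<phi>' at_top"
proof -
  have s: "\<psi>' \<in> sqint" "\<phi>' \<in> sqint" and ae: "AE x in lborel. \<phi> x = \<phi>' x"
    using assms by (auto simp: borel_rep_def)
  have "(\<integral>\<^sup>+\<xi>. ennreal ((norm (fourier_trunc R \<psi> \<xi> - \<phi> \<xi>))\<^sup>2) \<partial>lebesgue) = ennreal (nsq (\<lambda>x. ft1 (trunc R \<psi>') x - \<phi>' x))" for R
  proof -
    have "(\<integral>\<^sup>+\<xi>. ennreal ((norm (fourier_trunc R \<psi> \<xi> - \<phi> \<xi>))\<^sup>2) \<partial>lebesgue) =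
      (\<integral>\<^sup>+\<xi>. ennreal ((cmod (ft1 (trunc R \<psi>') \<xi> - \<phi>' \<xi>))\<^sup>2) \<partial>lborel)"
      unfolding nn_integral_completion fourier_trunc_eq[OF assms(1)]
      by (rule nn_integral_cong_AE) (use ae in eventually_elim, simp)
    also have "\<dots> = ennreal (nsq (\<lambda>x. ft1 (trunc R \<psi>') x - \<phi>' x))"
      unfolding nsq_def by (intro nn_integral_eq_integral sqint_integrable sqint_diff ft1_trunc_sqint s) auto
    finally show ?thesis .
  qed
  then show ?thesis
    using borel_rep_L2[OF assms(2)] tendsto_ennreal_iff[of "\<lambda>R. nsq (\<lambda>x. ft1 (trunc R \<psi>') x - \<phi>' x)" at_top 0]
    by (simp add: is_fourier_L2_def L2lim_def)
qed

lemma fourier_L2_rep: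
  assumes "borel_rep \<psi> \<psi>'"
  shows "borel_rep (fourier_L2 \<psi>) (FT \<psi>')"
proof -
  have s: "\<psi>' \<in> sqint" using assms by (simp add: borel_rep_def)
  have "is_fourier_L2 \<psi> (FT \<psi>')"
    using is_fourier_L2_iff[OF assms borel_rep_self[OF FT_sqint[OF s]]] FT_L2lim[OF s] by simp
  then have F: "is_fourier_L2 \<psi> (fourier_L2 \<psi>)"
    unfolding fourier_L2_def by (rule someI[where P = "is_fourier_L2 \<psi>"])
  then have "fourier_L2 \<psi> \<in> L2" by (simp add: is_fourier_L2_def)
  then obtain \<phi> where \<phi>: "borel_rep (fourier_L2 \<psi>) \<phi>" by (rule L2_borel_rep)
  have "AE x in lborel. FT \<psi>' x = \<phi> x"
    using F is_fourier_L2_iff[OF assms \<phi>] \<phi> s by (intro FT_unique) (auto simp: borel_rep_def)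
  moreover have "AE x in lborel. fourier_L2 \<psi> x = \<phi> x" using \<phi> by (simp add: borel_rep_def)
  ultimately have "AE x in lborel. fourier_L2 \<psi> x = FT \<psi>' x" by eventually_elim simp
  then show ?thesis by (simp add: borel_rep_def FT_sqint s)
qed

text \<open>
  Because \<open>FT\<close> is onto, the set from which \<open>inv_fourier_L2\<close> chooses is not empty; whatever it chooses
  has the transform \<open>f FT \<psi>\<close>.
\<close>
lemma fun_of_P_rep:
  assumes r: "borel_rep \<psi> \<psi>'" and f': "f' \<in> borel_measurable borel" "\<And>x. \<bar>f' x\<bar> \<le> M"
    and f: "AE x in lborel. f x = f' x"
  obtains \<eta> where "borel_rep (fun_of_P f \<psi>) \<eta>" "AE x in lborel. FT \<eta> x = complex_of_real (f' x) * FT \<psi>' x"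
proof -
  have s: "\<psi>' \<in> sqint" using r by (simp add: borel_rep_def)
  define \<phi> where "\<phi> = (\<lambda>\<xi>. complex_of_real (f' \<xi>) * FT \<psi>' \<xi>)"
  have \<phi>: "\<phi> \<in> sqint" unfolding \<phi>_def by (rule sqint_real_bounded_mult[OF FT_sqint[OF s] f'])
  have tgt: "AE x in lborel. complex_of_real (f x) * fourier_L2 \<psi> x = \<phi> x"
    using f fourier_L2_rep[OF r, unfolded borel_rep_def, THEN conjunct2] by eventually_elim (simp add: \<phi>_def)
  have inv: "borel_rep (invFT \<phi>) (invFT \<phi>)" by (intro borel_rep_self invFT_sqint \<phi>)
  have "AE x in lborel. fourier_L2 (invFT \<phi>) x = complex_of_real (f x) * fourier_L2 \<psi> x"
    using fourier_L2_rep[OF inv, unfolded borel_rep_def, THEN conjunct2] FT_invFT[OF \<phi>] tgt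
    by eventually_elim simp
  moreover define good where "good = (\<lambda>\<eta>. \<eta> \<in> L2 \<and> (AE \<xi> in lebesgue. fourier_L2 \<eta> \<xi> = complex_of_real (f \<xi>) * fourier_L2 \<psi> \<xi>))"
  ultimately have "good (invFT \<phi>)"
    using borel_rep_L2[OF inv] by (simp add: AE_completion_iff)
  then have "good (Eps good)" by (rule someI[where P = good and x = "invFT \<phi>"])
  then have *: "fun_of_P f \<psi> \<in> L2 \<and> (AE \<xi> in lebesgue. fourier_L2 (fun_of_P f \<psi>) \<xi> = complex_of_real (f \<xi>) * fourier_L2 \<psi> \<xi>)"
    by (simp add: fun_of_P_def inv_fourier_L2_def good_def)
  then obtain \<eta> where \<eta>: "borel_rep (fun_of_P f \<psi>) \<eta>" using L2_borel_rep by blast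
  have "AE x in lborel. fourier_L2 (fun_of_P f \<psi>) x = complex_of_real (f x) * fourier_L2 \<psi> x"
    using * by (simp add: AE_completion_iff)
  then have "AE x in lborel. FT \<eta> x = complex_of_real (f' x) * FT \<psi>' x"
    using fourier_L2_rep[OF \<eta>, unfolded borel_rep_def, THEN conjunct2] tgt
    by eventually_elim (simp add: \<phi>_def)
  with \<eta> show thesis by (rule that)
qed

text \<open>
  The sesquilinear form \<open>\<langle>\<phi>, i[f(P), g(Q)] \<psi>\<rangle>\<close>, with \<open>f(P)\<close> acting on the Fourier side; \<open>cform\<close> is its diagonal.
\<close>
definition bform :: "(real \<Rightarrow> real) \<Rightarrow> (real \<Rightarrow> real) \<Rightarrow> (real \<Rightarrow> complex) \<Rightarrow> (real \<Rightarrow> complex) \<Rightarrow> complex" where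
  "bform f g \<phi> \<psi> = \<i> * (ip (FT \<phi>) (\<lambda>\<xi>. complex_of_real (f \<xi>) * FT (\<lambda>x. complex_of_real (g x) * \<psi> x) \<xi>)
     - ip (FT (\<lambda>x. complex_of_real (g x) * \<phi> x)) (\<lambda>\<xi>. complex_of_real (f \<xi>) * FT \<psi> \<xi>))"

definition cform :: "(real \<Rightarrow> real) \<Rightarrow> (real \<Rightarrow> real) \<Rightarrow> (real \<Rightarrow> complex) \<Rightarrow> real" where
  "cform f g \<psi> = - 2 * Im (ip (FT \<psi>) (\<lambda>\<xi>. complex_of_real (f \<xi>) * FT (\<lambda>x. complex_of_real (g x) * \<psi> x) \<xi>))"

definition bdd_borel :: "(real \<Rightarrow> real) \<Rightarrow> bool" where
  "bdd_borel f \<longleftrightarrow> f \<in> borel_measurable borel \<and> (\<exists>M. \<forall>x. \<bar>f x\<bar> \<le> M)"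

lemma bdd_borel_measurable [measurable_dest]: "bdd_borel f \<Longrightarrow> f \<in> borel_measurable borel"
  by (simp add: bdd_borel_def)

lemma bdd_borelE:
  assumes "bdd_borel f" obtains M where "\<And>x. \<bar>f x\<bar> \<le> M" "0 \<le> M"
proof -
  obtain M where M: "\<And>x. \<bar>f x\<bar> \<le> M" using assms by (auto simp: bdd_borel_def)
  then show thesis using that[of M] order_trans[OF abs_ge_zero M[of 0]] by blast
qed

lemma bdd_borel_mult_sqint:
  assumes "bdd_borel f" "\<psi> \<in> sqint" shows "(\<lambda>x. complex_of_real (f x) * \<psi> x) \<in> sqint"
proof -
  obtain M where "\<And>x. \<bar>f x\<bar> \<le> M" by (rule bdd_borelE[OF assms(1)]) blast
  with assms show ?thesis by (intro sqint_real_bounded_mult) (auto simp: bdd_borel_def)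
qed

lemma bform_eq:
  "bform f g \<phi> \<psi> = \<i> * (ip (FT \<phi>) (\<lambda>\<xi>. complex_of_real (f \<xi>) * FT (\<lambda>x. complex_of_real (g x) * \<psi> x) \<xi>)
     - cnj (ip (FT \<psi>) (\<lambda>\<xi>. complex_of_real (f \<xi>) * FT (\<lambda>x. complex_of_real (g x) * \<phi> x) \<xi>)))"
proof -
  have "ip (FT (\<lambda>x. complex_of_real (g x) * \<phi> x)) (\<lambda>\<xi>. complex_of_real (f \<xi>) * FT \<psi> \<xi>) =
      cnj (ip (FT \<psi>) (\<lambda>\<xi>. complex_of_real (f \<xi>) * FT (\<lambda>x. complex_of_real (g x) * \<phi> x) \<xi>))"
    by (subst ip_real_mult[where g = f and \<phi> = "FT \<psi>", symmetric]) (rule ip_commute)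
  then show ?thesis by (simp add: bform_def)
qed

lemma bform_hermitian: "bform f g \<phi> \<psi> = cnj (bform f g \<psi> \<phi>)"
  unfolding bform_eq by (simp add: complex_eq_iff)

lemma bform_diag: "bform f g \<psi> \<psi> = complex_of_real (cform f g \<psi>)"
  unfolding bform_eq by (simp add: complex_eq_iff cform_def)

text \<open>
  By Parseval's identity the scalar products with \<open>f(P) g(Q) \<psi>\<close> and \<open>g(Q) f(P) \<psi>\<close> are the two terms of \<open>bform\<close>.
\<close>
lemma i_commutator_rep:
  assumes r: "borel_rep \<psi> \<psi>'" and f': "bdd_borel f'" "AE x in lborel. f x = f' x"
    and g': "bdd_borel g'" "AE x in lborel. g x = g' x"
  obtains \<tau> where "borel_rep (i_commutator_PQ f g \<psi>) \<tau>" "\<And>\<phi>. \<phi> \<in> sqint \<Longrightarrow> ip \<phi> \<tau> = bform f' g' \<phi> \<psi>'"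
proof -
  obtain M where M: "\<And>x. \<bar>f' x\<bar> \<le> M" by (rule bdd_borelE[OF f'(1)]) blast
  have s: "\<psi>' \<in> sqint" and ae: "AE x in lborel. \<psi> x = \<psi>' x" using r by (auto simp: borel_rep_def)
  have gs: "(\<lambda>x. complex_of_real (g' x) * \<phi> x) \<in> sqint" if "\<phi> \<in> sqint" for \<phi>
    by (rule bdd_borel_mult_sqint[OF g'(1) that])
  have r2: "borel_rep (fun_of_Q g \<psi>) (\<lambda>x. complex_of_real (g' x) * \<psi>' x)"
    unfolding borel_rep_def using gs[OF s] ae g'(2) by (auto simp: fun_of_Q_def elim: AE_mp)
  obtain \<eta>1 where e1: "borel_rep (fun_of_P f (fun_of_Q g \<psi>)) \<eta>1"
      "AE x in lborel. FT \<eta>1 x = complex_of_real (f' x) * FT (\<lambda>x. complex_of_real (g' x) * \<psi>' x) x"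
    using fun_of_P_rep[OF r2 bdd_borel_measurable[OF f'(1)] M f'(2)] by blast
  obtain \<eta>2 where e2: "borel_rep (fun_of_P f \<psi>) \<eta>2"
      "AE x in lborel. FT \<eta>2 x = complex_of_real (f' x) * FT \<psi>' x"
    using fun_of_P_rep[OF r bdd_borel_measurable[OF f'(1)] M f'(2)] by blast
  have es: "\<eta>1 \<in> sqint" "\<eta>2 \<in> sqint" using e1 e2 by (auto simp: borel_rep_def)
  define \<tau> where "\<tau> = (\<lambda>x. \<i> * (\<eta>1 x - complex_of_real (g' x) * \<eta>2 x))"
  have \<tau>: "\<tau> \<in> sqint" unfolding \<tau>_def by (intro sqint_cmult sqint_diff es gs)
  have "AE x in lborel. i_commutator_PQ f g \<psi> x = \<tau> x"
    using e1(1)[unfolded borel_rep_def, THEN conjunct2] e2(1)[unfolded borel_rep_def, THEN conjunct2] g'(2)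
    by eventually_elim (simp add: \<tau>_def i_commutator_PQ_def commutator_def fun_of_Q_def)
  with \<tau> have 1: "borel_rep (i_commutator_PQ f g \<psi>) \<tau>" by (simp add: borel_rep_def)
  have 2: "ip \<phi> \<tau> = bform f' g' \<phi> \<psi>'" if p: "\<phi> \<in> sqint" for \<phi>
  proof -
    have "ip \<phi> \<tau> = \<i> * (ip \<phi> \<eta>1 - ip \<phi> (\<lambda>x. complex_of_real (g' x) * \<eta>2 x))"
      unfolding \<tau>_def ip_cmult_right by (simp add: ip_diff_right p es gs)
    also have "ip \<phi> \<eta>1 = ip (FT \<phi>) (FT \<eta>1)" by (simp add: FT_parseval p es)
    also have "\<dots> = ip (FT \<phi>) (\<lambda>\<xi>. complex_of_real (f' \<xi>) * FT (\<lambda>x. complex_of_real (g' x) * \<psi>' x) \<xi>)"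
      using e1(2) es p s gs f' by (intro ip_cong_AE) (auto intro!: sqint_measurable bdd_borel_mult_sqint FT_sqint)
    also have "ip \<phi> (\<lambda>x. complex_of_real (g' x) * \<eta>2 x) = ip (\<lambda>x. complex_of_real (g' x) * \<phi> x) \<eta>2"
      by (rule ip_real_mult[symmetric])
    also have "\<dots> = ip (FT (\<lambda>x. complex_of_real (g' x) * \<phi> x)) (FT \<eta>2)" by (simp add: FT_parseval p es gs)
    also have "\<dots> = ip (FT (\<lambda>x. complex_of_real (g' x) * \<phi> x)) (\<lambda>\<xi>. complex_of_real (f' \<xi>) * FT \<psi>' \<xi>)"
      using e2(2) es p s gs f' by (intro ip_cong_AE) (auto intro!: sqint_measurable bdd_borel_mult_sqint FT_sqint)
    finally show ?thesis by (simp add: bform_def)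
  qed
  from 1 2 show thesis by (rule that)
qed

lemma L2_inner_rep:
  assumes "borel_rep \<phi> \<phi>'" "borel_rep \<psi> \<psi>'" shows "L2_inner \<phi> \<psi> = ip \<phi>' \<psi>'"
  unfolding L2_inner_def ip_def
  by (rule integrable_lebesgue_cong_borel(2)) (use assms in \<open>auto simp: borel_rep_def sqint_def elim: AE_mp\<close>)

lemma bform_representable:
  assumes "bdd_borel f" "bdd_borel g" "\<psi> \<in> sqint"
  obtains \<tau> where "\<tau> \<in> sqint" "\<And>\<phi>. \<phi> \<in> sqint \<Longrightarrow> ip \<phi> \<tau> = bform f g \<phi> \<psi>"
  using i_commutator_rep[OF borel_rep_self[OF assms(3)] assms(1) _ assms(2), of f g]
  by (auto simp: borel_rep_def)

text \<open>
  Expanding the form at \<open>\<phi> + c \<psi>\<close> for \<open>c = 1\<close> and \<open>c = i\<close> leaves two linear equations for the mixed terms.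
\<close>
lemma bform_polarization:
  assumes fg: "bdd_borel f" "bdd_borel g" and zero: "\<And>\<psi>. \<psi> \<in> sqint \<Longrightarrow> cform f g \<psi> = 0"
    and \<phi>: "\<phi> \<in> sqint" and \<psi>: "\<psi> \<in> sqint"
  shows "bform f g \<phi> \<psi> = 0"
proof -
  have left: "bform f g (\<lambda>x. u x + c * v x) w = bform f g u w + cnj c * bform f g v w"
    if uvw: "u \<in> sqint" "v \<in> sqint" "w \<in> sqint" for u v w c
  proof -
    obtain \<tau> where \<tau>: "\<tau> \<in> sqint" "\<And>\<phi>. \<phi> \<in> sqint \<Longrightarrow> ip \<phi> \<tau> = bform f g \<phi> w"
      by (rule bform_representable[OF fg uvw(3)]) blast
    show ?thesis
      using uvw \<tau>(1) by (simp add: \<tau>(2)[symmetric] sqint_add sqint_cmult ip_add_left ip_cmult_left)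
  qed
  have right: "bform f g w (\<lambda>x. u x + c * v x) = bform f g w u + c * bform f g w v"
    if uvw: "u \<in> sqint" "v \<in> sqint" "w \<in> sqint" for u v w c
    using left[OF uvw, of c] by (simp add: bform_hermitian[of f g w])
  have exp: "cnj c * bform f g \<psi> \<phi> + c * bform f g \<phi> \<psi> = 0" for c
  proof -
    have "bform f g (\<lambda>x. \<phi> x + c * \<psi> x) (\<lambda>x. \<phi> x + c * \<psi> x) = 0" "bform f g \<phi> \<phi> = 0" "bform f g \<psi> \<psi> = 0"
      using zero[OF sqint_add[OF \<phi> sqint_cmult[OF \<psi>]]] zero[OF \<phi>] zero[OF \<psi>] by (simp_all add: bform_diag)
    moreover have "bform f g (\<lambda>x. \<phi> x + c * \<psi> x) (\<lambda>x. \<phi> x + c * \<psi> x) =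
        bform f g \<phi> \<phi> + c * bform f g \<phi> \<psi> + cnj c * (bform f g \<psi> \<phi> + c * bform f g \<psi> \<psi>)"
      by (simp only: left[OF \<phi> \<psi> sqint_add[OF \<phi> sqint_cmult[OF \<psi>]]] right[OF \<phi> \<psi> \<phi>] right[OF \<phi> \<psi> \<psi>])
    ultimately show ?thesis by (simp add: add.commute)
  qed
  from exp[of 1] exp[of \<i>] show ?thesis
    by (simp add: complex_eq_iff)
qed

theorem positive_op_iff_cform:
  assumes "bdd_borel f'" "AE x in lborel. f x = f' x" "bdd_borel g'" "AE x in lborel. g x = g' x"
  shows "positive_op (i_commutator_PQ f g) \<longleftrightarrow> (\<forall>\<psi>\<in>sqint. 0 \<le> cform f' g' \<psi>)"
proof -
  have "L2_inner \<psi> (i_commutator_PQ f g \<psi>) = complex_of_real (cform f' g' \<psi>')" if r: "borel_rep \<psi> \<psi>'" for \<psi> \<psi>'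
  proof -
    obtain \<tau> where \<tau>: "borel_rep (i_commutator_PQ f g \<psi>) \<tau>" "\<And>\<phi>. \<phi> \<in> sqint \<Longrightarrow> ip \<phi> \<tau> = bform f' g' \<phi> \<psi>'"
      by (rule i_commutator_rep[OF r assms]) blast
    show ?thesis using L2_inner_rep[OF r \<tau>(1)] \<tau>(2)[of \<psi>'] r by (simp add: bform_diag borel_rep_def)
  qed
  note eq = this
  show ?thesis
  proof
    assume p: "positive_op (i_commutator_PQ f g)"
    show "\<forall>\<psi>\<in>sqint. 0 \<le> cform f' g' \<psi>"
    proof
      fix \<psi> assume "\<psi> \<in> sqint"
      then have r: "borel_rep \<psi> \<psi>" by (rule borel_rep_self)
      show "0 \<le> cform f' g' \<psi>" using p eq[OF r] borel_rep_L2[OF r] by (auto simp: positive_op_def)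
    qed
  next
    assume p: "\<forall>\<psi>\<in>sqint. 0 \<le> cform f' g' \<psi>"
    show "positive_op (i_commutator_PQ f g)"
      unfolding positive_op_def
    proof
      fix \<psi> assume "\<psi> \<in> L2"
      then obtain \<psi>' where r: "borel_rep \<psi> \<psi>'" by (rule L2_borel_rep)
      then show "L2_inner \<psi> (i_commutator_PQ f g \<psi>) \<in> \<real> \<and> 0 \<le> Re (L2_inner \<psi> (i_commutator_PQ f g \<psi>))"
        using p eq[OF r] by (auto simp: borel_rep_def)
    qed
  qed
qed

theorem zero_op_iff_cform:
  assumes "bdd_borel f'" "AE x in lborel. f x = f' x" "bdd_borel g'" "AE x in lborel. g x = g' x"
  shows "zero_op (i_commutator_PQ f g) \<longleftrightarrow> (\<forall>\<psi>\<in>sqint. cform f' g' \<psi> = 0)"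
proof
  assume z: "zero_op (i_commutator_PQ f g)"
  show "\<forall>\<psi>\<in>sqint. cform f' g' \<psi> = 0"
  proof
    fix \<psi> assume s: "\<psi> \<in> sqint"
    then have r: "borel_rep \<psi> \<psi>" by (rule borel_rep_self)
    obtain \<tau> where \<tau>: "borel_rep (i_commutator_PQ f g \<psi>) \<tau>" "\<And>\<phi>. \<phi> \<in> sqint \<Longrightarrow> ip \<phi> \<tau> = bform f' g' \<phi> \<psi>"
      by (rule i_commutator_rep[OF r assms]) blast
    have "AE x in lborel. i_commutator_PQ f g \<psi> x = 0"
      using z borel_rep_L2[OF r] by (simp add: zero_op_def AE_completion_iff)
    with \<tau>(1)[unfolded borel_rep_def, THEN conjunct2] have "AE x in lborel. \<tau> x = 0"
      by eventually_elim simp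
    then have "ip \<psi> \<tau> = ip \<psi> (\<lambda>_. 0)"
      using s \<tau>(1) by (intro ip_cong_AE) (auto simp: borel_rep_def sqint_def)
    then have "bform f' g' \<psi> \<psi> = 0" using \<tau>(2)[OF s] by (simp add: ip_def)
    then show "cform f' g' \<psi> = 0" by (simp add: bform_diag)
  qed
next
  assume z: "\<forall>\<psi>\<in>sqint. cform f' g' \<psi> = 0"
  show "zero_op (i_commutator_PQ f g)"
    unfolding zero_op_def
  proof
    fix \<psi> assume "\<psi> \<in> L2"
    then obtain \<psi>' where r: "borel_rep \<psi> \<psi>'" by (rule L2_borel_rep)
    obtain \<tau> where \<tau>: "borel_rep (i_commutator_PQ f g \<psi>) \<tau>" "\<And>\<phi>. \<phi> \<in> sqint \<Longrightarrow> ip \<phi> \<tau> = bform f' g' \<phi> \<psi>'"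
      by (rule i_commutator_rep[OF r assms]) blast
    have ts: "\<tau> \<in> sqint" "\<psi>' \<in> sqint" using \<tau>(1) r by (auto simp: borel_rep_def)
    have "ip \<tau> \<tau> = 0"
      using \<tau>(2)[OF ts(1)] bform_polarization[OF assms(1,3) _ ts] z by simp
    then have "AE x in lborel. \<tau> x = 0" using nsq_eq_0_AE[OF ts(1)] by (simp add: ip_self)
    with \<tau>(1)[unfolded borel_rep_def, THEN conjunct2] have "AE x in lborel. i_commutator_PQ f g \<psi> x = 0"
      by eventually_elim simp
    then show "AE x in lebesgue. i_commutator_PQ f g \<psi> x = 0" by (rule AE_completion)
  qed
qed

section \<open>Averaging over modulations and the symmetry of position and momentum\<close>

definition conv :: "(real \<Rightarrow> real) \<Rightarrow> (real \<Rightarrow> real) \<Rightarrow> real \<Rightarrow> real" where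
  "conv f w x = (LINT s|lborel. f (x - s) * w s)"

text \<open>
  Strict positivity is what allows one to conclude from a vanishing average of a nonnegative function that the
  function vanishes.
\<close>
definition pos_kernel :: "(real \<Rightarrow> real) \<Rightarrow> bool" where
  "pos_kernel w \<longleftrightarrow> w \<in> borel_measurable borel \<and> integrable lborel w \<and> (\<forall>s. 0 < w s)"

lemma pos_kernelD:
  assumes "pos_kernel w"
  shows "w \<in> borel_measurable borel" "integrable lborel w" "0 < w s" "0 \<le> w s"
  using assms by (auto simp: pos_kernel_def less_imp_le)

lemma conv_integrable:
  assumes "bdd_borel f" "pos_kernel w"
  shows "integrable lborel (\<lambda>s. f (x - s) * w s)"
proof -
  obtain M where M: "\<And>x. \<bar>f x\<bar> \<le> M" "0 \<le> M" using bdd_borelE[OF assms(1)] by blast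
  have [measurable]: "f \<in> borel_measurable borel" "w \<in> borel_measurable borel"
    using assms by (auto simp: bdd_borel_def pos_kernel_def)
  show ?thesis
  proof (rule Bochner_Integration.integrable_bound)
    show "integrable lborel (\<lambda>s. M * w s)" using pos_kernelD(2)[OF assms(2)] by simp
    show "AE s in lborel. norm (f (x - s) * w s) \<le> norm (M * w s)"
      using M pos_kernelD(4)[OF assms(2)] by (auto simp: abs_mult intro!: mult_right_mono)
  qed measurable
qed

lemma conv_bound:
  assumes "bdd_borel f" "pos_kernel w" "\<And>x. \<bar>f x\<bar> \<le> M"
  shows "\<bar>conv f w x\<bar> \<le> M * (LINT s|lborel. w s)"
proof -
  have "norm (conv f w x) \<le> (LINT s|lborel. M * w s)"
    unfolding conv_def
    using assms(3) pos_kernelD(2,4)[OF assms(2)]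
    by (intro integral_norm_le) (auto simp: abs_mult intro!: mult_right_mono)
  then show ?thesis by simp
qed

lemma bdd_borel_conv:
  assumes "bdd_borel f" "pos_kernel w" shows "bdd_borel (conv f w)"
proof -
  have [measurable]: "f \<in> borel_measurable borel" "w \<in> borel_measurable borel"
    using assms by (auto simp: bdd_borel_def pos_kernel_def)
  obtain M where M: "\<And>x. \<bar>f x\<bar> \<le> M" by (rule bdd_borelE[OF assms(1)]) blast
  have "conv f w \<in> borel_measurable borel"
    unfolding conv_def[abs_def] by measurable
  then show ?thesis using conv_bound[OF assms M] unfolding bdd_borel_def by blast
qed

definition cpos :: "(real \<Rightarrow> real) \<Rightarrow> (real \<Rightarrow> real) \<Rightarrow> bool" where
  "cpos f g \<longleftrightarrow> (\<forall>\<psi>\<in>sqint. 0 \<le> cform f g \<psi>)"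

lemma cform_modul:
  assumes "bdd_borel f" "bdd_borel g" "\<psi> \<in> sqint"
  shows "cform f g (modul s \<psi>) =
    - 2 * Im (LINT \<xi>|lborel. cnj (FT \<psi> \<xi>) * complex_of_real (f (\<xi> - s)) * FT (\<lambda>x. complex_of_real (g x) * \<psi> x) \<xi>)"
proof -
  define h where "h = (\<lambda>x. complex_of_real (g x) * \<psi> x)"
  have h: "h \<in> sqint" unfolding h_def by (rule bdd_borel_mult_sqint[OF assms(2,3)])
  have gm: "(\<lambda>x. complex_of_real (g x) * modul s \<psi> x) = modul s h"
    by (auto simp: modul_def h_def)
  have [measurable]: "f \<in> borel_measurable borel" using assms by (auto simp: bdd_borel_def)
  have m [measurable]: "FT \<psi> \<in> borel_measurable borel" "FT h \<in> borel_measurable borel"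
    "FT (modul s \<psi>) \<in> borel_measurable borel" "FT (modul s h) \<in> borel_measurable borel"
    by (intro FT_measurable modul_sqint assms h)+
  have "ip (FT (modul s \<psi>)) (\<lambda>\<xi>. complex_of_real (f \<xi>) * FT (modul s h) \<xi>) =
      ip (\<lambda>\<xi>. FT \<psi> (\<xi> + s)) (\<lambda>\<xi>. complex_of_real (f \<xi>) * FT h (\<xi> + s))"
    by (rule ip_cong_AE)
      (use FT_modul[OF assms(3), of s] FT_modul[OF h, of s] in \<open>auto elim: AE_mp\<close>)
  also have "\<dots> = (LINT \<xi>|lborel. cnj (FT \<psi> \<xi>) * complex_of_real (f (\<xi> - s)) * FT h \<xi>)"
    unfolding ip_def
    using lborel_integral_real_affine[of 1 "\<lambda>\<xi>. cnj (FT \<psi> \<xi>) * complex_of_real (f (\<xi> - s)) * FT h \<xi>" s]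
    by (simp add: mult.assoc add.commute)
  finally show ?thesis unfolding cform_def gm by (simp add: h_def)
qed

text \<open>
  Modulation of \<open>\<psi>\<close> commutes with \<open>g(Q)\<close> and translates the Fourier transforms of \<open>\<psi>\<close> and \<open>g \<psi>\<close>; moving
  the translation over to \<open>f\<close> in \<open>cform_modul\<close> and exchanging integrals gives the average.
\<close>
lemma cform_conv:
  assumes f: "bdd_borel f" and g: "bdd_borel g" and w: "pos_kernel w" and \<psi>: "\<psi> \<in> sqint"
  shows "integrable lborel (\<lambda>s. w s * cform f g (modul s \<psi>))"
    and "cform (conv f w) g \<psi> = (LINT s|lborel. w s * cform f g (modul s \<psi>))"
proof -
  define h where "h = (\<lambda>x. complex_of_real (g x) * \<psi> x)"
  have h: "h \<in> sqint" unfolding h_def by (rule bdd_borel_mult_sqint[OF g \<psi>])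
  obtain M where M: "\<And>x. \<bar>f x\<bar> \<le> M" "0 \<le> M" using bdd_borelE[OF f] by blast
  have [measurable]: "f \<in> borel_measurable borel" "w \<in> borel_measurable borel"
    using f w by (auto simp: bdd_borel_def pos_kernel_def)
  have [measurable]: "FT \<psi> \<in> borel_measurable borel" "FT h \<in> borel_measurable borel"
    by (intro FT_measurable \<psi> h)+
  define k where "k \<xi> = cnj (FT \<psi> \<xi>) * FT h \<xi>" for \<xi>
  have k: "integrable lborel k" unfolding k_def by (intro integrable_ip FT_sqint \<psi> h)
  have [measurable]: "k \<in> borel_measurable borel" unfolding k_def[abs_def] by measurable
  let ?G = "\<lambda>\<xi> s. complex_of_real (f (\<xi> - s) * w s) * k \<xi>"
  have meas: "(\<lambda>(\<xi>, s). ?G \<xi> s) \<in> borel_measurable (lborel \<Otimes>\<^sub>M lborel)" by measurable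
  note fub = fubini_dom[OF meas, where A = "\<lambda>\<xi>. M * cmod (k \<xi>)" and D = "\<lambda>_. w" and K = "LINT s|lborel. w s"]
  have le: "norm (?G \<xi> s) \<le> M * cmod (k \<xi>) * w s" for \<xi> s
  proof -
    have "\<bar>f (\<xi> - s)\<bar> * (w s * cmod (k \<xi>)) \<le> M * (w s * cmod (k \<xi>))"
      using M pos_kernelD(4)[OF w, of s] by (intro mult_right_mono) auto
    then show ?thesis using pos_kernelD(4)[OF w, of s] by (simp add: norm_mult abs_mult mult_ac)
  qed
  have swap: "(LINT \<xi>|lborel. LINT s|lborel. ?G \<xi> s) = (LINT s|lborel. LINT \<xi>|lborel. ?G \<xi> s)"
    and int: "integrable lborel (\<lambda>s. LINT \<xi>|lborel. ?G \<xi> s)"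
    using fub(1,3) k pos_kernelD(2)[OF w] le by auto
  have inner: "(LINT \<xi>|lborel. ?G \<xi> s) = complex_of_real (w s) *
      (LINT \<xi>|lborel. cnj (FT \<psi> \<xi>) * complex_of_real (f (\<xi> - s)) * FT h \<xi>)" for s
    by (simp add: k_def mult_ac flip: Bochner_Integration.integral_mult_right_zero)
  have im: "- 2 * Im (LINT \<xi>|lborel. ?G \<xi> s) = w s * cform f g (modul s \<psi>)" for s
    unfolding inner cform_modul[OF f g \<psi>] by (simp add: h_def)
  show "integrable lborel (\<lambda>s. w s * cform f g (modul s \<psi>))"
    unfolding im[symmetric] using integrable_Im[OF int] by simp
  have "ip (FT \<psi>) (\<lambda>\<xi>. complex_of_real (conv f w \<xi>) * FT h \<xi>) = (LINT \<xi>|lborel. LINT s|lborel. ?G \<xi> s)"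
    unfolding ip_def conv_def
    by (intro Bochner_Integration.integral_cong refl) (simp add: k_def mult_ac del: of_real_mult)
  then have "cform (conv f w) g \<psi> = - 2 * Im (LINT s|lborel. LINT \<xi>|lborel. ?G \<xi> s)"
    unfolding cform_def h_def[symmetric] swap[symmetric] by (simp only:)
  also have "\<dots> = (LINT s|lborel. - 2 * Im (LINT \<xi>|lborel. ?G \<xi> s))"
    using integral_Im[OF int] by simp
  finally show "cform (conv f w) g \<psi> = (LINT s|lborel. w s * cform f g (modul s \<psi>))"
    by (simp only: im)
qed

lemma cform_continuous:
  assumes f: "bdd_borel f" and g: "bdd_borel g" and \<psi>: "\<psi> \<in> sqint" and \<Psi>: "\<And>i. \<Psi> i \<in> sqint"
    and lim: "L2lim \<Psi> \<psi> F"
  shows "((\<lambda>i. cform f g (\<Psi> i)) \<longlongrightarrow> cform f g \<psi>) F"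
proof -
  obtain M where M: "\<And>x. \<bar>f x\<bar> \<le> M" by (rule bdd_borelE[OF f]) blast
  obtain N where N: "\<And>x. \<bar>g x\<bar> \<le> N" by (rule bdd_borelE[OF g]) blast
  have [measurable]: "f \<in> borel_measurable borel" "g \<in> borel_measurable borel"
    using f g by (auto simp: bdd_borel_def)
  have gl: "L2lim (\<lambda>i x. complex_of_real (g x) * \<Psi> i x) (\<lambda>x. complex_of_real (g x) * \<psi> x) F"
    by (rule L2lim_bounded_mult[OF lim \<psi> \<Psi>, where C = N]) (use N in auto)
  have FTl: "L2lim (\<lambda>i. FT (\<lambda>x. complex_of_real (g x) * \<Psi> i x)) (FT (\<lambda>x. complex_of_real (g x) * \<psi> x)) F"
    by (intro FT_L2_continuous gl bdd_borel_mult_sqint g \<psi> \<Psi>)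
  have fl: "L2lim (\<lambda>i \<xi>. complex_of_real (f \<xi>) * FT (\<lambda>x. complex_of_real (g x) * \<Psi> i x) \<xi>)
      (\<lambda>\<xi>. complex_of_real (f \<xi>) * FT (\<lambda>x. complex_of_real (g x) * \<psi> x) \<xi>) F"
    by (rule L2lim_bounded_mult[OF FTl, where C = M])
      (use M in \<open>auto intro!: FT_sqint bdd_borel_mult_sqint g \<psi> \<Psi>\<close>)
  show ?thesis
    unfolding cform_def
    by (intro tendsto_intros L2lim_ip FT_L2_continuous lim fl FT_sqint bdd_borel_mult_sqint f g \<psi> \<Psi>)
qed

lemma modul_L2lim:
  assumes "\<psi> \<in> sqint" "s \<longlonglongrightarrow> s0" shows "L2lim (\<lambda>n. modul (s n) \<psi>) (modul s0 \<psi>) sequentially"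
proof (rule L2lim_dominated[OF sqint_cmult[OF assms(1), of 2]])
  show "modul (s n) \<psi> \<in> borel_measurable borel" "modul s0 \<psi> \<in> borel_measurable borel" for n
    by (intro sqint_measurable modul_sqint assms)+
  have one: "cmod (modul t \<psi> x) = cmod (\<psi> x)" for t x by (simp add: modul_def norm_mult)
  show "cmod (modul (s n) \<psi> x - modul s0 \<psi> x) \<le> cmod (2 * \<psi> x)" for n x
    using norm_triangle_ineq4[of "modul (s n) \<psi> x" "modul s0 \<psi> x"] by (simp add: one norm_mult)
  show "AE x in lborel. (\<lambda>n. modul (s n) \<psi> x) \<longlonglongrightarrow> modul s0 \<psi> x"
    unfolding modul_def by (intro AE_I2 tendsto_intros assms)
qed

lemma modul_0 [simp]: "modul 0 \<psi> = \<psi>"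
  by (simp add: modul_def fun_eq_iff)

lemma cpos_conv:
  assumes "bdd_borel f" "bdd_borel g" "pos_kernel w" "cpos f g"
  shows "cpos (conv f w) g"
  unfolding cpos_def
proof
  fix \<psi> assume \<psi>: "\<psi> \<in> sqint"
  show "0 \<le> cform (conv f w) g \<psi>"
    unfolding cform_conv(2)[OF assms(1-3) \<psi>]
    by (intro Bochner_Integration.integral_nonneg mult_nonneg_nonneg pos_kernelD(4)[OF assms(3)])
      (use assms(4) modul_sqint[OF \<psi>] in \<open>auto simp: cpos_def\<close>)
qed

text \<open>
  A property that holds almost everywhere holds on a dense set.
\<close>
lemma AE_lborel_sequence:
  assumes "AE s in lborel. P s"
  obtains s :: "nat \<Rightarrow> real" where "\<And>n. P (s n)" "s \<longlonglongrightarrow> 0"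
proof -
  have "\<exists>t. P t \<and> 0 < t \<and> t < 1 / real (Suc n)" for n
  proof (rule ccontr)
    assume "\<nexists>t. P t \<and> 0 < t \<and> t < 1 / real (Suc n)"
    then have "AE t in lborel. t \<notin> {0<..<1 / real (Suc n)}"
      using assms by (auto elim: AE_mp)
    then have "emeasure lborel {0<..<1 / real (Suc n)} = 0"
      by (subst (asm) AE_iff_measurable[where N = "{0<..<1 / real (Suc n)}"]) auto
    then show False by simp
  qed
  then obtain s where s: "\<And>n. P (s n)" "\<And>n. 0 < s n" "\<And>n. s n < 1 / real (Suc n)" by metis
  have "s \<longlonglongrightarrow> 0"
    by (rule tendsto_sandwich[OF _ _ tendsto_const inv_Suc_tendsto])
      (use s in \<open>auto intro!: always_eventually less_imp_le\<close>)
  with s(1) show thesis by (rule that)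
qed

text \<open>
  A nonnegative continuous function of the modulation with vanishing weighted integral is zero, in
  particular at the modulation \<open>0\<close>.
\<close>
lemma cform_conv_eq_0:
  assumes "bdd_borel f" "bdd_borel g" "pos_kernel w" "cpos f g" "\<psi> \<in> sqint" "cform (conv f w) g \<psi> = 0"
  shows "cform f g \<psi> = 0"
proof -
  have nn: "0 \<le> w s * cform f g (modul s \<psi>)" for s
    using pos_kernelD(4)[OF assms(3)] assms(4) modul_sqint[OF assms(5)] by (simp add: cpos_def)
  have "AE s in lborel. w s * cform f g (modul s \<psi>) = 0"
    using assms(6) integral_nonneg_eq_0_iff_AE[OF cform_conv(1)[OF assms(1,2,3,5)]] nn
    by (simp add: cform_conv(2)[OF assms(1,2,3,5)])
  then have "AE s in lborel. cform f g (modul s \<psi>) = 0"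
    using pos_kernelD(3)[OF assms(3)] by (simp add: less_imp_neq[symmetric])
  then obtain s where s: "\<And>n. cform f g (modul (s n) \<psi>) = 0" "s \<longlonglongrightarrow> 0"
    using AE_lborel_sequence by blast
  have "(\<lambda>n. cform f g (modul (s n) \<psi>)) \<longlonglongrightarrow> cform f g (modul 0 \<psi>)"
    by (intro cform_continuous modul_L2lim modul_sqint assms s)
  then show ?thesis by (simp add: s(1) LIMSEQ_const_iff)
qed

text \<open>
  The map \<open>\<psi> \<mapsto> cnj (FT \<psi>)\<close> intertwines \<open>P\<close> with multiplication and \<open>Q\<close> with \<open>P\<close>. The exchange of the two
  factors of the commutator costs a sign, which the antilinearity of the map compensates at the factor \<open>i\<close>.
\<close>
lemma cform_swap:
  assumes f: "bdd_borel f" and g: "bdd_borel g" and \<psi>: "\<psi> \<in> sqint"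
  shows "cform f g \<psi> = cform g f (\<lambda>x. cnj (FT \<psi> x))"
proof -
  define \<phi> where "\<phi> = (\<lambda>x. cnj (FT \<psi> x))"
  have \<phi>: "\<phi> \<in> sqint" unfolding \<phi>_def by (intro sqint_cnj FT_sqint \<psi>)
  have gs: "(\<lambda>x. complex_of_real (g x) * \<psi> x) \<in> sqint" by (rule bdd_borel_mult_sqint[OF g \<psi>])
  have fs: "(\<lambda>x. complex_of_real (f x) * FT \<psi> x) \<in> sqint" by (rule bdd_borel_mult_sqint[OF f FT_sqint[OF \<psi>]])
  have fs': "(\<lambda>x. complex_of_real (f x) * \<phi> x) \<in> sqint" by (rule bdd_borel_mult_sqint[OF f \<phi>])
  have "ip (FT \<psi>) (\<lambda>\<xi>. complex_of_real (f \<xi>) * FT (\<lambda>x. complex_of_real (g x) * \<psi> x) \<xi>) =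
     ip (\<lambda>\<xi>. complex_of_real (f \<xi>) * FT \<psi> \<xi>) (FT (\<lambda>x. complex_of_real (g x) * \<psi> x))"
    by (rule ip_real_mult[symmetric])
  also have "\<dots> = cnj (ip (\<lambda>x. complex_of_real (g x) * \<psi> x) (invFT (\<lambda>\<xi>. complex_of_real (f \<xi>) * FT \<psi> \<xi>)))"
    unfolding FT_adjoint[OF fs gs, symmetric] by (rule ip_commute)
  also have "\<dots> = ip (invFT (\<lambda>\<xi>. complex_of_real (f \<xi>) * FT \<psi> \<xi>)) (\<lambda>x. complex_of_real (g x) * \<psi> x)"
    by (rule ip_commute[symmetric])
  also have "\<dots> = ip (\<lambda>x. cnj (\<psi> x)) (\<lambda>x. complex_of_real (g x) * FT (\<lambda>x. complex_of_real (f x) * \<phi> x) x)"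
    unfolding ip_def invFT_def \<phi>_def by (simp add: mult_ac)
  also have "\<dots> = ip (FT \<phi>) (\<lambda>x. complex_of_real (g x) * FT (\<lambda>x. complex_of_real (f x) * \<phi> x) x)"
  proof (rule ip_cong_AE)
    show "AE x in lborel. cnj (\<psi> x) = FT \<phi> x"
      using invFT_FT[OF \<psi>] unfolding invFT_def \<phi>_def[symmetric]
      by eventually_elim (metis complex_cnj_cnj)
  qed (auto intro!: sqint_measurable sqint_cnj \<psi> FT_sqint \<phi> bdd_borel_mult_sqint f g)
  finally show ?thesis by (simp add: cform_def \<phi>_def)
qed

lemma cpos_swap:
  assumes "bdd_borel f" "bdd_borel g" "cpos f g" shows "cpos g f"
  unfolding cpos_def
proof
  fix \<psi> assume \<psi>: "\<psi> \<in> sqint"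
  show "0 \<le> cform g f \<psi>"
    unfolding cform_swap[OF assms(2,1) \<psi>] using assms(3) sqint_cnj[OF FT_sqint[OF \<psi>]] by (simp add: cpos_def)
qed

definition czero :: "(real \<Rightarrow> real) \<Rightarrow> (real \<Rightarrow> real) \<Rightarrow> bool" where
  "czero f g \<longleftrightarrow> (\<forall>\<psi>\<in>sqint. cform f g \<psi> = 0)"

lemma czero_swap:
  assumes "bdd_borel f" "bdd_borel g" "czero f g" shows "czero g f"
  unfolding czero_def
proof
  fix \<psi> assume \<psi>: "\<psi> \<in> sqint"
  show "cform g f \<psi> = 0"
    unfolding cform_swap[OF assms(2,1) \<psi>] using assms(3) sqint_cnj[OF FT_sqint[OF \<psi>]] by (simp add: czero_def)
qed

lemma czero_conv:
  assumes "bdd_borel f" "bdd_borel g" "pos_kernel w" "cpos f g" "czero (conv f w) g"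
  shows "czero f g"
  using assms cform_conv_eq_0 by (auto simp: czero_def)

lemma cform_minus:
  assumes g: "bdd_borel g" and \<psi>: "\<psi> \<in> sqint" and f: "bdd_borel f"
  shows "cform (\<lambda>x. - f x) (\<lambda>x. - g x) \<psi> = cform f g \<psi>"
proof -
  have gs: "(\<lambda>x. complex_of_real (g x) * \<psi> x) \<in> sqint" by (rule bdd_borel_mult_sqint[OF g \<psi>])
  have gm: "(\<lambda>x. complex_of_real (- g x) * \<psi> x) = (\<lambda>x. (- 1) * (complex_of_real (g x) * \<psi> x))" by auto
  have gs': "(\<lambda>x. (- 1) * (complex_of_real (g x) * \<psi> x)) \<in> sqint" by (rule sqint_cmult[OF gs])
  have [measurable]: "f \<in> borel_measurable borel" using f by (auto simp: bdd_borel_def)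
  have [measurable]: "FT \<psi> \<in> borel_measurable borel" "FT (\<lambda>x. complex_of_real (g x) * \<psi> x) \<in> borel_measurable borel"
     "FT (\<lambda>x. (- 1) * (complex_of_real (g x) * \<psi> x)) \<in> borel_measurable borel"
    by (intro FT_measurable \<psi> gs gs')+
  have "ip (FT \<psi>) (\<lambda>\<xi>. complex_of_real (- f \<xi>) * FT (\<lambda>x. (- 1) * (complex_of_real (g x) * \<psi> x)) \<xi>) =
      ip (FT \<psi>) (\<lambda>\<xi>. complex_of_real (f \<xi>) * FT (\<lambda>x. complex_of_real (g x) * \<psi> x) \<xi>)"
  proof (rule ip_cong_AE)
    show "AE \<xi> in lborel. complex_of_real (- f \<xi>) * FT (\<lambda>x. (- 1) * (complex_of_real (g x) * \<psi> x)) \<xi> =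
        complex_of_real (f \<xi>) * FT (\<lambda>x. complex_of_real (g x) * \<psi> x) \<xi>"
      using FT_cmult[OF gs, of "-1"] by eventually_elim simp
  qed measurable
  then show ?thesis unfolding cform_def gm by simp
qed

lemma cform_AE_const:
  assumes f: "bdd_borel f" and g: "bdd_borel g" and \<psi>: "\<psi> \<in> sqint" and c: "AE x in lborel. f x = c"
  shows "cform f g \<psi> = 0"
proof -
  have gs: "(\<lambda>x. complex_of_real (g x) * \<psi> x) \<in> sqint" by (rule bdd_borel_mult_sqint[OF g \<psi>])
  have [measurable]: "f \<in> borel_measurable borel" using f by (auto simp: bdd_borel_def)
  have [measurable]: "FT \<psi> \<in> borel_measurable borel" "FT (\<lambda>x. complex_of_real (g x) * \<psi> x) \<in> borel_measurable borel"
    by (intro FT_measurable \<psi> gs)+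
  have "ip (FT \<psi>) (\<lambda>\<xi>. complex_of_real (f \<xi>) * FT (\<lambda>x. complex_of_real (g x) * \<psi> x) \<xi>) =
      ip (FT \<psi>) (\<lambda>\<xi>. complex_of_real c * FT (\<lambda>x. complex_of_real (g x) * \<psi> x) \<xi>)"
    by (rule ip_cong_AE) (use c in \<open>auto elim: AE_mp\<close>)
  also have "\<dots> = complex_of_real c * ip \<psi> (\<lambda>x. complex_of_real (g x) * \<psi> x)"
    by (simp add: ip_cmult_right FT_parseval \<psi> gs)
  finally have 1: "ip (FT \<psi>) (\<lambda>\<xi>. complex_of_real (f \<xi>) * FT (\<lambda>x. complex_of_real (g x) * \<psi> x) \<xi>) =
     complex_of_real c * ip \<psi> (\<lambda>x. complex_of_real (g x) * \<psi> x)" .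
  have "ip \<psi> (\<lambda>x. complex_of_real (g x) * \<psi> x) = cnj (ip \<psi> (\<lambda>x. complex_of_real (g x) * \<psi> x))"
    using ip_commute[of "\<lambda>x. complex_of_real (g x) * \<psi> x" \<psi>] ip_real_mult[of g \<psi> \<psi>] ip_commute by metis
  then have "Im (ip \<psi> (\<lambda>x. complex_of_real (g x) * \<psi> x)) = 0"
    by (metis Reals_cnj_iff complex_is_Real_iff)
  then show ?thesis by (simp add: cform_def 1)
qed

section \<open>Wide Poisson averages\<close>

lemma pos_kernel_poisson: "0 < e \<Longrightarrow> pos_kernel (poisson e)"
  by (simp add: pos_kernel_def poisson_integral poisson_pos)

text \<open>
  The derivative of the Poisson kernel, up to its sign: \<open>dpoisson S s = - poisson S' s\<close>.
\<close>
definition dpoisson :: "real \<Rightarrow> real \<Rightarrow> real" where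
  "dpoisson S s = 2 * s * S / (pi * (S\<^sup>2 + s\<^sup>2)\<^sup>2)"

lemma dpoisson_measurable [measurable]: "dpoisson S \<in> borel_measurable borel"
  unfolding dpoisson_def[abs_def] by measurable

text \<open>
  The remainder of the Taylor expansion of the kernel is bounded by a multiple of the kernel itself,
  uniformly in \<open>h\<close>. It is an explicit rational function: with \<open>A = S\<^sup>2 + s\<^sup>2\<close>, \<open>B = S\<^sup>2 + (h - s)\<^sup>2\<close> and
  \<open>R = 3 s\<^sup>2 - 2 h s - S\<^sup>2\<close> it equals \<open>S h\<^sup>2 R / (\<pi> A\<^sup>2 B)\<close>.
\<close>
lemma poisson_taylor:
  assumes S: "0 < S"
  shows "\<bar>poisson S (h - s) - poisson S s - h * dpoisson S s\<bar> \<le> 2 * h\<^sup>2 / S\<^sup>2 * poisson S s"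
proof -
  define A where "A = S\<^sup>2 + s\<^sup>2"
  define B where "B = S\<^sup>2 + (h - s)\<^sup>2"
  define R where "R = 4 * s\<^sup>2 - 2 * h * s - A"
  have S2: "0 < S\<^sup>2" using S by simp
  have A: "0 < A" and B: "0 < B" using S2 by (auto simp: A_def B_def intro: add_pos_nonneg)
  have AB: "A - B = 2 * h * s - h\<^sup>2" by (simp add: A_def B_def power2_eq_square algebra_simps)
  have "A\<^sup>2 - A * B - 2 * h * s * B = A * (A - B) - 2 * h * s * A + 2 * h * s * (A - B)"
    by (simp add: power2_eq_square algebra_simps)
  also have "\<dots> = h\<^sup>2 * R"
    unfolding AB R_def by (simp add: power2_eq_square algebra_simps)
  finally have num: "A\<^sup>2 - A * B - 2 * h * s * B = h\<^sup>2 * R" .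
  have "poisson S (h - s) - poisson S s - h * dpoisson S s = S / pi * (1 / B - 1 / A - 2 * h * s / A\<^sup>2)"
    by (simp add: poisson_def dpoisson_def A_def B_def algebra_simps)
  also have "1 / B - 1 / A - 2 * h * s / A\<^sup>2 = (A\<^sup>2 - A * B - 2 * h * s * B) / (A\<^sup>2 * B)"
    using A B by (simp add: field_simps power2_eq_square)
  finally have eq: "poisson S (h - s) - poisson S s - h * dpoisson S s = S / pi * (h\<^sup>2 * R / (A\<^sup>2 * B))"
    by (simp add: num)
  have R: "\<bar>R\<bar> * S\<^sup>2 \<le> 2 * A * B"
  proof -
    define d where "d = s - h"
    have Rd: "R = s\<^sup>2 - S\<^sup>2 + 2 * s * d" by (simp add: R_def A_def d_def power2_eq_square algebra_simps)
    have Bd: "B = S\<^sup>2 + d\<^sup>2" by (simp add: B_def d_def power2_commute)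
    have "\<bar>R\<bar> \<le> A + 2 * (\<bar>s\<bar> * \<bar>d\<bar>)"
      unfolding Rd A_def using abs_triangle_ineq[of "s\<^sup>2 - S\<^sup>2" "2 * s * d"] abs_triangle_ineq4[of "s\<^sup>2" "S\<^sup>2"]
      by (simp add: abs_mult)
    then have "\<bar>R\<bar> * S\<^sup>2 \<le> (A + 2 * (\<bar>s\<bar> * \<bar>d\<bar>)) * S\<^sup>2" by (rule mult_right_mono) simp
    moreover have "A * S\<^sup>2 \<le> A * B" using A by (simp add: Bd)
    moreover have "(2 * (S * \<bar>s\<bar>)) * (2 * (S * \<bar>d\<bar>)) \<le> A * B"
    proof (rule mult_mono)
      show "2 * (S * \<bar>s\<bar>) \<le> A" "2 * (S * \<bar>d\<bar>) \<le> B"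
        using zero_le_power2[of "S - \<bar>s\<bar>"] zero_le_power2[of "S - \<bar>d\<bar>"]
        by (simp_all add: A_def Bd power2_diff)
    qed (use A S in auto)
    moreover have "0 \<le> \<bar>s\<bar> * \<bar>d\<bar> * S\<^sup>2" by simp
    ultimately show ?thesis by (simp add: algebra_simps power2_eq_square)
  qed
  have "\<bar>S / pi * (h\<^sup>2 * R / (A\<^sup>2 * B))\<bar> = S / pi * (h\<^sup>2 / (S\<^sup>2 * A\<^sup>2 * B)) * (\<bar>R\<bar> * S\<^sup>2)"
    using S A B by (simp add: abs_mult abs_divide)
  also have "\<dots> \<le> S / pi * (h\<^sup>2 / (S\<^sup>2 * A\<^sup>2 * B)) * (2 * A * B)"
    using R S A B by (intro mult_left_mono) auto
  also have "\<dots> = 2 * h\<^sup>2 / S\<^sup>2 * (S / (pi * A))"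
    using A B by (simp add: power2_eq_square mult_ac)
  finally show ?thesis unfolding eq by (simp add: poisson_def A_def)
qed

lemma dpoisson_le:
  assumes S: "0 < S" shows "\<bar>dpoisson S s\<bar> \<le> poisson S s / S"
proof -
  define A where "A = S\<^sup>2 + s\<^sup>2"
  have A: "0 < A" using S by (auto simp: A_def intro: add_pos_nonneg)
  have "2 * (S * \<bar>s\<bar>) \<le> A"
    using zero_le_power2[of "S - \<bar>s\<bar>"] by (simp add: A_def power2_diff)
  then have "2 * (S * \<bar>s\<bar>) / (pi * A\<^sup>2) \<le> A / (pi * A\<^sup>2)" by (intro divide_right_mono) auto
  moreover have "A / (pi * A\<^sup>2) = 1 / (pi * A)" using A by (simp add: power2_eq_square)
  ultimately show ?thesis
    using S A by (simp add: dpoisson_def poisson_def A_def[symmetric] abs_mult abs_divide mult_ac)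
qed

text \<open>
  The derivative at \<open>a\<close> of the Poisson mean of \<open>f\<close> of width \<open>S\<close>, see \<open>conv_poisson_deriv\<close>.
\<close>
definition slope :: "real \<Rightarrow> real \<Rightarrow> (real \<Rightarrow> real) \<Rightarrow> real" where
  "slope S a f = (LINT x|lborel. f x * dpoisson S (x - a))"

lemma conv_alt: "conv f w x = (LINT s|lborel. f s * w (x - s))"
  unfolding conv_def
  using lborel_integral_real_affine[of "-1" "\<lambda>s. f s * w (x - s)" x] by simp

lemma bounded_mult_integrable:
  fixes w :: "real \<Rightarrow> real"
  assumes "bdd_borel f" "integrable lborel w"
  shows "integrable lborel (\<lambda>s. f s * w s)"
proof -
  obtain M where M: "\<And>x. \<bar>f x\<bar> \<le> M" "0 \<le> M" using bdd_borelE[OF assms(1)] by blast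
  have [measurable]: "f \<in> borel_measurable borel" "w \<in> borel_measurable borel"
    using assms by (auto simp: bdd_borel_def)
  show ?thesis
  proof (rule Bochner_Integration.integrable_bound)
    show "integrable lborel (\<lambda>s. M * w s)" using assms(2) by simp
    show "AE s in lborel. norm (f s * w s) \<le> norm (M * w s)"
      using M by (auto simp: abs_mult intro!: mult_right_mono)
  qed measurable
qed

lemma dpoisson_integrable:
  assumes "0 < S" shows "integrable lborel (\<lambda>x. dpoisson S (x - a))"
proof (rule Bochner_Integration.integrable_bound)
  show "integrable lborel (\<lambda>x. poisson S (x - a) / S)"
    using poisson_shift(3)[OF assms] by simp
  show "AE x in lborel. norm (dpoisson S (x - a)) \<le> norm (poisson S (x - a) / S)"
    using dpoisson_le[OF assms] poisson_nonneg[OF assms] assms by auto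
qed measurable

lemma conv_poisson_taylor:
  assumes f: "bdd_borel f" and M: "\<And>x. \<bar>f x\<bar> \<le> M" and S: "0 < S"
  shows "\<bar>conv f (poisson S) (a + h) - conv f (poisson S) a - h * slope S a f\<bar> \<le> 2 * M * h\<^sup>2 / S\<^sup>2"
proof -
  have i1: "integrable lborel (\<lambda>x. f x * poisson S (b - x))" for b
    by (rule bounded_mult_integrable[OF f poisson_shift(1)[OF S]])
  have i2: "integrable lborel (\<lambda>x. f x * dpoisson S (x - a))"
    by (rule bounded_mult_integrable[OF f dpoisson_integrable[OF S]])
  have eq: "conv f (poisson S) (a + h) - conv f (poisson S) a - h * slope S a f =
     (LINT x|lborel. f x * poisson S (a + h - x) - f x * poisson S (a - x) - h * (f x * dpoisson S (x - a)))"
    unfolding conv_alt slope_def using i1 i2 by simp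
  have "norm (conv f (poisson S) (a + h) - conv f (poisson S) a - h * slope S a f) \<le>
      (LINT x|lborel. 2 * M * h\<^sup>2 / S\<^sup>2 * poisson S (x - a))"
    unfolding eq
  proof (rule integral_norm_le)
    show "integrable lborel (\<lambda>x. 2 * M * h\<^sup>2 / S\<^sup>2 * poisson S (x - a))"
      using poisson_shift(3)[OF S] by simp
    fix x
    have e: "poisson S (a - x) = poisson S (x - a)" using poisson_even[of S "x - a"] by simp
    have "norm (f x * poisson S (a + h - x) - f x * poisson S (a - x) - h * (f x * dpoisson S (x - a))) =
       \<bar>f x\<bar> * \<bar>poisson S (h - (x - a)) - poisson S (x - a) - h * dpoisson S (x - a)\<bar>"
      unfolding real_norm_def abs_mult[symmetric] e by (simp add: algebra_simps)
    also have "\<dots> \<le> M * (2 * h\<^sup>2 / S\<^sup>2 * poisson S (x - a))"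
      using M poisson_taylor[OF S] order_trans[OF abs_ge_zero M] by (intro mult_mono) auto
    finally show "norm (f x * poisson S (a + h - x) - f x * poisson S (a - x) - h * (f x * dpoisson S (x - a)))
       \<le> 2 * M * h\<^sup>2 / S\<^sup>2 * poisson S (x - a)" by (simp add: mult_ac)
  qed
  also have "\<dots> = 2 * M * h\<^sup>2 / S\<^sup>2" using poisson_shift(4)[OF S] by simp
  finally show ?thesis by simp
qed

lemma conv_poisson_deriv:
  assumes f: "bdd_borel f" and S: "0 < S"
  shows "(conv f (poisson S) has_real_derivative slope S a f) (at a)"
proof -
  obtain M where M: "\<And>x. \<bar>f x\<bar> \<le> M" "0 \<le> M" using bdd_borelE[OF f] by blast
  define V where "V = conv f (poisson S)"
  have "((\<lambda>h. (V (a + h) - V a) / h - slope S a f) \<longlongrightarrow> 0) (at 0)"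
  proof (rule Lim_null_comparison)
    have "((\<lambda>h. 2 * M * \<bar>h\<bar> / S\<^sup>2) \<longlongrightarrow> 2 * M * \<bar>0\<bar> / S\<^sup>2) (at 0)"
      using S by (intro tendsto_intros) auto
    then show "((\<lambda>h. 2 * M * \<bar>h\<bar> / S\<^sup>2) \<longlongrightarrow> 0) (at 0)" by simp
    show "\<forall>\<^sub>F h in at 0. norm ((V (a + h) - V a) / h - slope S a f) \<le> 2 * M * \<bar>h\<bar> / S\<^sup>2"
      unfolding eventually_at_topological
    proof (intro exI[of _ UNIV] conjI ballI impI)
      fix h :: real assume h: "h \<noteq> 0"
      have "(V (a + h) - V a) / h - slope S a f = (V (a + h) - V a - h * slope S a f) / h"
        using h by (simp add: field_simps)
      then have "norm ((V (a + h) - V a) / h - slope S a f) = \<bar>V (a + h) - V a - h * slope S a f\<bar> / \<bar>h\<bar>"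
        by simp
      also have "\<dots> \<le> (2 * M * h\<^sup>2 / S\<^sup>2) / \<bar>h\<bar>"
        unfolding V_def by (intro divide_right_mono conv_poisson_taylor f M S) auto
      also have "\<dots> = 2 * M * \<bar>h\<bar> / S\<^sup>2"
        using h by (simp add: power2_eq_square abs_mult_self_eq[of h, symmetric] del: abs_mult_self_eq)
      finally show "norm ((V (a + h) - V a) / h - slope S a f) \<le> 2 * M * \<bar>h\<bar> / S\<^sup>2" .
    qed auto
  qed
  then show ?thesis unfolding DERIV_def V_def by (simp add: LIM_zero_iff)
qed

text \<open>
  The domain of \<open>P\<^sup>2\<close>, on which a quadratic error in the Fourier variable can be controlled.
\<close>
definition dom_P2 :: "(real \<Rightarrow> complex) \<Rightarrow> bool" where
  "dom_P2 \<psi> \<longleftrightarrow> \<psi> \<in> sqint \<and> (\<lambda>\<xi>. complex_of_real \<xi> * FT \<psi> \<xi>) \<in> sqint \<and>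
     (\<lambda>\<xi>. complex_of_real (\<xi>\<^sup>2) * FT \<psi> \<xi>) \<in> sqint"

text \<open>
  The form of \<open>i[P, g(Q)]\<close>, which is what \<open>cform\<close> becomes for the unbounded function \<open>f(\<xi>) = \<xi>\<close>.
\<close>
definition moment_form :: "(real \<Rightarrow> real) \<Rightarrow> (real \<Rightarrow> complex) \<Rightarrow> real" where
  "moment_form g \<psi> = - 2 * Im (ip (\<lambda>\<xi>. complex_of_real \<xi> * FT \<psi> \<xi>) (FT (\<lambda>x. complex_of_real (g x) * \<psi> x)))"

text \<open>
  On the Fourier side the Poisson mean of \<open>f\<close> equals a constant, plus \<open>\<xi>\<close> times the slope at \<open>0\<close>, plus an
  error of order \<open>\<xi>\<^sup>2 / S\<^sup>2\<close>. The constant commutes with \<open>g(Q)\<close> and does not contribute.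
\<close>
lemma cform_conv_poisson_asymp:
  assumes f: "bdd_borel f" and g: "bdd_borel g" and n: "dom_P2 \<psi>"
  obtains K where "0 \<le> K" "\<And>S. 0 < S \<Longrightarrow> \<bar>cform (conv f (poisson S)) g \<psi> - slope S 0 f * moment_form g \<psi>\<bar> \<le> K / S\<^sup>2"
proof -
  obtain M where M: "\<And>x. \<bar>f x\<bar> \<le> M" "0 \<le> M" using bdd_borelE[OF f] by blast
  define \<phi>1 where "\<phi>1 = (\<lambda>\<xi>. complex_of_real \<xi> * FT \<psi> \<xi>)"
  define \<phi>2 where "\<phi>2 = (\<lambda>\<xi>. complex_of_real (\<xi>\<^sup>2) * FT \<psi> \<xi>)"
  have s: "\<psi> \<in> sqint" "\<phi>1 \<in> sqint" "\<phi>2 \<in> sqint" using n by (auto simp: dom_P2_def \<phi>1_def \<phi>2_def)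
  have F: "FT \<psi> \<in> sqint" by (rule FT_sqint[OF s(1)])
  have gs: "(\<lambda>x. complex_of_real (g x) * \<psi> x) \<in> sqint" by (rule bdd_borel_mult_sqint[OF g s(1)])
  define H where "H = FT (\<lambda>x. complex_of_real (g x) * \<psi> x)"
  have H: "H \<in> sqint" unfolding H_def by (rule FT_sqint[OF gs])
  define K where "K = 4 * M * sqrt (nsq \<phi>2) * sqrt (nsq H)"
  have bound: "\<bar>cform (conv f (poisson S)) g \<psi> - slope S 0 f * moment_form g \<psi>\<bar> \<le> K / S\<^sup>2" if S: "0 < S" for S
  proof -
    define V where "V = conv f (poisson S)"
    define r where "r \<xi> = V \<xi> - V 0 - \<xi> * slope S 0 f" for \<xi>
    define C where "C = 2 * M / S\<^sup>2"
    have C: "0 \<le> C" using M by (simp add: C_def)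
    have V: "bdd_borel V" unfolding V_def by (rule bdd_borel_conv[OF f pos_kernel_poisson[OF S]])
    have [measurable]: "V \<in> borel_measurable borel" using V by (simp add: bdd_borel_def)
    have [measurable]: "FT \<psi> \<in> borel_measurable borel" by (rule sqint_measurable[OF F])
    have rb: "\<bar>r \<xi>\<bar> \<le> C * \<xi>\<^sup>2" for \<xi>
      using conv_poisson_taylor[OF f M(1) S, of 0 \<xi>] by (simp add: r_def V_def C_def)
    define \<rho> where "\<rho> = (\<lambda>\<xi>. complex_of_real (r \<xi>) * FT \<psi> \<xi>)"
    have \<rho>m: "\<rho> \<in> borel_measurable borel" unfolding \<rho>_def r_def by measurable
    have \<rho>b: "cmod (\<rho> \<xi>) \<le> C * cmod (\<phi>2 \<xi>)" for \<xi>
      using mult_right_mono[OF rb, of "cmod (FT \<psi> \<xi>)" \<xi>] by (simp add: \<rho>_def \<phi>2_def norm_mult norm_power)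
    have \<rho>: "\<rho> \<in> sqint" by (rule sqint_dominated[OF s(3) \<rho>m \<rho>b])
    have n\<rho>: "sqrt (nsq \<rho>) \<le> C * sqrt (nsq \<phi>2)"
      using real_sqrt_le_mono[OF nsq_mono[OF s(3) \<rho>m C \<rho>b]] C by (simp add: real_sqrt_mult)
    have V\<phi>: "(\<lambda>\<xi>. complex_of_real (V \<xi>) * FT \<psi> \<xi>) = (\<lambda>\<xi>. (complex_of_real (V 0) * FT \<psi> \<xi> + complex_of_real (slope S 0 f) * \<phi>1 \<xi>) + \<rho> \<xi>)"
      by (simp add: \<rho>_def r_def \<phi>1_def algebra_simps)
    have "ip (FT \<psi>) (\<lambda>\<xi>. complex_of_real (V \<xi>) * H \<xi>) = ip (\<lambda>\<xi>. complex_of_real (V \<xi>) * FT \<psi> \<xi>) H"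
      by (rule ip_real_mult[symmetric])
    also have "\<dots> = complex_of_real (V 0) * ip (FT \<psi>) H + complex_of_real (slope S 0 f) * ip \<phi>1 H + ip \<rho> H"
      unfolding V\<phi> using F s H \<rho> by (simp add: ip_add_left sqint_add sqint_cmult ip_cmult_left)
    finally have e1: "ip (FT \<psi>) (\<lambda>\<xi>. complex_of_real (V \<xi>) * H \<xi>) =
       complex_of_real (V 0) * ip (FT \<psi>) H + complex_of_real (slope S 0 f) * ip \<phi>1 H + ip \<rho> H" .
    have "Im (ip (FT \<psi>) H) = 0"
      using cform_AE_const[of "\<lambda>_. 1" g \<psi> 1] g s(1) by (simp add: cform_def H_def bdd_borel_def) blast
    then have "cform V g \<psi> = slope S 0 f * moment_form g \<psi> - 2 * Im (ip \<rho> H)"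
      unfolding cform_def moment_form_def H_def[symmetric] \<phi>1_def[symmetric] e1 by simp
    then have "\<bar>cform V g \<psi> - slope S 0 f * moment_form g \<psi>\<bar> = 2 * \<bar>Im (ip \<rho> H)\<bar>" by simp
    also have "\<dots> \<le> 2 * (sqrt (nsq \<rho>) * sqrt (nsq H))"
      using abs_Im_le_cmod[of "ip \<rho> H"] ip_bound[OF \<rho> H] by linarith
    also have "\<dots> \<le> 2 * (C * sqrt (nsq \<phi>2) * sqrt (nsq H))"
      using n\<rho> by (intro mult_left_mono mult_right_mono) auto
    also have "\<dots> = K / S\<^sup>2" by (simp add: C_def K_def)
    finally show ?thesis by (simp add: V_def)
  qed
  show thesis by (rule that[OF _ bound]) (use M in \<open>auto simp: K_def\<close>)
qed

section \<open>Monotonicity\<close>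

lemma sqint_cong_AE:
  assumes "\<phi> \<in> sqint" "\<psi> \<in> borel_measurable borel" "AE x in lborel. \<psi> x = \<phi> x"
  shows "\<psi> \<in> sqint"
proof -
  have "AE x in lborel. (cmod (\<psi> x))\<^sup>2 = (cmod (\<phi> x))\<^sup>2" using assms(3) by eventually_elim simp
  then have "integrable lborel (\<lambda>x. (cmod (\<psi> x))\<^sup>2) \<longleftrightarrow> integrable lborel (\<lambda>x. (cmod (\<phi> x))\<^sup>2)"
    using assms(1,2) by (intro integrable_cong_AE) auto
  with assms show ?thesis by (simp add: sqint_def)
qed

lemma dom_P2_invFT:
  assumes "\<phi> \<in> sqint" "(\<lambda>\<xi>. complex_of_real \<xi> * \<phi> \<xi>) \<in> sqint" "(\<lambda>\<xi>. complex_of_real (\<xi>\<^sup>2) * \<phi> \<xi>) \<in> sqint"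
  shows "dom_P2 (invFT \<phi>)"
proof -
  have s: "invFT \<phi> \<in> sqint" by (rule invFT_sqint[OF assms(1)])
  have [measurable]: "FT (invFT \<phi>) \<in> borel_measurable borel" by (rule FT_measurable[OF s])
  note ae = FT_invFT[OF assms(1)]
  have "(\<lambda>\<xi>. complex_of_real \<xi> * FT (invFT \<phi>) \<xi>) \<in> sqint"
  proof (rule sqint_cong_AE[OF assms(2)])
    show "AE \<xi> in lborel. complex_of_real \<xi> * FT (invFT \<phi>) \<xi> = complex_of_real \<xi> * \<phi> \<xi>"
      using ae by eventually_elim simp
  qed measurable
  moreover have "(\<lambda>\<xi>. complex_of_real (\<xi>\<^sup>2) * FT (invFT \<phi>) \<xi>) \<in> sqint"
  proof (rule sqint_cong_AE[OF assms(3)])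
    show "AE \<xi> in lborel. complex_of_real (\<xi>\<^sup>2) * FT (invFT \<phi>) \<xi> = complex_of_real (\<xi>\<^sup>2) * \<phi> \<xi>"
      using ae by eventually_elim simp
  qed measurable
  ultimately show ?thesis using s by (simp add: dom_P2_def)
qed

lemma dom_P2_dense:
  assumes \<psi>: "\<psi> \<in> sqint"
  obtains \<Psi> where "\<And>n. dom_P2 (\<Psi> n)" "L2lim \<Psi> \<psi> sequentially"
proof -
  define \<phi> where "\<phi> = FT \<psi>"
  have \<phi>: "\<phi> \<in> sqint" unfolding \<phi>_def by (rule FT_sqint[OF \<psi>])
  define \<Psi> where "\<Psi> n = invFT (trunc (real n) \<phi>)" for n
  have t: "trunc (real n) \<phi> \<in> sqint" for n by (rule trunc_sqint[OF \<phi>])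
  have [measurable]: "trunc (real n) \<phi> \<in> borel_measurable borel" for n by (rule sqint_measurable[OF t])
  have dom_P2: "dom_P2 (\<Psi> n)" for n
    unfolding \<Psi>_def
  proof (rule dom_P2_invFT[OF t])
    show "(\<lambda>\<xi>. complex_of_real \<xi> * trunc (real n) \<phi> \<xi>) \<in> sqint"
    proof (rule sqint_dominated[OF \<phi>, where C = "real n"])
      show "cmod (complex_of_real \<xi> * trunc (real n) \<phi> \<xi>) \<le> real n * cmod (\<phi> \<xi>)" for \<xi>
        by (auto simp: trunc_def norm_mult intro: mult_right_mono)
    qed measurable
    show "(\<lambda>\<xi>. complex_of_real (\<xi>\<^sup>2) * trunc (real n) \<phi> \<xi>) \<in> sqint"
    proof (rule sqint_dominated[OF \<phi>, where C = "(real n)\<^sup>2"])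
      show "cmod (complex_of_real (\<xi>\<^sup>2) * trunc (real n) \<phi> \<xi>) \<le> (real n)\<^sup>2 * cmod (\<phi> \<xi>)" for \<xi>
      proof (cases "\<bar>\<xi>\<bar> \<le> real n")
        case True
        from power_mono[OF this, of 2] have "\<xi>\<^sup>2 \<le> (real n)\<^sup>2" by simp
        with True show ?thesis by (auto simp: trunc_def norm_mult norm_power intro: mult_right_mono)
      qed (auto simp: trunc_def)
    qed measurable
  qed
  have "nsq (\<lambda>x. \<Psi> n x - \<psi> x) = nsq (\<lambda>x. trunc (real n) \<phi> x - \<phi> x)" for n
  proof -
    have s: "\<Psi> n \<in> sqint" using dom_P2 by (simp add: dom_P2_def)
    have "nsq (\<lambda>x. \<Psi> n x - \<psi> x) = nsq (FT (\<lambda>x. \<Psi> n x - \<psi> x))"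
      by (simp add: FT_plancherel sqint_diff s \<psi>)
    also have "\<dots> = nsq (\<lambda>x. trunc (real n) \<phi> x - \<phi> x)"
    proof (rule nsq_cong_AE)
      show "AE x in lborel. FT (\<lambda>x. \<Psi> n x - \<psi> x) x = trunc (real n) \<phi> x - \<phi> x"
        using FT_diff[OF s \<psi>] FT_invFT[OF t[of n]] by eventually_elim (simp add: \<Psi>_def \<phi>_def)
    qed (auto intro!: sqint_measurable FT_sqint sqint_diff s \<psi> t \<phi>)
    finally show ?thesis .
  qed
  then have "L2lim \<Psi> \<psi> sequentially"
    using filterlim_compose[OF trunc_L2lim[OF \<phi>, unfolded L2lim_def] filterlim_real_sequentially]
    by (simp add: L2lim_def)
  with dom_P2 show thesis by (rule that)
qed

lemma poisson_scaled_ge: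
  assumes "1 \<le> S" shows "poisson 1 t \<le> S * poisson S t"
proof -
  have S2: "1 \<le> S\<^sup>2" using assms by (simp add: one_le_power)
  have p: "0 < 1 + t\<^sup>2" "0 < S\<^sup>2 + t\<^sup>2" 
    using add_pos_nonneg[of 1 "t\<^sup>2"] add_pos_nonneg[of "S\<^sup>2" "t\<^sup>2"] S2 by simp_all
  have "S\<^sup>2 + t\<^sup>2 \<le> S\<^sup>2 * (1 + t\<^sup>2)"
    using mult_right_mono[OF S2, of "t\<^sup>2"] by (simp add: algebra_simps)
  then have "1 / (1 + t\<^sup>2) \<le> S\<^sup>2 / (S\<^sup>2 + t\<^sup>2)"
    using p by (simp add: divide_simps mult.commute)
  then have "1 / (1 + t\<^sup>2) / pi \<le> S\<^sup>2 / (S\<^sup>2 + t\<^sup>2) / pi" by (intro divide_right_mono) auto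
  then show ?thesis by (simp add: poisson_def power2_eq_square mult.commute)
qed

text \<open>
  The kernel \<open>S poisson S\<close> dominates \<open>poisson 1\<close> for \<open>S \<ge> 1\<close>. If \<open>S\<close> times the slope were
  small along a sequence, then by \<open>cform_conv_poisson_asymp\<close> the averages of the form over these kernels would tend to
  \<open>0\<close>, and so would the smaller average over \<open>poisson 1\<close>; this makes the form itself vanish.
\<close>
lemma slope_lower_bound:
  assumes f: "bdd_borel f" and g: "bdd_borel g" and pos: "cpos f g" and nz: "\<not> czero f g"
  obtains \<delta> S0 where "0 < \<delta>" "\<And>S. S0 \<le> S \<Longrightarrow> \<delta> \<le> \<bar>S * slope S 0 f\<bar>"
proof (rule ccontr)
  assume "\<not> thesis"
  then have ex: "\<exists>S\<ge>S0. \<bar>S * slope S 0 f\<bar> < \<delta>" if "0 < \<delta>" for \<delta> S0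
    using that \<open>\<And>\<delta> S0. 0 < \<delta> \<Longrightarrow> (\<And>S. S0 \<le> S \<Longrightarrow> \<delta> \<le> \<bar>S * slope S 0 f\<bar>) \<Longrightarrow> thesis\<close>
    by (meson not_le)
  have "\<exists>S\<ge>real (Suc n). \<bar>S * slope S 0 f\<bar> < 1 / real (Suc n)" for n
    by (rule ex) simp
  then obtain S where S: "\<And>n. real (Suc n) \<le> S n" "\<And>n. \<bar>S n * slope (S n) 0 f\<bar> < 1 / real (Suc n)"
    by metis
  have S1: "1 \<le> S n" for n using S(1)[of n] by simp
  have zero: "cform (conv f (poisson 1)) g \<psi> = 0" if n: "dom_P2 \<psi>" for \<psi>
  proof -
    have \<psi>: "\<psi> \<in> sqint" using n by (simp add: dom_P2_def)
    obtain K where K: "0 \<le> K" "\<And>S. 0 < S \<Longrightarrow> \<bar>cform (conv f (poisson S)) g \<psi> - slope S 0 f * moment_form g \<psi>\<bar> \<le> K / S\<^sup>2"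
      using cform_conv_poisson_asymp[OF f g n] by blast
    have le: "cform (conv f (poisson 1)) g \<psi> \<le> (K + \<bar>moment_form g \<psi>\<bar>) * (1 / real (Suc n))" for n
    proof -
      have p: "0 < S n" using S1[of n] by simp
      have "cform (conv f (poisson 1)) g \<psi> \<le> (LINT s|lborel. S n * (poisson (S n) s * cform f g (modul s \<psi>)))"
        unfolding cform_conv(2)[OF f g pos_kernel_poisson[OF zero_less_one] \<psi>]
      proof (rule integral_mono)
        show "integrable lborel (\<lambda>s. poisson 1 s * cform f g (modul s \<psi>))"
          by (rule cform_conv(1)[OF f g pos_kernel_poisson[OF zero_less_one] \<psi>])
        show "integrable lborel (\<lambda>s. S n * (poisson (S n) s * cform f g (modul s \<psi>)))"
          using cform_conv(1)[OF f g pos_kernel_poisson[OF p] \<psi>] by simp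
        show "poisson 1 s * cform f g (modul s \<psi>) \<le> S n * (poisson (S n) s * cform f g (modul s \<psi>))" for s
          using mult_right_mono[OF poisson_scaled_ge[OF S1, of s]] pos modul_sqint[OF \<psi>]
          by (simp add: cpos_def mult.assoc)
      qed
      also have "\<dots> = S n * cform (conv f (poisson (S n))) g \<psi>"
        by (simp add: cform_conv(2)[OF f g pos_kernel_poisson[OF p] \<psi>])
      also have "\<dots> \<le> S n * (K / (S n)\<^sup>2 + slope (S n) 0 f * moment_form g \<psi>)"
        using K(2)[OF p] p by (intro mult_left_mono) auto
      also have "\<dots> = K * (1 / S n) + S n * slope (S n) 0 f * moment_form g \<psi>"
        using p by (simp add: algebra_simps power2_eq_square)
      also have "\<dots> \<le> K * (1 / real (Suc n)) + (1 / real (Suc n)) * \<bar>moment_form g \<psi>\<bar>"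
      proof (rule add_mono)
        show "K * (1 / S n) \<le> K * (1 / real (Suc n))"
          using K(1) S(1)[of n] p by (intro mult_left_mono divide_left_mono) auto
        have "S n * slope (S n) 0 f * moment_form g \<psi> \<le> \<bar>S n * slope (S n) 0 f\<bar> * \<bar>moment_form g \<psi>\<bar>"
          unfolding abs_mult[symmetric] by (rule abs_ge_self)
        also have "\<dots> \<le> (1 / real (Suc n)) * \<bar>moment_form g \<psi>\<bar>"
          using S(2)[of n] by (intro mult_right_mono) auto
        finally show "S n * slope (S n) 0 f * moment_form g \<psi> \<le> (1 / real (Suc n)) * \<bar>moment_form g \<psi>\<bar>" .
      qed
      finally show ?thesis by (simp only: distrib_right mult.commute[of "1 / real (Suc n)"])
    qed
    have "(\<lambda>n. (K + \<bar>moment_form g \<psi>\<bar>) * (1 / real (Suc n))) \<longlonglongrightarrow> (K + \<bar>moment_form g \<psi>\<bar>) * 0"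
      by (intro tendsto_intros inv_Suc_tendsto)
    then have "cform (conv f (poisson 1)) g \<psi> \<le> (K + \<bar>moment_form g \<psi>\<bar>) * 0"
      by (rule LIMSEQ_le_const) (use le in blast)
    moreover have "0 \<le> cform (conv f (poisson 1)) g \<psi>"
      using cpos_conv[OF f g pos_kernel_poisson[OF zero_less_one] pos] \<psi> by (simp add: cpos_def)
    ultimately show ?thesis by simp
  qed
  have "czero (conv f (poisson 1)) g"
    unfolding czero_def
  proof
    fix \<psi> assume \<psi>: "\<psi> \<in> sqint"
    obtain \<Psi> where \<Psi>: "\<And>n. dom_P2 (\<Psi> n)" "L2lim \<Psi> \<psi> sequentially" using dom_P2_dense[OF \<psi>] by blast
    have "(\<lambda>n. cform (conv f (poisson 1)) g (\<Psi> n)) \<longlonglongrightarrow> cform (conv f (poisson 1)) g \<psi>"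
      by (intro cform_continuous bdd_borel_conv f g pos_kernel_poisson \<psi> \<Psi>) (use \<Psi> in \<open>auto simp: dom_P2_def\<close>)
    then show "cform (conv f (poisson 1)) g \<psi> = 0" by (simp add: zero[OF \<Psi>(1)] LIMSEQ_const_iff)
  qed
  then have "czero f g" by (rule czero_conv[OF f g pos_kernel_poisson[OF zero_less_one] pos])
  with nz show False by simp
qed

text \<open>
  Some sign \<open>c\<close> of the slope occurs for arbitrarily large widths. For these widths the error term is
  negligible against the slope, so positivity passes to \<open>c\<close> times the form of \<open>i[P, g(Q)]\<close>.
\<close>
lemma moment_form_sign:
  assumes f: "bdd_borel f" and g: "bdd_borel g" and pos: "cpos f g" and nz: "\<not> czero f g"
  obtains c \<delta> where "c = 1 \<or> c = (- 1 :: real)" "0 < \<delta>" "\<And>S0. \<exists>S\<ge>S0. 0 < S \<and> \<delta> \<le> c * (S * slope S 0 f)"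
    "\<And>\<psi>. dom_P2 \<psi> \<Longrightarrow> 0 \<le> c * moment_form g \<psi>"
proof -
  obtain \<delta> S0 where \<delta>: "0 < \<delta>" "\<And>S. S0 \<le> S \<Longrightarrow> \<delta> \<le> \<bar>S * slope S 0 f\<bar>"
    using slope_lower_bound[OF assms] by blast
  have "\<exists>c. (c = 1 \<or> c = (- 1 :: real)) \<and> (\<forall>S1. \<exists>S\<ge>S1. 0 < S \<and> \<delta> \<le> c * (S * slope S 0 f))"
  proof (cases "\<forall>S1. \<exists>S\<ge>S1. 0 < S \<and> \<delta> \<le> S * slope S 0 f")
    case True
    then show ?thesis by (intro exI[of _ 1]) simp
  next
    case False
    then obtain S1 where S1: "\<And>S. S1 \<le> S \<Longrightarrow> 0 < S \<Longrightarrow> S * slope S 0 f < \<delta>" by (meson not_le)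
    have "\<exists>S\<ge>S2. 0 < S \<and> \<delta> \<le> (- 1) * (S * slope S 0 f)" for S2
    proof -
      define S where "S = max (max S0 S1) (max S2 1)"
      have S: "S0 \<le> S" "S1 \<le> S" "S2 \<le> S" "0 < S" by (auto simp: S_def)
      show ?thesis using \<delta>(2)[OF S(1)] S1[OF S(2,4)] S by (intro exI[of _ S]) auto
    qed
    then show ?thesis by (intro exI[of _ "- 1"]) simp
  qed
  then obtain c where c: "c = 1 \<or> c = (- 1 :: real)" "\<And>S1. \<exists>S\<ge>S1. 0 < S \<and> \<delta> \<le> c * (S * slope S 0 f)" by blast
  have "0 \<le> c * moment_form g \<psi>" if n: "dom_P2 \<psi>" for \<psi>
  proof (rule ccontr)
    assume neg: "\<not> 0 \<le> c * moment_form g \<psi>"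
    have \<psi>: "\<psi> \<in> sqint" using n by (simp add: dom_P2_def)
    obtain K where K: "0 \<le> K" "\<And>S. 0 < S \<Longrightarrow> \<bar>cform (conv f (poisson S)) g \<psi> - slope S 0 f * moment_form g \<psi>\<bar> \<le> K / S\<^sup>2"
      using cform_conv_poisson_asymp[OF f g n] by blast
    define m where "m = - (c * moment_form g \<psi>)"
    have m: "0 < m" using neg by (simp add: m_def)
    obtain S where S: "K / (\<delta> * m) + 1 \<le> S" "0 < S" "\<delta> \<le> c * (S * slope S 0 f)" using c(2) by blast
    have "0 \<le> cform (conv f (poisson S)) g \<psi>"
      using cpos_conv[OF f g pos_kernel_poisson[OF S(2)] pos] \<psi> by (simp add: cpos_def)
    then have "- (slope S 0 f * moment_form g \<psi>) \<le> K / S\<^sup>2" using K(2)[OF S(2)] by linarith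
    moreover have "(c * slope S 0 f) * m = - (slope S 0 f * moment_form g \<psi>)" using c(1) by (auto simp: m_def)
    ultimately have "(c * slope S 0 f) * m \<le> K / S\<^sup>2" by simp
    then have "S * ((c * slope S 0 f) * m) \<le> S * (K / S\<^sup>2)" using S(2) by (intro mult_left_mono) auto
    then have "c * (S * slope S 0 f) * m \<le> K / S" using S(2) by (simp add: power2_eq_square mult_ac)
    moreover have "\<delta> * m \<le> c * (S * slope S 0 f) * m" using S(3) m by (intro mult_right_mono) auto
    ultimately have "\<delta> * m \<le> K / S" by simp
    then have "S \<le> K / (\<delta> * m)" using S(2) m \<delta>(1) by (simp add: field_simps)
    with S(1) show False by simp
  qed
  with c \<delta>(1) show thesis by (intro that[of c \<delta>]) auto
qed

text \<open>
  Elements of the Hardy space: their inverse Fourier transforms are powers of \<open>1 / (l - ix)\<close>.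
\<close>
definition hexp :: "complex \<Rightarrow> nat \<Rightarrow> real \<Rightarrow> complex" where
  "hexp l k \<xi> = indicator {0..} \<xi> *\<^sub>R (complex_of_real \<xi> ^ k * exp (- l * complex_of_real \<xi>))"

lemma hexp_integrable: "0 < Re l \<Longrightarrow> integrable lborel (hexp l k)"
  unfolding hexp_def[abs_def] by (rule half_line_power_exp_integrable)

lemma hexp_sqint:
  assumes "0 < Re l" shows "hexp l k \<in> sqint"
proof -
  have cm: "cmod (hexp l k \<xi>) = indicator {0..} \<xi> * (\<xi> ^ k * exp (- Re l * \<xi>))" for l k \<xi>
    by (auto simp: hexp_def indicator_def norm_mult norm_power)
  have sq: "(\<xi> ^ k * exp (- Re l * \<xi>))\<^sup>2 = \<xi> ^ (2 * k) * exp (- (2 * Re l) * \<xi>)" for \<xi>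
  proof -
    have "(exp (- Re l * \<xi>))\<^sup>2 = exp (- (2 * Re l) * \<xi>)"
      unfolding power2_eq_square exp_add[symmetric] by (simp add: algebra_simps)
    moreover have "(\<xi> ^ k)\<^sup>2 = \<xi> ^ (2 * k)" by (simp add: power_even_eq)
    ultimately show ?thesis by (simp add: power_mult_distrib)
  qed
  have "(cmod (hexp l k \<xi>))\<^sup>2 = cmod (hexp (2 * complex_of_real (Re l)) (2 * k) \<xi>)" for \<xi>
    unfolding cm using sq[of \<xi>] by (auto simp: indicator_def)
  moreover have "integrable lborel (\<lambda>\<xi>. cmod (hexp (2 * complex_of_real (Re l)) (2 * k) \<xi>))"
    using assms by (intro integrable_norm hexp_integrable) simp
  moreover have "hexp l k \<in> borel_measurable borel" unfolding hexp_def[abs_def] by measurable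
  ultimately show ?thesis by (simp add: sqint_def)
qed

lemma cnj_hexp: "cnj (hexp l k \<xi>) = hexp (cnj l) k \<xi>"
  by (simp add: hexp_def exp_cnj)

lemma invFT_hexp:
  assumes l: "0 < Re l"
  shows "AE x in lborel. invFT (hexp l 0) x = complex_of_real (1 / sqrt (2 * pi)) / (l - \<i> * complex_of_real x)"
    and "AE x in lborel. invFT (hexp l 1) x = complex_of_real (1 / sqrt (2 * pi)) / (l - \<i> * complex_of_real x)\<^sup>2"
proof -
  have l': "0 < Re (cnj l)" using l by simp
  have re: "0 < Re (cnj l + \<i> * complex_of_real x)" for x using l by simp
  have e: "exp (- (\<i> * complex_of_real x * complex_of_real \<xi>)) * hexp (cnj l) k \<xi> = hexp (cnj l + \<i> * complex_of_real x) k \<xi>" for x \<xi> k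
    by (auto simp: hexp_def indicator_def mult_exp_exp algebra_simps)
  have ft0: "ft1 (hexp (cnj l) 0) x = complex_of_real (1 / sqrt (2 * pi)) * (1 / (cnj l + \<i> * complex_of_real x))" for x
    unfolding ft1_def e using half_line_exp_integral(1)[OF re[of x]] by (simp add: hexp_def)
  have ft1: "ft1 (hexp (cnj l) 1) x = complex_of_real (1 / sqrt (2 * pi)) * (1 / (cnj l + \<i> * complex_of_real x)\<^sup>2)" for x
    unfolding ft1_def e using half_line_exp_integral(2)[OF re[of x]] by (simp add: hexp_def)
  have inv: "invFT (hexp l k) x = cnj (FT (hexp (cnj l) k) x)" for k x
    unfolding invFT_def cnj_hexp by (rule refl)
  show "AE x in lborel. invFT (hexp l 0) x = complex_of_real (1 / sqrt (2 * pi)) / (l - \<i> * complex_of_real x)"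
    using FT_eq_ft1[OF hexp_integrable[OF l'] hexp_sqint[OF l'], of 0]
    by eventually_elim (simp add: inv ft0)
  show "AE x in lborel. invFT (hexp l 1) x = complex_of_real (1 / sqrt (2 * pi)) / (l - \<i> * complex_of_real x)\<^sup>2"
    using FT_eq_ft1[OF hexp_integrable[OF l'] hexp_sqint[OF l'], of 1]
    by eventually_elim (simp add: inv ft1 del: One_nat_def)
qed

text \<open>
  With \<open>\<psi>(x)\<close> proportional to \<open>1 / (l - ix)\<close>, \<open>l = T + ia\<close>, the product of \<open>cnj (P \<psi>)\<close> and \<open>\<psi>\<close> is a multiple of
  \<open>1 / (cnj (l - ix)\<^sup>2 (l - ix))\<close>, whose imaginary part is a multiple of \<open>dpoisson T (x - a)\<close>.
\<close>
lemma moment_form_hexp: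
  assumes g: "bdd_borel g" and T: "0 < T"
  shows "dom_P2 (invFT (hexp (Complex T a) 0))"
    and "moment_form g (invFT (hexp (Complex T a) 0)) = slope T a g / (2 * T)"
proof -
  define l where "l = Complex T a"
  have l: "0 < Re l" using T by (simp add: l_def)
  define \<phi> where "\<phi> = hexp l 0"
  have \<phi>: "\<phi> \<in> sqint" unfolding \<phi>_def by (rule hexp_sqint[OF l])
  have h1: "(\<lambda>\<xi>. complex_of_real \<xi> * \<phi> \<xi>) = hexp l 1"
    and h2: "(\<lambda>\<xi>. complex_of_real (\<xi>\<^sup>2) * \<phi> \<xi>) = hexp l 2"
    by (auto simp: \<phi>_def hexp_def indicator_def)
  show n: "dom_P2 (invFT (hexp (Complex T a) 0))"
    unfolding l_def[symmetric] \<phi>_def[symmetric]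
    by (rule dom_P2_invFT[OF \<phi>]) (simp_all only: h1 h2 hexp_sqint[OF l])
  define \<psi> where "\<psi> = invFT \<phi>"
  have \<psi>: "\<psi> \<in> sqint" unfolding \<psi>_def by (rule invFT_sqint[OF \<phi>])
  have gs: "(\<lambda>x. complex_of_real (g x) * \<psi> x) \<in> sqint" by (rule bdd_borel_mult_sqint[OF g \<psi>])
  have g1: "hexp l 1 \<in> sqint" by (rule hexp_sqint[OF l])
  have [measurable]: "g \<in> borel_measurable borel" using g by (simp add: bdd_borel_def)
  define H where "H = FT (\<lambda>x. complex_of_real (g x) * \<psi> x)"
  have H: "H \<in> sqint" unfolding H_def by (rule FT_sqint[OF gs])
  define u where "u x = complex_of_real (1 / sqrt (2 * pi)) / (l - \<i> * complex_of_real x)" for x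
  define v where "v x = complex_of_real (1 / sqrt (2 * pi)) / (l - \<i> * complex_of_real x)\<^sup>2" for x
  have [measurable]: "u \<in> borel_measurable borel" "v \<in> borel_measurable borel"
    unfolding u_def[abs_def] v_def[abs_def] by measurable
  have us: "u \<in> sqint" by (rule sqint_cong_AE[OF \<psi>]) (use invFT_hexp(1)[OF l] in \<open>auto simp: \<psi>_def \<phi>_def u_def elim: AE_mp\<close>)
  have vs: "v \<in> sqint" by (rule sqint_cong_AE[OF invFT_sqint[OF g1]]) (use invFT_hexp(2)[OF l] in \<open>auto simp: v_def elim: AE_mp\<close>)
  have "ip (\<lambda>\<xi>. complex_of_real \<xi> * FT \<psi> \<xi>) H = ip (hexp l 1) H"
  proof (rule ip_cong_AE)
    show "AE x in lborel. complex_of_real x * FT \<psi> x = hexp l 1 x"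
      using FT_invFT[OF \<phi>] unfolding h1[symmetric] by eventually_elim (simp add: \<psi>_def)
    show "(\<lambda>\<xi>. complex_of_real \<xi> * FT \<psi> \<xi>) \<in> borel_measurable borel"
      using FT_measurable[OF \<psi>] by measurable
  qed (rule AE_I2[OF refl] sqint_measurable[OF H] sqint_measurable[OF g1])+
  also have "\<dots> = cnj (ip (\<lambda>x. complex_of_real (g x) * \<psi> x) (invFT (hexp l 1)))"
    unfolding H_def FT_adjoint[OF g1 gs, symmetric] by (rule ip_commute)
  also have "\<dots> = ip (invFT (hexp l 1)) (\<lambda>x. complex_of_real (g x) * \<psi> x)"
    by (rule ip_commute[symmetric])
  also have "\<dots> = ip v (\<lambda>x. complex_of_real (g x) * u x)"
  proof (rule ip_cong_AE)
    show "AE x in lborel. invFT (hexp l 1) x = v x" using invFT_hexp(2)[OF l] by (simp add: v_def)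
    show "AE x in lborel. complex_of_real (g x) * \<psi> x = complex_of_real (g x) * u x"
      using invFT_hexp(1)[OF l] by eventually_elim (simp add: u_def \<psi>_def \<phi>_def)
  qed ((rule sqint_measurable[OF invFT_sqint[OF g1]] sqint_measurable[OF gs])+, measurable)
  finally have e: "ip (\<lambda>\<xi>. complex_of_real \<xi> * FT \<psi> \<xi>) H = ip v (\<lambda>x. complex_of_real (g x) * u x)" .
  have "moment_form g \<psi> = - 2 * Im (ip v (\<lambda>x. complex_of_real (g x) * u x))"
    unfolding moment_form_def H_def[symmetric] e by simp
  also have "\<dots> = (LINT x|lborel. - 2 * Im (cnj (v x) * (complex_of_real (g x) * u x)))"
    unfolding ip_def integral_Im[OF integrable_ip[OF vs bdd_borel_mult_sqint[OF g us]], symmetric]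
    by (rule Bochner_Integration.integral_mult_right_zero[symmetric])
  also have "\<dots> = (LINT x|lborel. g x * dpoisson T (x - a) / (2 * T))"
  proof (intro Bochner_Integration.integral_cong refl)
    fix x
    define y where "y = x - a"
    define z where "z = Complex T (- y)"
    have z: "l - \<i> * complex_of_real x = z" by (simp add: z_def l_def y_def complex_eq_iff)
    have z0: "z \<noteq> 0" using T by (simp add: z_def complex_eq_iff)
    have c: "cnj (complex_of_real (1 / sqrt (2 * pi))) * complex_of_real (1 / sqrt (2 * pi)) = complex_of_real (1 / (2 * pi))"
      unfolding complex_cnj_complex_of_real of_real_mult[symmetric] by simp
    have zz: "z * cnj z = complex_of_real (T\<^sup>2 + y\<^sup>2)" by (simp add: z_def complex_eq_iff power2_eq_square)
    have "cnj (v x) * (complex_of_real (g x) * u x) = complex_of_real (g x) *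
        (cnj (complex_of_real (1 / sqrt (2 * pi))) * complex_of_real (1 / sqrt (2 * pi))) * (1 / ((cnj z)\<^sup>2 * z))"
      unfolding v_def u_def z by simp
    also have "1 / ((cnj z)\<^sup>2 * z) = z / (z * cnj z)\<^sup>2"
      using z0 by (simp add: power2_eq_square)
    also have "complex_of_real (g x) * (cnj (complex_of_real (1 / sqrt (2 * pi))) * complex_of_real (1 / sqrt (2 * pi))) * (z / (z * cnj z)\<^sup>2)
        = complex_of_real (g x * (1 / (2 * pi)) / (T\<^sup>2 + y\<^sup>2)\<^sup>2) * z"
      unfolding c zz by simp
    finally have "Im (cnj (v x) * (complex_of_real (g x) * u x)) = g x * (1 / (2 * pi)) / (T\<^sup>2 + y\<^sup>2)\<^sup>2 * (- y)"
      by (simp add: z_def)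
    then show "- 2 * Im (cnj (v x) * (complex_of_real (g x) * u x)) = g x * dpoisson T (x - a) / (2 * T)"
      using T by (simp add: dpoisson_def y_def[symmetric])
  qed
  also have "\<dots> = slope T a g / (2 * T)" by (simp add: slope_def)
  finally show "moment_form g (invFT (hexp (Complex T a) 0)) = slope T a g / (2 * T)"
    by (simp add: \<psi>_def \<phi>_def l_def)
qed

text \<open>
  Applied to \<open>(f, g)\<close> and to \<open>(g, f)\<close>, \<open>moment_form_sign\<close> gives one sign for the slopes of \<open>g\<close> and another for those of
  \<open>f\<close>. They agree: the second one is realised by slopes of \<open>g\<close> that are not zero.
\<close>
lemma slope_sign:
  assumes f: "bdd_borel f" and g: "bdd_borel g" and pos: "cpos f g" and nz: "\<not> czero f g"
  obtains c where "c = 1 \<or> c = (- 1 :: real)" "\<And>T a. 0 < T \<Longrightarrow> 0 \<le> c * slope T a f"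
    "\<And>T a. 0 < T \<Longrightarrow> 0 \<le> c * slope T a g"
proof -
  have pos': "cpos g f" by (rule cpos_swap[OF f g pos])
  have nz': "\<not> czero g f" using czero_swap[OF g f] nz by blast
  obtain c \<delta> where c: "c = 1 \<or> c = (- 1 :: real)" "0 < \<delta>" "\<And>S0. \<exists>S\<ge>S0. 0 < S \<and> \<delta> \<le> c * (S * slope S 0 f)"
    "\<And>\<psi>. dom_P2 \<psi> \<Longrightarrow> 0 \<le> c * moment_form g \<psi>"
    using moment_form_sign[OF f g pos nz] by blast
  obtain d \<epsilon> where d: "d = 1 \<or> d = (- 1 :: real)" "0 < \<epsilon>" "\<And>S0. \<exists>S\<ge>S0. 0 < S \<and> \<epsilon> \<le> d * (S * slope S 0 g)"
    "\<And>\<psi>. dom_P2 \<psi> \<Longrightarrow> 0 \<le> d * moment_form f \<psi>"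
    using moment_form_sign[OF g f pos' nz'] by blast
  have cg: "0 \<le> c * slope T a g" if "0 < T" for T a
    using c(4)[OF moment_form_hexp(1)[OF g that, of a]] that
    by (simp add: moment_form_hexp(2)[OF g that] zero_le_divide_iff)
  have df: "0 \<le> d * slope T a f" if "0 < T" for T a
    using d(4)[OF moment_form_hexp(1)[OF f that, of a]] that
    by (simp add: moment_form_hexp(2)[OF f that] zero_le_divide_iff)
  have "c = d"
  proof -
    obtain S where S: "0 < S" "\<epsilon> \<le> d * (S * slope S 0 g)" using d(3) by blast
    then have "0 < S * (d * slope S 0 g)" using d(2) by (simp add: mult_ac)
    then have "0 < d * slope S 0 g" using S(1) by (simp add: zero_less_mult_iff)
    then show ?thesis using cg[OF S(1), of 0] c(1) d(1) by auto
  qed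
  with c(1) df cg show thesis by (intro that[of c]) auto
qed

lemma conv_poisson_mono:
  assumes f: "bdd_borel f" and T: "0 < T" and s: "\<And>a. 0 \<le> slope T a f"
  shows "mono (conv f (poisson T))"
proof (rule monoI)
  fix x y :: real assume "x \<le> y"
  then show "conv f (poisson T) x \<le> conv f (poisson T) y"
    by (rule DERIV_nonneg_imp_nondecreasing) (use conv_poisson_deriv[OF f T] s in blast)
qed

section \<open>Compactness of the classes of Pick functions on strips\<close>

abbreviation strip :: "real \<Rightarrow> complex set" where
  "strip a \<equiv> {z. \<bar>Im z\<bar> < a}"

lemma strip_eq: "strip a = {z. Im z < a} \<inter> {z. Im z > - a}"
  by auto

lemma open_strip: "open (strip a)"
  unfolding strip_eq by (intro open_Int open_halfspace_Im_lt open_halfspace_Im_gt)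

lemma convex_strip: "convex (strip a)"
  unfolding strip_eq by (intro convex_Int convex_halfspace_Im_lt convex_halfspace_Im_gt)

lemma K_class_scale:
  assumes "f \<in> K_class \<alpha>" "0 < c" shows "(\<lambda>x. f (c * x)) \<in> K_class (\<alpha> / c)"
proof -
  obtain F where F: "F holomorphic_on strip \<alpha>" "\<And>x. F (complex_of_real x) = complex_of_real (f x)"
    "\<And>z. \<bar>Im z\<bar> < \<alpha> \<Longrightarrow> 0 \<le> Im (F z) * Im z" and b: "bounded (range f)"
    using assms(1) by (auto simp: K_class_def)
  define G where "G z = F (complex_of_real c * z)" for z
  have inS: "\<bar>Im (complex_of_real c * z)\<bar> < \<alpha>" if "\<bar>Im z\<bar> < \<alpha> / c" for z
    using that assms(2) by (simp add: abs_mult pos_less_divide_eq mult.commute)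
  have "G holomorphic_on strip (\<alpha> / c)"
    unfolding G_def
    by (rule holomorphic_on_compose_gen[OF _ F(1), unfolded o_def]) (use inS in \<open>auto intro!: holomorphic_intros\<close>)
  moreover have "G (complex_of_real x) = complex_of_real (f (c * x))" for x
    using F(2)[of "c * x"] by (simp add: G_def)
  moreover have "0 \<le> Im (G z) * Im z" if "\<bar>Im z\<bar> < \<alpha> / c" for z
  proof -
    have "0 \<le> c * (Im (G z) * Im z)"
      using F(3)[OF inS[OF that]] by (simp add: G_def mult_ac)
    then show ?thesis using assms(2) by (simp add: zero_le_mult_iff)
  qed
  moreover have "bounded (range (\<lambda>x. f (c * x)))"
    by (rule bounded_subset[OF b]) auto
  ultimately show ?thesis by (auto simp: K_class_def)
qed

lemma K_class_continuous:
  assumes "f \<in> K_class \<alpha>" "0 < \<alpha>" shows "continuous_on UNIV f"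
proof -
  obtain F where F: "F holomorphic_on strip \<alpha>" "\<And>x. F (complex_of_real x) = complex_of_real (f x)"
    using assms(1) by (auto simp: K_class_def)
  have "continuous_on UNIV (\<lambda>x. Re (F (complex_of_real x)))"
    by (intro continuous_on_Re continuous_on_compose2[OF holomorphic_on_imp_continuous_on[OF F(1)]] continuous_intros)
      (use assms(2) in auto)
  then show ?thesis by (simp add: F(2))
qed

text \<open>
  In the upper half of the strip a real value is a boundary value of the closed upper half plane, so the
  open mapping theorem makes \<open>F\<close> constant there, and by continuity the constant is attained on the real axis.
\<close>
lemma upper_real_value_bounded:
  assumes F: "F holomorphic_on strip a" "\<And>x. F (complex_of_real x) = complex_of_real (f x)"
    and pick: "\<And>z. z \<in> strip a \<Longrightarrow> 0 \<le> Im (F z) * Im z" and M: "\<And>x. \<bar>f x\<bar> \<le> M"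
    and z: "z \<in> strip a" "0 < Im z" "Im (F z) = 0"
  shows "cmod (F z) \<le> M"
proof -
  define U where "U = {w. Im w < a} \<inter> {w. 0 < Im w}"
  have U: "open U" "convex U" "U \<subseteq> strip a" "z \<in> U"
    using z unfolding U_def
    by (auto intro: open_halfspace_Im_lt open_halfspace_Im_gt convex_Int convex_halfspace_Im_lt convex_halfspace_Im_gt)
  have con: "F constant_on U"
  proof (rule ccontr)
    assume "\<not> F constant_on U"
    then have "open (F ` U)"
      using open_mapping_thm[OF holomorphic_on_subset[OF F(1) U(3)] U(1) convex_connected[OF U(2)] U(1) order_refl] by blast
    moreover have "F z \<in> F ` U" using U(4) by blast
    ultimately obtain e where e: "0 < e" "ball (F z) e \<subseteq> F ` U" by (meson open_contains_ball)
    have "F z - \<i> * complex_of_real (e / 2) \<in> ball (F z) e"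
      using e(1) by (simp add: dist_norm norm_mult)
    then obtain w where w: "w \<in> U" "F w = F z - \<i> * complex_of_real (e / 2)" using e(2) by (metis image_iff subsetD)
    have "0 \<le> Im (F w) * Im w" using pick[of w] w(1) U(3) by blast
    then have "0 \<le> Im (F w)" using w(1) by (auto simp: U_def zero_le_mult_iff)
    then show False using w(2) z(3) e(1) by simp
  qed
  then obtain c where c: "\<And>w. w \<in> U \<Longrightarrow> F w = c" by (auto simp: constant_on_def)
  define zn where "zn n = Complex (Re z) (Im z * (1 / real (Suc n)))" for n
  have znU: "zn n \<in> U" for n
  proof -
    have "Im z * (1 / real (Suc n)) \<le> Im z * 1" using z(2) by (intro mult_left_mono) auto
    then show ?thesis using z by (auto simp: zn_def U_def)
  qed
  have "zn \<longlonglongrightarrow> Complex (Re z) (Im z * 0)"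
    unfolding zn_def by (intro tendsto_Complex tendsto_intros inv_Suc_tendsto)
  then have zl: "zn \<longlonglongrightarrow> complex_of_real (Re z)" by (simp add: complex_of_real_def)
  have "(\<lambda>n. F (zn n)) \<longlonglongrightarrow> F (complex_of_real (Re z))"
    by (rule continuous_on_tendsto_compose[OF holomorphic_on_imp_continuous_on[OF F(1)] zl])
      (use znU U(3) z in \<open>auto intro!: always_eventually\<close>)
  then have "c = F (complex_of_real (Re z))" by (simp add: c[OF znU] LIMSEQ_const_iff)
  then show ?thesis using c[OF U(4)] M[of "Re z"] by (simp add: F(2))
qed

lemma real_value_bounded:
  assumes F: "F holomorphic_on strip a" "\<And>x. F (complex_of_real x) = complex_of_real (f x)"
    and pick: "\<And>z. z \<in> strip a \<Longrightarrow> 0 \<le> Im (F z) * Im z" and M: "\<And>x. \<bar>f x\<bar> \<le> M"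
    and z: "z \<in> strip a" "Im (F z) = 0"
  shows "cmod (F z) \<le> M"
proof -
  consider "Im z = 0" | "0 < Im z" | "Im z < 0" by linarith
  then show ?thesis
  proof cases
    case 1
    then have "z = complex_of_real (Re z)" by (simp add: complex_eq_iff)
    then show ?thesis using F(2)[of "Re z"] M[of "Re z"] by (metis norm_of_real)
  next
    case 2
    then show ?thesis using upper_real_value_bounded[OF F pick M z(1) _ z(2)] by blast
  next
    case 3
    \<comment> \<open>The point reflection \<open>- F (- z)\<close> has the same properties and swaps the half strips.\<close>
    define G where "G w = - F (- w)" for w
    have "G holomorphic_on strip a"
      unfolding G_def
      by (intro holomorphic_intros holomorphic_on_compose_gen[OF _ F(1), unfolded o_def]) auto
    moreover have "G (complex_of_real x) = complex_of_real (- f (- x))" for x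
      using F(2)[of "- x"] by (simp add: G_def)
    moreover have "0 \<le> Im (G w) * Im w" if "w \<in> strip a" for w
      using pick[of "- w"] that by (simp add: G_def)
    moreover have "\<bar>- f (- x)\<bar> \<le> M" for x using M by simp
    moreover have "- z \<in> strip a" "0 < Im (- z)" "Im (G (- z)) = 0" using z 3 by (auto simp: G_def)
    ultimately have "cmod (G (- z)) \<le> M" by (rule upper_real_value_bounded)
    then show ?thesis by (simp add: G_def)
  qed
qed

text \<open>
  The conformal map of the plane without the real numbers of modulus \<open>\<ge> M + 1\<close> onto the unit disc: a Moebius map
  onto the plane slit along the nonpositive reals, a square root onto the right half plane, and the Cayley map. Its inverse
  is the Koebe-type function \<open>G \<mapsto> 2 (M + 1) G / (1 + G\<^sup>2)\<close>.
\<close>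
definition slitmap :: "real \<Rightarrow> complex \<Rightarrow> complex" where
  "slitmap M w = (let H = csqrt ((complex_of_real (M + 1) + w) / (complex_of_real (M + 1) - w)) in (H - 1) / (H + 1))"

lemma slitmap_props:
  assumes M: "0 \<le> M" and w: "Im w = 0 \<longrightarrow> cmod w \<le> M"
  shows "complex_of_real (M + 1) - w \<noteq> 0"
    and "(complex_of_real (M + 1) + w) / (complex_of_real (M + 1) - w) \<notin> \<real>\<^sub>\<le>\<^sub>0"
    and "csqrt ((complex_of_real (M + 1) + w) / (complex_of_real (M + 1) - w)) + 1 \<noteq> 0"
    and "cmod (slitmap M w) < 1"
    and "w * (1 + (slitmap M w)\<^sup>2) = 2 * complex_of_real (M + 1) * slitmap M w"
proof -
  define m where "m = M + 1"
  define q where "q = (complex_of_real m + w) / (complex_of_real m - w)"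
  have m: "0 < m" using M by (simp add: m_def)
  have ne: "complex_of_real m - w \<noteq> 0"
  proof
    assume "complex_of_real m - w = 0"
    then have "w = complex_of_real m" by simp
    then show False using w m by (simp add: m_def)
  qed
  then show "complex_of_real (M + 1) - w \<noteq> 0" by (simp add: m_def)
  have q: "q \<notin> \<real>\<^sub>\<le>\<^sub>0"
  proof
    assume "q \<in> \<real>\<^sub>\<le>\<^sub>0"
    then obtain t where t: "q = complex_of_real t" "t \<le> 0" by (auto simp: nonpos_Reals_def)
    have e: "complex_of_real m + w = complex_of_real t * (complex_of_real m - w)"
      using ne t(1) by (simp add: q_def field_simps)
    have re: "m + Re w = t * (m - Re w)" and im: "Im w = - t * Im w"
      using arg_cong[OF e, of Re] arg_cong[OF e, of Im] by auto
    have t1: "t \<noteq> - 1" using re m by auto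
    have "Im w * (1 + t) = 0" using im by (simp add: algebra_simps)
    then have "Im w = 0" using t1 by auto
    then have "\<bar>Re w\<bar> \<le> M" using w by (simp add: cmod_eq_Re)
    moreover have "Re w * (1 + t) = m * (t - 1)" using re by (simp add: algebra_simps)
    then have "\<bar>Re w\<bar> * \<bar>1 + t\<bar> = m * \<bar>t - 1\<bar>" using m by (metis abs_mult abs_of_pos)
    moreover have "\<bar>1 + t\<bar> \<le> \<bar>t - 1\<bar>" "0 < \<bar>t - 1\<bar>" using t(2) by auto
    moreover have "\<bar>Re w\<bar> * \<bar>1 + t\<bar> \<le> M * \<bar>t - 1\<bar>"
      by (intro mult_mono) (use calculation M in auto)
    ultimately have "m * \<bar>t - 1\<bar> \<le> M * \<bar>t - 1\<bar>" by simp
    then show False using \<open>0 < \<bar>t - 1\<bar>\<close> by (simp add: m_def)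
  qed
  then show "(complex_of_real (M + 1) + w) / (complex_of_real (M + 1) - w) \<notin> \<real>\<^sub>\<le>\<^sub>0"
    by (simp add: q_def m_def)
  define H where "H = csqrt q"
  have HH: "H * H = q" unfolding H_def by (metis power2_csqrt power2_eq_square)
  have ReH: "0 < Re H"
  proof -
    have "Re H \<noteq> 0"
    proof
      assume "Re H = 0"
      then have "H = \<i> * complex_of_real (Im H)" by (simp add: complex_eq_iff)
      then have "q = complex_of_real (- (Im H * Im H))" using HH by (metis complex_i_mult_minus mult.assoc mult.commute of_real_minus of_real_mult)
      then show False using q by (simp add: complex_nonpos_Reals_iff)
    qed
    then show ?thesis using csqrt_principal[of q] by (auto simp: H_def)
  qed
  have H1: "H + 1 \<noteq> 0" using ReH by (auto simp: complex_eq_iff)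
  then show "csqrt ((complex_of_real (M + 1) + w) / (complex_of_real (M + 1) - w)) + 1 \<noteq> 0"
    by (simp add: H_def q_def m_def)
  define G where "G = (H - 1) / (H + 1)"
  have G: "slitmap M w = G" by (simp add: slitmap_def Let_def G_def H_def q_def m_def)
  have "cmod (H - 1) < cmod (H + 1)"
    using ReH by (simp add: cmod_def power2_eq_square algebra_simps)
  then show "cmod (slitmap M w) < 1" using H1 by (simp add: G G_def norm_divide)
  have qm: "q * (complex_of_real m - w) = complex_of_real m + w" using ne by (simp add: q_def)
  have GH: "G * (H + 1) = H - 1" using H1 by (simp add: G_def)
  have "w * ((H + 1) * (H + 1) + (H - 1) * (H - 1)) = 2 * complex_of_real m * ((H - 1) * (H + 1))"
    using qm unfolding HH[symmetric] by algebra
  then have "w * (1 + G\<^sup>2) * ((H + 1) * (H + 1)) = 2 * complex_of_real m * G * ((H + 1) * (H + 1))"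
    unfolding GH[symmetric] by (simp add: algebra_simps power2_eq_square)
  then show "w * (1 + (slitmap M w)\<^sup>2) = 2 * complex_of_real (M + 1) * slitmap M w"
    using H1 by (simp add: G m_def)
qed

lemma one_plus_sq_nonzero: "cmod z < 1 \<Longrightarrow> 1 + z\<^sup>2 \<noteq> 0"
proof
  assume z: "cmod z < 1" "1 + z\<^sup>2 = 0"
  then have "z\<^sup>2 = - 1" by (simp add: eq_neg_iff_add_eq_0 add.commute)
  then have "(cmod z)\<^sup>2 = 1" by (metis norm_minus_cancel norm_one norm_power)
  then show False using z(1) by (simp add: power2_eq_1_iff) (smt (verit) norm_ge_zero)
qed

text \<open>
  Convergence is stated along sequences of points, since rescaling of the strips will move the
  points at which the functions are evaluated.
\<close>
lemma K_class_normal: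
  assumes K: "\<And>n. fn n \<in> K_class 1" and M: "\<And>n x. \<bar>fn n x\<bar> \<le> M"
  obtains r k where "strict_mono (r :: nat \<Rightarrow> nat)" "k \<in> K_class 1"
    "\<And>y y0. y \<longlonglongrightarrow> y0 \<Longrightarrow> (\<lambda>n. fn (r n) (y n)) \<longlonglongrightarrow> k y0"
proof -
  let ?S = "strip 1"
  have M0: "0 \<le> M" using order_trans[OF abs_ge_zero M[of 0 0]] .
  have "\<exists>F. F holomorphic_on ?S \<and> (\<forall>x. F (complex_of_real x) = complex_of_real (fn n x)) \<and>
      (\<forall>z. \<bar>Im z\<bar> < 1 \<longrightarrow> 0 \<le> Im (F z) * Im z)" for n
    using K[of n] by (auto simp: K_class_def)
  then obtain Fn where F: "\<And>n. Fn n holomorphic_on ?S" "\<And>n x. Fn n (complex_of_real x) = complex_of_real (fn n x)"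
    "\<And>n z. z \<in> ?S \<Longrightarrow> 0 \<le> Im (Fn n z) * Im z" by (metis (lifting) mem_Collect_eq)
  have avoid: "Im (Fn n z) = 0 \<longrightarrow> cmod (Fn n z) \<le> M" if "z \<in> ?S" for n z
    using real_value_bounded[OF F(1,2,3) M that] by blast
  define Gn where "Gn n z = slitmap M (Fn n z)" for n z
  note sp = slitmap_props[OF M0 avoid]
  have Ghol: "Gn n holomorphic_on ?S" for n
    unfolding Gn_def slitmap_def Let_def
    by (intro holomorphic_intros holomorphic_on_csqrt' F(1)) (use sp in auto)
  have Glt: "cmod (Gn n z) < 1" if "z \<in> ?S" for n z unfolding Gn_def by (rule sp(4)[OF that])
  define HH where "HH = {h. h holomorphic_on ?S \<and> (\<forall>z\<in>?S. cmod (h z) \<le> 1)}"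
  obtain g r where g: "g holomorphic_on ?S" "strict_mono (r :: nat \<Rightarrow> nat)"
      "\<And>z. z \<in> ?S \<Longrightarrow> (\<lambda>n. Gn (r n) z) \<longlonglongrightarrow> g z"
      "\<And>C. compact C \<Longrightarrow> C \<subseteq> ?S \<Longrightarrow> uniform_limit C (Gn \<circ> r) g sequentially"
  proof (rule Montel[OF open_strip[of 1], of HH Gn])
    show "h holomorphic_on ?S" if "h \<in> HH" for h using that by (simp add: HH_def)
    show "\<exists>B. \<forall>h\<in>HH. \<forall>z\<in>C. cmod (h z) \<le> B" if "C \<subseteq> ?S" for C
      using that by (intro exI[of _ 1]) (auto simp: HH_def)
    show "range Gn \<subseteq> HH" using Ghol Glt by (auto simp: HH_def intro: less_imp_le)
  qed blast
  have gle: "cmod (g z) \<le> 1" if "z \<in> ?S" for z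
    by (rule LIMSEQ_le_const2[OF tendsto_norm[OF g(3)[OF that]]]) (use Glt[OF that] in \<open>auto intro: less_imp_le\<close>)
  have rel: "Fn n z * (1 + (Gn n z)\<^sup>2) = 2 * complex_of_real (M + 1) * Gn n z" if "z \<in> ?S" for n z
    unfolding Gn_def by (rule sp(5)[OF that])
  \<comment> \<open>At real points the values of the functions stay bounded, which rules out the exceptional points of the limit.\<close>
  have nz0: "1 + (g 0)\<^sup>2 \<noteq> 0"
  proof
    assume z: "1 + (g 0)\<^sup>2 = 0"
    have lim: "(\<lambda>n. 2 * complex_of_real (M + 1) * Gn (r n) 0) \<longlonglongrightarrow> 2 * complex_of_real (M + 1) * g 0"
      by (intro tendsto_intros g(3)) auto
    have "(\<lambda>n. 1 + (Gn (r n) 0)\<^sup>2) \<longlonglongrightarrow> 0" using tendsto_add[OF tendsto_const tendsto_power[OF g(3)[of 0], of 2], of 1] z by simp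
    from tendsto_mult[OF tendsto_const tendsto_norm_zero[OF this], of M]
    have lim0: "(\<lambda>n. M * cmod (1 + (Gn (r n) 0)\<^sup>2)) \<longlonglongrightarrow> 0" by simp
    have "cmod (Fn (r n) 0 * (1 + (Gn (r n) 0)\<^sup>2)) \<le> M * cmod (1 + (Gn (r n) 0)\<^sup>2)" for n
      using F(2)[of "r n" 0] M[of "r n" 0] by (simp add: norm_mult mult_right_mono)
    then have "(\<lambda>n. Fn (r n) 0 * (1 + (Gn (r n) 0)\<^sup>2)) \<longlonglongrightarrow> 0"
      by (intro Lim_null_comparison[OF always_eventually lim0]) blast
    then have "2 * complex_of_real (M + 1) * g 0 = 0" using LIMSEQ_unique[OF lim] rel[of 0] by simp
    then have "g 0 = 0" using M0 by (auto simp flip: of_real_add)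
    then show False using z by simp
  qed
  have nz: "1 + (g z)\<^sup>2 \<noteq> 0" if "z \<in> ?S" for z
  proof
    assume z: "1 + (g z)\<^sup>2 = 0"
    then have "\<not> cmod (g z) < 1" using one_plus_sq_nonzero by blast
    then have "cmod (g z) = 1" using gle[OF that] by simp
    then have "g constant_on ?S"
      using maximum_modulus_principle[OF g(1) open_strip convex_connected[OF convex_strip] open_strip order_refl that] gle by simp
    then have "g z = g 0" using that by (auto simp: constant_on_def)
    then show False using z nz0 by simp
  qed
  define Fi where "Fi z = 2 * complex_of_real (M + 1) * g z / (1 + (g z)\<^sup>2)" for z
  have Fihol: "Fi holomorphic_on ?S"
    unfolding Fi_def by (intro holomorphic_intros g(1)) (use nz in auto)
  have Fn_eq: "Fn n z = 2 * complex_of_real (M + 1) * Gn n z / (1 + (Gn n z)\<^sup>2)" if "z \<in> ?S" for n z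
    using rel[OF that] one_plus_sq_nonzero[OF Glt[OF that]] by (simp add: eq_divide_eq)
  have Flim: "(\<lambda>n. Fn (r n) (zs n)) \<longlonglongrightarrow> Fi z"
    if "(\<lambda>n. Gn (r n) (zs n)) \<longlonglongrightarrow> g z" "\<And>n. zs n \<in> ?S" "z \<in> ?S" for zs z
    unfolding Fi_def Fn_eq[OF that(2)] by (intro tendsto_intros that(1) nz that(3))
  define k where "k x = Re (Fi (complex_of_real x))" for x
  have pt: "(\<lambda>n. Fn (r n) z) \<longlonglongrightarrow> Fi z" if "z \<in> ?S" for z
    by (rule Flim[OF g(3)[OF that]]) (use that in auto)
  have kF: "Fi (complex_of_real x) = complex_of_real (k x)" and kb: "\<bar>k x\<bar> \<le> M" for x
  proof -
    have l: "(\<lambda>n. complex_of_real (fn (r n) x)) \<longlonglongrightarrow> Fi (complex_of_real x)" using pt[of "complex_of_real x"] by (simp add: F(2))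
    from tendsto_Im[OF l] have "Im (Fi (complex_of_real x)) = 0" by (simp add: LIMSEQ_const_iff)
    then show "Fi (complex_of_real x) = complex_of_real (k x)" by (simp add: k_def complex_eq_iff)
    have "(\<lambda>n. \<bar>fn (r n) x\<bar>) \<longlonglongrightarrow> \<bar>k x\<bar>" using tendsto_rabs[OF tendsto_Re[OF l]] by (simp add: k_def)
    then show "\<bar>k x\<bar> \<le> M" by (rule LIMSEQ_le_const2) (use M in auto)
  qed
  have "0 \<le> Im (Fi z) * Im z" if "z \<in> ?S" for z
    by (rule LIMSEQ_le_const[OF tendsto_mult[OF tendsto_Im[OF pt[OF that]] tendsto_const]]) (use F(3)[OF that] in auto)
  then have kK: "k \<in> K_class 1"
    using Fihol kF kb by (auto simp: K_class_def bounded_iff)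
  have seq: "(\<lambda>n. fn (r n) (y n)) \<longlonglongrightarrow> k y0" if y: "y \<longlonglongrightarrow> y0" for y y0
  proof -
    define C where "C = complex_of_real ` {y0 - 1..y0 + 1}"
    have C: "compact C" "C \<subseteq> ?S" unfolding C_def by (auto intro!: compact_continuous_image continuous_intros)
    have evC: "eventually (\<lambda>n. complex_of_real (y n) \<in> C) sequentially"
      using tendstoD[OF y, of 1] by (auto simp: C_def dist_real_def abs_less_iff elim!: eventually_mono intro!: imageI)
    have gc: "(\<lambda>n. g (complex_of_real (y n))) \<longlonglongrightarrow> g (complex_of_real y0)"
      by (rule continuous_on_tendsto_compose[OF holomorphic_on_imp_continuous_on[OF g(1)]])
        (use y in \<open>auto intro!: tendsto_intros\<close>)
    have "(\<lambda>n. Gn (r n) (complex_of_real (y n)) - g (complex_of_real (y n))) \<longlonglongrightarrow> 0"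
    proof (rule tendstoI)
      fix e :: real assume "0 < e"
      from uniform_limitD[OF g(4)[OF C] this] evC
      show "\<forall>\<^sub>F n in sequentially. dist (Gn (r n) (complex_of_real (y n)) - g (complex_of_real (y n))) 0 < e"
        by eventually_elim (simp add: dist_norm)
    qed
    from tendsto_add[OF this gc] have "(\<lambda>n. Gn (r n) (complex_of_real (y n))) \<longlonglongrightarrow> g (complex_of_real y0)" by simp
    then have "(\<lambda>n. Fn (r n) (complex_of_real (y n))) \<longlonglongrightarrow> Fi (complex_of_real y0)"
      by (rule Flim) auto
    from tendsto_Re[OF this] show ?thesis by (simp add: F(2) kF)
  qed
  show thesis by (rule that[OF g(2) kK seq])
qed

text \<open>
  The limit \<open>\<theta> = 0\<close>, where the strips become arbitrarily wide, is included; the limit function is then constant.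
\<close>
lemma K_class_limit:
  assumes K: "\<And>n. fn n \<in> K_class (\<alpha> n)" and \<alpha>: "\<And>n. 0 < \<alpha> n" and M: "\<And>n x. \<bar>fn n x\<bar> \<le> M"
    and \<theta>: "(\<lambda>n. 1 / \<alpha> n) \<longlonglongrightarrow> \<theta>"
  obtains r k where "strict_mono (r :: nat \<Rightarrow> nat)" "k \<in> K_class 1" "\<And>x. (\<lambda>n. fn (r n) x) \<longlonglongrightarrow> k (\<theta> * x)"
proof -
  have K1: "(\<lambda>x. fn n (\<alpha> n * x)) \<in> K_class 1" for n
    using K_class_scale[OF K[of n] \<alpha>[of n]] \<alpha>[of n] by simp
  obtain r k where rk: "strict_mono (r :: nat \<Rightarrow> nat)" "k \<in> K_class 1"
    "\<And>y y0. y \<longlonglongrightarrow> y0 \<Longrightarrow> (\<lambda>n. fn (r n) (\<alpha> (r n) * y n)) \<longlonglongrightarrow> k y0"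
    using K_class_normal[of "\<lambda>n x. fn n (\<alpha> n * x)" M, OF K1 M] by metis
  have "(\<lambda>n. fn (r n) x) \<longlonglongrightarrow> k (\<theta> * x)" for x
  proof -
    have "(\<lambda>n. 1 / \<alpha> (r n) * x) \<longlonglongrightarrow> \<theta> * x"
      using LIMSEQ_subseq_LIMSEQ[OF \<theta> rk(1)] by (intro tendsto_intros) (simp add: o_def)
    from rk(3)[OF this] show ?thesis using \<alpha> by (simp add: less_imp_neq[symmetric])
  qed
  with rk(1,2) show thesis by (rule that)
qed

text \<open>
  Cauchy's inequality bounds the difference quotients by a multiple of the majorant, so dominated
  convergence applies to them.
\<close>
lemma holomorphic_parametric_integral:
  fixes H :: "complex \<Rightarrow> real \<Rightarrow> complex"
  assumes S: "open S" and hol: "\<And>s. (\<lambda>z. H z s) holomorphic_on S"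
    and meas: "\<And>z. H z \<in> borel_measurable borel"
    and dom: "\<And>z0. z0 \<in> S \<Longrightarrow> \<exists>r>0. \<exists>w. cball z0 r \<subseteq> S \<and> integrable lborel w \<and> (\<forall>z\<in>cball z0 r. \<forall>s. cmod (H z s) \<le> w s)"
  shows "(\<lambda>z. LINT s|lborel. H z s) holomorphic_on S"
  unfolding holomorphic_on_open[OF S]
proof
  fix z0 assume z0: "z0 \<in> S"
  obtain r w where r: "0 < r" "cball z0 r \<subseteq> S" and w: "integrable lborel w"
    "\<And>z s. z \<in> cball z0 r \<Longrightarrow> cmod (H z s) \<le> w s" using dom[OF z0] by blast
  have int: "integrable lborel (H z)" if "z \<in> cball z0 r" for z
    by (rule Bochner_Integration.integrable_bound[OF w(1)])
      (use meas w(2)[OF that] in \<open>auto intro!: AE_I2 order_trans[OF _ abs_ge_self]\<close>)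
  define D where "D s = deriv (\<lambda>z. H z s) z0" for s
  have der: "((\<lambda>z. H z s) has_field_derivative deriv (\<lambda>z. H z s) \<zeta>) (at \<zeta>)" if "\<zeta> \<in> S" for \<zeta> s
    by (rule holomorphic_derivI[OF hol S that])
  have dbound: "cmod (deriv (\<lambda>z. H z s) \<zeta>) \<le> w s / (r / 2)" if \<zeta>: "\<zeta> \<in> cball z0 (r / 2)" for \<zeta> s
  proof -
    have sub: "cball \<zeta> (r / 2) \<subseteq> cball z0 r"
    proof
      fix u assume "u \<in> cball \<zeta> (r / 2)"
      then show "u \<in> cball z0 r" using \<zeta> dist_triangle[of z0 u \<zeta>] by simp
    qed
    have "cmod ((deriv ^^ 1) (\<lambda>z. H z s) \<zeta>) \<le> fact 1 * w s / (r / 2) ^ 1"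
    proof (rule Cauchy_inequality)
      show "(\<lambda>z. H z s) holomorphic_on ball \<zeta> (r / 2)"
        using sub r(2) ball_subset_cball by (intro holomorphic_on_subset[OF hol]) blast
      show "continuous_on (cball \<zeta> (r / 2)) (\<lambda>z. H z s)"
        using sub r(2) by (intro holomorphic_on_imp_continuous_on holomorphic_on_subset[OF hol]) blast
      show "cmod (H x s) \<le> w s" if "cmod (\<zeta> - x) = r / 2" for x
        using sub that by (intro w(2)) (auto simp: dist_norm)
    qed (use r in auto)
    then show ?thesis by simp
  qed
  have "((\<lambda>z. LINT s|lborel. H z s) has_field_derivative (LINT s|lborel. D s)) (at z0)"
    unfolding has_field_derivative_iff tendsto_at_iff_sequentially
  proof (intro allI impI)
    fix X :: "nat \<Rightarrow> complex" assume X: "\<forall>i. X i \<in> UNIV - {z0}" "X \<longlonglongrightarrow> z0"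
    obtain N where N: "\<And>n. n \<ge> N \<Longrightarrow> X n \<in> cball z0 (r / 2)"
      using tendstoD[OF X(2), of "r / 2"] r(1) by (auto simp: eventually_sequentially dist_commute intro: less_imp_le)
    define Y where "Y n = X (n + N)" for n
    have Y: "\<And>n. Y n \<noteq> z0" "\<And>n. Y n \<in> cball z0 (r / 2)" "Y \<longlonglongrightarrow> z0"
      using X(1) N LIMSEQ_ignore_initial_segment[OF X(2), of N] by (auto simp: Y_def[abs_def])
    have Yr: "Y n \<in> cball z0 r" for n using Y(2)[of n] r(1) by auto
    have "(\<lambda>n. LINT s|lborel. (H (Y n) s - H z0 s) / (Y n - z0)) \<longlonglongrightarrow> (LINT s|lborel. D s)"
    proof (rule integral_dominated_convergence[where w = "\<lambda>s. w s / (r / 2)"])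
      show lim: "AE s in lborel. (\<lambda>n. (H (Y n) s - H z0 s) / (Y n - z0)) \<longlonglongrightarrow> D s"
      proof (rule AE_I2)
        fix s
        show "(\<lambda>n. (H (Y n) s - H z0 s) / (Y n - z0)) \<longlonglongrightarrow> D s"
          using der[OF z0, of s, unfolded has_field_derivative_iff tendsto_at_iff_sequentially] Y
          by (simp add: D_def o_def)
      qed
      have m: "(\<lambda>s. (H (Y n) s - H z0 s) / (Y n - z0)) \<in> borel_measurable borel" for n
        using meas by measurable
      then show "(\<lambda>s. (H (Y n) s - H z0 s) / (Y n - z0)) \<in> borel_measurable lborel" for n by simp
      show "D \<in> borel_measurable lborel"
        by (rule borel_measurable_LIMSEQ_metric[where f = "\<lambda>n s. (H (Y n) s - H z0 s) / (Y n - z0)"])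
          (use m in simp, use der[OF z0, unfolded has_field_derivative_iff tendsto_at_iff_sequentially] Y in \<open>simp add: D_def o_def\<close>)
      show "integrable lborel (\<lambda>s. w s / (r / 2))" using w(1) by simp
      show "AE s in lborel. cmod ((H (Y n) s - H z0 s) / (Y n - z0)) \<le> w s / (r / 2)" for n
      proof (rule AE_I2)
        fix s
        have "cmod (H (Y n) s - H z0 s) \<le> w s / (r / 2) * cmod (Y n - z0)"
        proof (rule field_differentiable_bound[of "cball z0 (r / 2)"])
          show "((\<lambda>z. H z s) has_field_derivative deriv (\<lambda>z. H z s) z) (at z within cball z0 (r / 2))"
            if z: "z \<in> cball z0 (r / 2)" for z
          proof (rule has_field_derivative_at_within[OF der])
            have "z \<in> cball z0 r" using z r(1) by simp
            then show "z \<in> S" using r(2) by blast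
          qed
          show "cmod (deriv (\<lambda>z. H z s) z) \<le> w s / (r / 2)" if "z \<in> cball z0 (r / 2)" for z
            by (rule dbound[OF that])
          show "Y n \<in> cball z0 (r / 2)" by (rule Y(2))
          show "z0 \<in> cball z0 (r / 2)" using r(1) by simp
        qed (rule convex_cball)
        then show "cmod ((H (Y n) s - H z0 s) / (Y n - z0)) \<le> w s / (r / 2)"
          using Y(1)[of n] by (simp add: norm_divide pos_divide_le_eq)
      qed
    qed
    moreover have "(LINT s|lborel. (H (Y n) s - H z0 s) / (Y n - z0)) =
        ((LINT s|lborel. H (Y n) s) - (LINT s|lborel. H z0 s)) / (Y n - z0)" for n
      using int[OF Yr[of n]] int[of z0] r(1) by simp
    ultimately have "(\<lambda>n. ((LINT s|lborel. H (Y n) s) - (LINT s|lborel. H z0 s)) / (Y n - z0)) \<longlonglongrightarrow> (LINT s|lborel. D s)"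
      by (simp only:)
    then have "(\<lambda>n. ((LINT s|lborel. H (X (n + N)) s) - (LINT s|lborel. H z0 s)) / (X (n + N) - z0)) \<longlonglongrightarrow> (LINT s|lborel. D s)"
      by (simp add: Y_def)
    then show "((\<lambda>y. ((LINT s|lborel. H y s) - (LINT s|lborel. H z0 s)) / (y - z0)) \<circ> X) \<longlonglongrightarrow> (LINT s|lborel. D s)"
      unfolding o_def by (rule LIMSEQ_offset)
  qed
  then show "\<exists>f'. ((\<lambda>z. LINT s|lborel. H z s) has_field_derivative f') (at z0)" by blast
qed

section \<open>Mollified increasing functions\<close>

lemma conv_commute:
  assumes f: "bdd_borel f" and A: "pos_kernel A" and B: "pos_kernel B"
  shows "conv (conv f A) B = conv (conv f B) A"
proof
  fix x
  obtain M where M: "\<And>x. \<bar>f x\<bar> \<le> M" "0 \<le> M" using bdd_borelE[OF f] by blast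
  have [measurable]: "f \<in> borel_measurable borel" "A \<in> borel_measurable borel" "B \<in> borel_measurable borel"
    using f A B by (auto simp: bdd_borel_def pos_kernel_def)
  have "(LINT s|lborel. LINT t|lborel. f (x - s - t) * A t * B s) = (LINT t|lborel. LINT s|lborel. f (x - s - t) * A t * B s)"
  proof (rule fubini_dom(1)[where A = "\<lambda>s. M * B s" and D = "\<lambda>_. A"])
    show "(\<lambda>(s, t). f (x - s - t) * A t * B s) \<in> borel_measurable (lborel \<Otimes>\<^sub>M lborel)" by measurable
    show "norm (f (x - s - t) * A t * B s) \<le> M * B s * A t" for s t
    proof -
      have "\<bar>f (x - s - t)\<bar> * (A t * B s) \<le> M * (A t * B s)"
        using M pos_kernelD(4)[OF A] pos_kernelD(4)[OF B] by (intro mult_right_mono) auto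
      then show ?thesis using pos_kernelD(4)[OF A] pos_kernelD(4)[OF B] by (simp add: abs_mult mult_ac)
    qed
  qed (use pos_kernelD(2)[OF A] pos_kernelD(2)[OF B] in auto)
  moreover have "x - s - t = x - t - s" for s t by simp
  ultimately show "conv (conv f A) B x = conv (conv f B) A x"
    unfolding conv_def by (simp add: mult_ac flip: Bochner_Integration.integral_mult_right_zero)
qed

lemma conv_mono:
  assumes f: "bdd_borel f" and w: "pos_kernel w" and "mono f" shows "mono (conv f w)"
proof (rule monoI)
  fix x y :: real assume "x \<le> y"
  then show "conv f w x \<le> conv f w y"
    unfolding conv_def using pos_kernelD(4)[OF w] monoD[OF assms(3)]
    by (intro integral_mono conv_integrable f w mult_right_mono) auto
qed

definition cpoisson :: "real \<Rightarrow> complex \<Rightarrow> complex" where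
  "cpoisson e z = complex_of_real e / (complex_of_real pi * (complex_of_real e ^ 2 + z\<^sup>2))"

lemma cpoisson_of_real: "cpoisson e (complex_of_real x) = complex_of_real (poisson e x)"
  by (simp add: cpoisson_def poisson_def)

text \<open>
  The factors \<open>z + ie\<close> and \<open>z - ie\<close> both have an imaginary part of modulus at least \<open>d\<close>.
\<close>
lemma cpoisson_denominator:
  assumes "0 < d" "\<bar>Im z\<bar> \<le> e - d"
  shows "(Re z)\<^sup>2 + d\<^sup>2 \<le> cmod (complex_of_real e ^ 2 + z\<^sup>2)"
proof -
  have fac: "complex_of_real e ^ 2 + z\<^sup>2 = (z + \<i> * complex_of_real e) * (z - \<i> * complex_of_real e)"
    by (simp add: power2_eq_square algebra_simps)
  have "d\<^sup>2 \<le> (Im z + e)\<^sup>2" "d\<^sup>2 \<le> (Im z - e)\<^sup>2"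
    using assms by (auto intro: power_mono simp: power2_commute[of "Im z" e])
  then have "sqrt ((Re z)\<^sup>2 + d\<^sup>2) \<le> cmod (z + \<i> * complex_of_real e)"
    "sqrt ((Re z)\<^sup>2 + d\<^sup>2) \<le> cmod (z - \<i> * complex_of_real e)"
    by (simp_all add: cmod_def)
  then have "sqrt ((Re z)\<^sup>2 + d\<^sup>2) * sqrt ((Re z)\<^sup>2 + d\<^sup>2) \<le> cmod (z + \<i> * complex_of_real e) * cmod (z - \<i> * complex_of_real e)"
    by (intro mult_mono) auto
  then show ?thesis unfolding fac norm_mult by simp
qed

lemma cpoisson_bound:
  assumes "0 < e" "0 < d" "\<bar>Im z\<bar> \<le> e - d"
  shows "cmod (cpoisson e z) \<le> e / d * poisson d (Re z)"
proof -
  have p: "0 < (Re z)\<^sup>2 + d\<^sup>2" using assms(2) by (simp add: add_nonneg_pos)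
  have "cmod (cpoisson e z) = e / (pi * cmod (complex_of_real e ^ 2 + z\<^sup>2))"
    using assms(1) by (simp add: cpoisson_def norm_divide norm_mult)
  also have "\<dots> \<le> e / (pi * ((Re z)\<^sup>2 + d\<^sup>2))"
    using cpoisson_denominator[OF assms(2,3)] p assms(1) by (intro divide_left_mono mult_left_mono mult_pos_pos) auto
  also have "\<dots> = e / d * poisson d (Re z)"
    using assms(2) by (simp add: poisson_def add.commute)
  finally show ?thesis .
qed

text \<open>
  The function \<open>p t = y * Im (cpoisson e (t + iy))\<close> is odd and \<open>p t * t \<le> 0\<close>. Pairing \<open>t\<close> with \<open>- t\<close> writes
  \<open>2 y\<close> times the imaginary part of the continuation as the integral of \<open>(h (x - t) - h (x + t)) * p t\<close>, whose two
  factors have the same sign for increasing \<open>h\<close>.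
\<close>
lemma conv_poisson_K_class:
  assumes h: "bdd_borel h" and mono: "mono h" and e: "0 < e"
  shows "conv h (poisson e) \<in> K_class e"
proof -
  obtain M where M: "\<And>x. \<bar>h x\<bar> \<le> M" "0 \<le> M" using bdd_borelE[OF h] by blast
  have [measurable]: "h \<in> borel_measurable borel" using h by (simp add: bdd_borel_def)
  define H where "H z s = complex_of_real (h s) * cpoisson e (z - complex_of_real s)" for z s
  define F where "F z = (LINT s|lborel. H z s)" for z
  have Hm: "H z \<in> borel_measurable borel" for z
    unfolding H_def[abs_def] cpoisson_def by measurable
  have hol: "F holomorphic_on strip e"
    unfolding F_def
  proof (rule holomorphic_parametric_integral[OF open_strip _ Hm])
    have "complex_of_real e ^ 2 + (z - complex_of_real s)\<^sup>2 \<noteq> 0" if "z \<in> strip e" for z s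
    proof -
      define d where "d = e - \<bar>Im z\<bar>"
      have d: "0 < d" using that by (simp add: d_def)
      have "0 < (Re (z - complex_of_real s))\<^sup>2 + d\<^sup>2" using d by (simp add: add_nonneg_pos)
      also have "\<dots> \<le> cmod (complex_of_real e ^ 2 + (z - complex_of_real s)\<^sup>2)"
        by (rule cpoisson_denominator[OF d]) (simp add: d_def)
      finally show ?thesis by auto
    qed
    then show "(\<lambda>z. H z s) holomorphic_on strip e" for s
      unfolding H_def cpoisson_def by (intro holomorphic_intros) auto
    show "\<exists>r>0. \<exists>w. cball z0 r \<subseteq> strip e \<and> integrable lborel w \<and> (\<forall>z\<in>cball z0 r. \<forall>s. cmod (H z s) \<le> w s)"
      if z0: "z0 \<in> strip e" for z0
    proof -
      define d where "d = (e - \<bar>Im z0\<bar>) / 2"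
      have d: "0 < d" using z0 by (simp add: d_def)
      define w where "w s = M * (e / d * (3 * poisson d (Re z0 - s)))" for s
      have Re: "\<bar>Re z - Re z0\<bar> \<le> d" and Im: "\<bar>Im z\<bar> \<le> e - d" if "z \<in> cball z0 d" for z
      proof -
        have n: "cmod (z - z0) \<le> d" using that by (simp add: dist_norm norm_minus_commute)
        show "\<bar>Re z - Re z0\<bar> \<le> d" using abs_Re_le_cmod[of "z - z0"] n by simp
        have "\<bar>Im z - Im z0\<bar> \<le> d" using abs_Im_le_cmod[of "z - z0"] n by simp
        moreover have "2 * d = e - \<bar>Im z0\<bar>" by (simp add: d_def)
        ultimately show "\<bar>Im z\<bar> \<le> e - d" by linarith
      qed
      have "cball z0 d \<subseteq> strip e"
      proof
        fix z assume "z \<in> cball z0 d"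
        from Im[OF this] d show "z \<in> strip e" by simp
      qed
      moreover have "integrable lborel w" unfolding w_def using poisson_shift(1)[OF d] by simp
      moreover have "cmod (H z s) \<le> w s" if z: "z \<in> cball z0 d" for z s
      proof -
        have sq: "(Re z0 - s)\<^sup>2 \<le> 2 * (Re z - s)\<^sup>2 + 2 * d\<^sup>2"
        proof -
          have "(Re z0 - Re z)\<^sup>2 \<le> d\<^sup>2" using power_mono[OF Re[OF z], of 2] by (simp add: power2_commute)
          moreover have "(Re z0 - s)\<^sup>2 \<le> 2 * (Re z0 - Re z)\<^sup>2 + 2 * (Re z - s)\<^sup>2"
            using zero_le_power2[of "Re z0 - Re z - (Re z - s)"] by (simp add: power2_eq_square algebra_simps)
          ultimately show ?thesis by linarith
        qed
        have aux: "D + A \<le> 3 * (D + B)" if "A \<le> 2 * B + 2 * D" "0 \<le> B" for A B D :: real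
          using that by simp
        have le: "d\<^sup>2 + (Re z0 - s)\<^sup>2 \<le> 3 * (d\<^sup>2 + (Re z - s)\<^sup>2)"
          by (rule aux[OF sq zero_le_power2])
        have p: "0 < d\<^sup>2 + (Re z0 - s)\<^sup>2" "0 < d\<^sup>2 + (Re z - s)\<^sup>2" using d by (simp_all add: add_pos_nonneg)
        have a: "d / (pi * (3 * (d\<^sup>2 + (Re z - s)\<^sup>2))) \<le> poisson d (Re z0 - s)"
          unfolding poisson_def using le p d by (intro divide_left_mono mult_left_mono mult_pos_pos) auto
        have b: "d / (pi * (3 * (d\<^sup>2 + (Re z - s)\<^sup>2))) = poisson d (Re z - s) / 3"
          by (simp add: poisson_def mult.left_commute)
        have c: "poisson d (Re z - s) \<le> 3 * poisson d (Re z0 - s)"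
          using a unfolding b by simp
        have "cmod (cpoisson e (z - complex_of_real s)) \<le> e / d * poisson d (Re z - s)"
          using cpoisson_bound[OF e d, of "z - complex_of_real s"] Im[OF z] by simp
        also have "\<dots> \<le> e / d * (3 * poisson d (Re z0 - s))"
          using e d c by (intro mult_left_mono) auto
        finally have "cmod (cpoisson e (z - complex_of_real s)) \<le> e / d * (3 * poisson d (Re z0 - s))" .
        then show ?thesis
          unfolding H_def w_def norm_mult norm_of_real using M by (intro mult_mono) auto
      qed
      ultimately show ?thesis using d by blast
    qed
  qed
  have real: "F (complex_of_real x) = complex_of_real (conv h (poisson e) x)" for x
  proof -
    have "H (complex_of_real x) = (\<lambda>s. complex_of_real (h s * poisson e (x - s)))"
    proof
      show "H (complex_of_real x) s = complex_of_real (h s * poisson e (x - s))" for s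
        using cpoisson_of_real[of e "x - s"] by (simp add: H_def)
    qed
    then show ?thesis unfolding F_def conv_alt by (simp del: of_real_mult)
  qed
  have pick: "0 \<le> Im (F z) * Im z" if z: "\<bar>Im z\<bar> < e" for z
  proof -
    define x where "x = Re z"
    define y where "y = Im z"
    have zxy: "z = Complex x y" by (simp add: x_def y_def)
    define p where "p t = Im (cpoisson e (Complex t y)) * y" for t
    have p_odd: "p (- t) = - p t" for t
    proof -
      have "cpoisson e (Complex (- t) y) = cnj (cpoisson e (Complex t y))"
        by (simp add: cpoisson_def complex_eq_iff power2_eq_square Re_divide Im_divide)
      then show ?thesis by (simp add: p_def)
    qed
    have p_sign: "p t * t \<le> 0" for t
    proof -
      define D where "D = complex_of_real pi * (complex_of_real e ^ 2 + (Complex t y)\<^sup>2)"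
      have "Im D = pi * (2 * t * y)" by (simp add: D_def power2_eq_square)
      then have "Im (cpoisson e (Complex t y)) = - (e * (pi * (2 * t * y))) / ((Re D)\<^sup>2 + (Im D)\<^sup>2)"
        unfolding cpoisson_def D_def[symmetric] by (simp add: Im_divide)
      then have "p t * t = - (2 * e * pi * (t * y)\<^sup>2) / ((Re D)\<^sup>2 + (Im D)\<^sup>2)"
        by (simp add: p_def power2_eq_square mult_ac)
      moreover have "0 \<le> 2 * e * pi * (t * y)\<^sup>2 / ((Re D)\<^sup>2 + (Im D)\<^sup>2)" using e by simp
      ultimately show ?thesis by simp
    qed
    have Hint: "integrable lborel (H z)"
    proof -
      define d where "d = e - \<bar>Im z\<bar>"
      have d: "0 < d" using z by (simp add: d_def)
      show ?thesis
      proof (rule Bochner_Integration.integrable_bound)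
        show "integrable lborel (\<lambda>s. M * (e / d * poisson d (Re z - s)))" using poisson_shift(1)[OF d] by simp
        show "H z \<in> borel_measurable lborel" using Hm by simp
        have "cmod (H z s) \<le> M * (e / d * poisson d (Re z - s))" for s
          unfolding H_def norm_mult norm_of_real
          using M cpoisson_bound[OF e d, of "z - complex_of_real s"] by (intro mult_mono) (auto simp: d_def)
        then show "AE s in lborel. cmod (H z s) \<le> norm (M * (e / d * poisson d (Re z - s)))"
          unfolding real_norm_def by (intro AE_I2 order_trans[OF _ abs_ge_self])
      qed
    qed
    define k where "k t = h (x - t) * p t" for t
    have kH: "Im (H z (x + (- 1) * t)) * y = k t" for t
    proof -
      have "z - complex_of_real (x + (- 1) * t) = Complex t y" by (simp add: zxy complex_eq_iff)
      then show ?thesis by (simp add: H_def k_def p_def)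
    qed
    have k: "integrable lborel k"
      unfolding kH[symmetric]
      using lborel_integrable_real_affine[OF Hint, of "-1" x] by (intro integrable_mult_left integrable_Im) auto
    have k': "integrable lborel (\<lambda>t. k (- t))" "(LINT t|lborel. k (- t)) = (LINT t|lborel. k t)"
      using lborel_integrable_real_affine[OF k, of "-1" 0] lborel_integral_real_affine[of "-1" k 0] by auto
    have "Im (F z) * Im z = (LINT s|lborel. Im (H z s) * y)"
      unfolding F_def y_def[symmetric] using integral_Im[OF Hint] by simp
    also have "\<dots> = (LINT t|lborel. k t)"
      using lborel_integral_real_affine[of "-1" "\<lambda>s. Im (H z s) * y" x] unfolding kH by simp
    also have "\<dots> = (LINT t|lborel. k t + k (- t)) / 2" using k k' by simp
    also have "0 \<le> \<dots>"
    proof -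
      have "0 \<le> k t + k (- t)" for t
      proof -
        have eq: "k t + k (- t) = (h (x - t) - h (x + t)) * p t"
          by (simp add: k_def p_odd algebra_simps)
        consider "0 < t" | "t = 0" | "t < 0" by linarith
        then show ?thesis
        proof cases
          case 1
          then have "p t \<le> 0" using p_sign[of t] by (simp add: mult_le_0_iff)
          moreover have "h (x - t) \<le> h (x + t)" using 1 by (intro monoD[OF mono]) simp
          ultimately show ?thesis unfolding eq by (intro mult_nonpos_nonpos) auto
        next
          case 2
          then show ?thesis unfolding eq by simp
        next
          case 3
          then have "0 \<le> p t" using p_sign[of t] by (simp add: mult_le_0_iff)
          moreover have "h (x + t) \<le> h (x - t)" using 3 by (intro monoD[OF mono]) simp
          ultimately show ?thesis unfolding eq by (intro mult_nonneg_nonneg) auto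
        qed
      qed
      then show ?thesis by simp
    qed
    finally show ?thesis .
  qed
  have "bounded (range (conv h (poisson e)))"
    using conv_bound[OF h pos_kernel_poisson[OF e] M(1)] by (auto simp: bounded_iff)
  with hol real pick show ?thesis by (auto simp: K_class_def)
qed

definition scaled :: "(real \<Rightarrow> real) \<Rightarrow> real \<Rightarrow> real \<Rightarrow> real" where
  "scaled w e t = w (t / e) / e"

lemma pos_kernel_scaled:
  assumes w: "pos_kernel w" and e: "0 < e"
  shows "pos_kernel (scaled w e)" "(LINT t|lborel. scaled w e t) = (LINT t|lborel. w t)"
proof -
  have [measurable]: "w \<in> borel_measurable borel" using w by (simp add: pos_kernel_def)
  have "integrable lborel (\<lambda>t. w (0 + (1 / e) * t))"
    using e by (intro lborel_integrable_real_affine pos_kernelD(2)[OF w]) simp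
  then have "integrable lborel (scaled w e)" by (simp add: scaled_def[abs_def])
  moreover have "scaled w e \<in> borel_measurable borel" unfolding scaled_def[abs_def] by measurable
  ultimately show "pos_kernel (scaled w e)" using e pos_kernelD(3)[OF w] by (simp add: pos_kernel_def scaled_def)
  show "(LINT t|lborel. scaled w e t) = (LINT t|lborel. w t)"
    using lborel_integral_real_affine[of "1 / e" w 0] e by (simp add: scaled_def[abs_def])
qed

lemma poisson_scaled: "0 < e \<Longrightarrow> poisson e = scaled (poisson 1) e"
  unfolding scaled_def[abs_def] by (rule ext) (rule poisson_scale)

lemma gauss_integrable: "integrable lborel (\<lambda>t::real. exp (- (t\<^sup>2)))"
proof (rule Bochner_Integration.integrable_bound)
  have "integrable lborel (\<lambda>t::real. exp (- 1 * \<bar>t\<bar>))"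
    using integrable_norm[OF abs_exp_transform(1)[OF zero_less_one, of 0]] by simp
  then show "integrable lborel (\<lambda>t::real. exp 1 * exp (- 1 * \<bar>t\<bar>))" by simp
  have "exp (- (t\<^sup>2)) \<le> exp 1 * exp (- 1 * \<bar>t\<bar>)" for t :: real
  proof -
    have "- (t\<^sup>2) \<le> 1 - \<bar>t\<bar>"
      using zero_le_power2[of "\<bar>t\<bar> - 1 / 2"] by (simp add: power2_eq_square algebra_simps)
    then show ?thesis by (simp add: mult_exp_exp)
  qed
  then show "AE t in (lborel :: real measure). norm (exp (- (t\<^sup>2))) \<le> norm (exp 1 * exp (- 1 * \<bar>t\<bar>))"
    by (intro AE_I2) simp
qed measurable

definition gauss :: "real \<Rightarrow> real" where
  "gauss t = exp (- (t\<^sup>2)) / (LINT t|lborel. exp (- (t\<^sup>2)))"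

lemma gauss_mass_pos: "0 < (LINT t|(lborel :: real measure). exp (- (t\<^sup>2)))"
proof -
  have "(LINT t|(lborel :: real measure). exp (- (t\<^sup>2))) \<noteq> 0"
  proof
    assume "(LINT t|(lborel :: real measure). exp (- (t\<^sup>2))) = 0"
    then have "AE t in (lborel :: real measure). exp (- (t\<^sup>2)) = 0"
      by (subst (asm) integral_nonneg_eq_0_iff_AE[OF gauss_integrable]) simp_all
    then obtain s :: "nat \<Rightarrow> real" where "\<And>n. exp (- ((s n)\<^sup>2)) = 0"
      by (rule AE_lborel_sequence) blast
    then show False by simp
  qed
  moreover have "0 \<le> (LINT t|(lborel :: real measure). exp (- (t\<^sup>2)))" by simp
  ultimately show ?thesis by linarith
qed

lemma pos_kernel_gauss: "pos_kernel gauss" and gauss_integral: "(LINT t|lborel. gauss t) = 1"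
proof -
  have "gauss \<in> borel_measurable borel" unfolding gauss_def[abs_def] by measurable
  then show "pos_kernel gauss"
    using gauss_integrable gauss_mass_pos by (simp add: pos_kernel_def gauss_def[abs_def])
  show "(LINT t|lborel. gauss t) = 1"
    using gauss_mass_pos by (simp add: gauss_def[abs_def])
qed

lemma conv_gauss_entire:
  assumes h: "bdd_borel h" and e: "0 < e"
  shows "restriction_of_entire (conv h (scaled gauss e))"
proof -
  obtain M where M: "\<And>x. \<bar>h x\<bar> \<le> M" "0 \<le> M" using bdd_borelE[OF h] by blast
  have [measurable]: "h \<in> borel_measurable borel" using h by (simp add: bdd_borel_def)
  define Z where "Z = (LINT t|(lborel :: real measure). exp (- (t\<^sup>2)))"
  have Z: "0 < Z" unfolding Z_def by (rule gauss_mass_pos)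
  define H where "H z s = complex_of_real (h s) * (exp (- (((z - complex_of_real s) / complex_of_real e)\<^sup>2)) / complex_of_real (Z * e))" for z s
  have Hm: "H z \<in> borel_measurable borel" for z
    unfolding H_def[abs_def] by measurable
  have "(\<lambda>z. LINT s|lborel. H z s) holomorphic_on UNIV"
  proof (rule holomorphic_parametric_integral[OF open_UNIV _ Hm])
    show "(\<lambda>z. H z s) holomorphic_on UNIV" for s
      unfolding H_def by (intro holomorphic_intros) (use Z e in auto)
    fix z0 :: complex
    define C where "C = M * (exp (1 + ((\<bar>Im z0\<bar> + e) / e)\<^sup>2) / (Z * e))"
    define w where "w s = C * exp (- ((Re z0 / (e * sqrt 2) + (- 1 / (e * sqrt 2)) * s)\<^sup>2))" for s
    have "integrable lborel w"
      unfolding w_def using e by (intro integrable_mult_right lborel_integrable_real_affine gauss_integrable) auto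
    moreover have "cmod (H z s) \<le> w s" if z: "z \<in> cball z0 e" for z s
    proof -
      define X where "X = (Re z - s) / e"
      define Y where "Y = Im z / e"
      define X0 where "X0 = (Re z0 - s) / e"
      have n: "cmod (z - z0) \<le> e" using z by (simp add: dist_norm norm_minus_commute)
      have "\<bar>Re z0 - Re z\<bar> \<le> e" using abs_Re_le_cmod[of "z - z0"] n by simp
      then have x: "\<bar>X0 - X\<bar> \<le> 1" using e by (simp add: X0_def X_def diff_divide_distrib[symmetric])
      have "\<bar>Im z\<bar> \<le> \<bar>Im z0\<bar> + e" using abs_Im_le_cmod[of "z - z0"] n by simp
      then have y: "\<bar>Y\<bar> \<le> (\<bar>Im z0\<bar> + e) / e" using e by (simp add: Y_def divide_right_mono)
      have "X0\<^sup>2 \<le> 2 * X\<^sup>2 + 2 * (X0 - X)\<^sup>2"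
        using zero_le_power2[of "2 * X - X0"] by (simp add: power2_eq_square algebra_simps)
      moreover have "(X0 - X)\<^sup>2 \<le> 1" using power_mono[OF x, of 2] by simp
      ultimately have x2: "- X\<^sup>2 \<le> 1 - X0\<^sup>2 / 2" by linarith
      have y2: "Y\<^sup>2 \<le> ((\<bar>Im z0\<bar> + e) / e)\<^sup>2" using power_mono[OF y, of 2] by simp
      have "Re (- (((z - complex_of_real s) / complex_of_real e)\<^sup>2)) = - X\<^sup>2 + Y\<^sup>2"
        using e by (simp add: X_def Y_def power2_eq_square Re_divide Im_divide diff_divide_distrib)
      also have "\<dots> \<le> (1 + ((\<bar>Im z0\<bar> + e) / e)\<^sup>2) + - (X0\<^sup>2 / 2)" using x2 y2 by linarith
      finally have "exp (Re (- (((z - complex_of_real s) / complex_of_real e)\<^sup>2))) \<le> exp (1 + ((\<bar>Im z0\<bar> + e) / e)\<^sup>2) * exp (- (X0\<^sup>2 / 2))"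
        unfolding exp_add[symmetric] by simp
      then have "exp (Re (- (((z - complex_of_real s) / complex_of_real e)\<^sup>2))) / (Z * e)
          \<le> exp (1 + ((\<bar>Im z0\<bar> + e) / e)\<^sup>2) * exp (- (X0\<^sup>2 / 2)) / (Z * e)"
        using Z e by (intro divide_right_mono) auto
      then have "cmod (H z s) \<le> M * (exp (1 + ((\<bar>Im z0\<bar> + e) / e)\<^sup>2) * exp (- (X0\<^sup>2 / 2)) / (Z * e))"
        unfolding H_def norm_mult norm_of_real norm_divide norm_exp_eq_Re
        using M Z e by (intro mult_mono) (auto simp: norm_mult)
      also have "X0\<^sup>2 / 2 = (Re z0 / (e * sqrt 2) + (- 1 / (e * sqrt 2)) * s)\<^sup>2"
        using e by (simp add: X0_def power_divide power_mult_distrib flip: diff_divide_distrib)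
      finally show ?thesis by (simp add: w_def C_def)
    qed
    ultimately show "\<exists>r>0. \<exists>w. cball z0 r \<subseteq> UNIV \<and> integrable lborel w \<and> (\<forall>z\<in>cball z0 r. \<forall>s. cmod (H z s) \<le> w s)"
      using e by blast
  qed
  moreover have "(LINT s|lborel. H (complex_of_real x) s) = complex_of_real (conv h (scaled gauss e) x)" for x
  proof -
    have "H (complex_of_real x) = (\<lambda>s. complex_of_real (h s * scaled gauss e (x - s)))"
      by (rule ext) (simp add: H_def scaled_def gauss_def Z_def[symmetric] exp_of_real[symmetric])
    then show ?thesis unfolding conv_alt by (simp del: of_real_mult)
  qed
  ultimately show ?thesis unfolding restriction_of_entire_def by blast
qed

section \<open>Weak convergence of mollifications\<close>

text \<open>
  A bound, for bounded \<open>h\<close>, on how far averaging with the kernel \<open>w\<close> scaled by \<open>e\<close> can change the integral of \<open>h\<close> over an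
  interval of length \<open>L\<close>. The minimum keeps it finite for kernels without first moment, such as \<open>poisson 1\<close>.
\<close>
definition spread :: "(real \<Rightarrow> real) \<Rightarrow> real \<Rightarrow> real \<Rightarrow> real" where
  "spread w L e = (LINT v|lborel. w v * min (4 * e * \<bar>v\<bar>) (2 * L))"

lemma spread_tendsto:
  assumes w: "pos_kernel w" and L: "0 \<le> L" shows "(\<lambda>n. spread w L (1 / real (Suc n))) \<longlonglongrightarrow> 0"
proof -
  have [measurable]: "w \<in> borel_measurable borel" using w by (simp add: pos_kernel_def)
  have "(\<lambda>n. LINT v|lborel. w v * min (4 * (1 / real (Suc n)) * \<bar>v\<bar>) (2 * L)) \<longlonglongrightarrow> (LINT v|(lborel :: real measure). 0)"
  proof (rule integral_dominated_convergence[where w = "\<lambda>v. w v * (2 * L)"])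
    show "integrable lborel (\<lambda>v. w v * (2 * L))" using pos_kernelD(2)[OF w] by simp
    show "AE v in lborel. (\<lambda>n. w v * min (4 * (1 / real (Suc n)) * \<bar>v\<bar>) (2 * L)) \<longlonglongrightarrow> 0"
    proof (rule AE_I2)
      fix v
      have "(\<lambda>n. w v * min (4 * (1 / real (Suc n)) * \<bar>v\<bar>) (2 * L)) \<longlonglongrightarrow> w v * min (4 * 0 * \<bar>v\<bar>) (2 * L)"
        by (intro tendsto_intros tendsto_min inv_Suc_tendsto)
      then show "(\<lambda>n. w v * min (4 * (1 / real (Suc n)) * \<bar>v\<bar>) (2 * L)) \<longlonglongrightarrow> 0" using L by simp
    qed
    show "AE v in lborel. norm (w v * min (4 * (1 / real (Suc n)) * \<bar>v\<bar>) (2 * L)) \<le> w v * (2 * L)" for n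
    proof (rule AE_I2)
      fix v
      have "0 \<le> 4 * (1 / real (Suc n)) * \<bar>v\<bar>" by simp
      then show "norm (w v * min (4 * (1 / real (Suc n)) * \<bar>v\<bar>) (2 * L)) \<le> w v * (2 * L)"
        using pos_kernelD(4)[OF w, of v] L by (auto simp: abs_mult intro!: mult_left_mono)
    qed
  qed measurable
  then show ?thesis by (simp add: spread_def)
qed

lemma indicator_integrable: "integrable lborel (indicator {a..b} :: real \<Rightarrow> real)"
  by (intro integrable_real_indicator) (auto simp: emeasure_lborel_Icc_eq)

lemma indicator_shift_L1:
  fixes a b s :: real
  assumes "a \<le> b"
  shows "(LINT x|lborel. \<bar>indicator {a..b} (x + s) - indicator {a..b} x :: real\<bar>) \<le> min (4 * \<bar>s\<bar>) (2 * (b - a))"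
proof -
  have sh: "(\<lambda>x. indicator {a..b} (x + s) :: real) = indicator {a - s..b - s}"
    by (auto simp: indicator_def fun_eq_iff)
  have i: "integrable lborel (\<lambda>x. \<bar>indicator {a..b} (x + s) - indicator {a..b} x :: real\<bar>)"
    using indicator_integrable[of "a - s" "b - s"] indicator_integrable[of a b] unfolding sh[symmetric] by simp
  have j: "integrable lborel (\<lambda>x. indicator {c..d} x + indicator {c'..d'} x :: real)" for c d c' d' :: real
    by (rule Bochner_Integration.integrable_add[OF indicator_integrable indicator_integrable])
  have m: "(LINT x|lborel. indicator {c..d} x :: real) = d - c" if "c \<le> d" for c d
    using that by simp
  have "(LINT x|lborel. \<bar>indicator {a..b} (x + s) - indicator {a..b} x :: real\<bar>) \<le>
     (LINT x|lborel. (indicator {a - s..b - s} x + indicator {a..b} x :: real))"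
    by (rule integral_mono[OF i j]) (auto simp: indicator_def)
  also have "\<dots> = 2 * (b - a)" using assms indicator_integrable by (simp add: m)
  finally have 1: "(LINT x|lborel. \<bar>indicator {a..b} (x + s) - indicator {a..b} x :: real\<bar>) \<le> 2 * (b - a)" .
  have "(LINT x|lborel. \<bar>indicator {a..b} (x + s) - indicator {a..b} x :: real\<bar>) \<le>
     (LINT x|lborel. (indicator {a - \<bar>s\<bar>..a + \<bar>s\<bar>} x + indicator {b - \<bar>s\<bar>..b + \<bar>s\<bar>} x :: real))"
    by (rule integral_mono[OF i j]) (auto simp: indicator_def)
  also have "\<dots> = 4 * \<bar>s\<bar>" using indicator_integrable by (simp add: m)
  finally show ?thesis using 1 by simp
qed

lemma indicator_mult_integrable:
  assumes "bdd_borel h" shows "integrable lborel (\<lambda>x. indicator {a..b} x * h x)"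
  using bounded_mult_integrable[OF assms indicator_integrable[of a b]] by (simp add: mult.commute)

text \<open>
  Averaging \<open>h\<close> amounts to averaging the translates of the interval, and a translate by \<open>s\<close> differs from the interval
  on a set of measure at most \<open>4 \<bar>s\<bar>\<close>.
\<close>
lemma conv_weak:
  assumes h: "bdd_borel h" and M: "\<And>x. \<bar>h x\<bar> \<le> M" and w: "pos_kernel w" "(LINT t|lborel. w t) = 1"
    and e: "0 < e" and ab: "a \<le> b"
  shows "\<bar>(LINT x|lborel. indicator {a..b} x * conv h (scaled w e) x) - (LINT x|lborel. indicator {a..b} x * h x)\<bar>
    \<le> M * spread w (b - a) e"
proof -
  define W where "W = scaled w e"
  have W: "pos_kernel W" "(LINT t|lborel. W t) = 1" unfolding W_def using pos_kernel_scaled[OF w(1) e] w(2) by simp_all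
  have M0: "0 \<le> M" using order_trans[OF abs_ge_zero M[of 0]] .
  have [measurable]: "h \<in> borel_measurable borel" "W \<in> borel_measurable borel" "w \<in> borel_measurable borel"
    using h W(1) w(1) by (auto simp: bdd_borel_def pos_kernel_def)
  define J where "J s = (LINT x|lborel. indicator {a..b} (x + s) * h x)" for s
  have J: "(LINT x|lborel. indicator {a..b} x * h (x - s)) = J s" for s
    unfolding J_def using lborel_integral_real_affine[of 1 "\<lambda>x. indicator {a..b} x * h (x - s)" s] by (simp add: add.commute)
  have le: "norm (indicator {a..b} x * h (x - s) * W s) \<le> M * indicator {a..b} x * W s" for x s
  proof -
    have "\<bar>h (x - s)\<bar> * (indicator {a..b} x * W s) \<le> M * (indicator {a..b} x * W s)"
      using M pos_kernelD(4)[OF W(1)] by (intro mult_right_mono) auto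
    then show ?thesis using pos_kernelD(4)[OF W(1), of s] by (simp add: abs_mult mult_ac)
  qed
  have meas: "(\<lambda>(x, s). indicator {a..b} x * h (x - s) * W s) \<in> borel_measurable (lborel \<Otimes>\<^sub>M lborel)" by measurable
  note fub = fubini_dom[OF meas, where A = "\<lambda>x. M * indicator {a..b} x" and D = "\<lambda>_. W" and K = 1]
  have swap: "(LINT x|lborel. LINT s|lborel. indicator {a..b} x * h (x - s) * W s) = (LINT s|lborel. LINT x|lborel. indicator {a..b} x * h (x - s) * W s)"
    and int: "integrable lborel (\<lambda>s. LINT x|lborel. indicator {a..b} x * h (x - s) * W s)"
    using fub(1,3) indicator_integrable W pos_kernelD(2)[OF W(1)] le by auto
  have int': "integrable lborel (\<lambda>s. J s * W s)" using int by (simp add: J)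
  have "(LINT x|lborel. indicator {a..b} x * conv h W x) = (LINT x|lborel. LINT s|lborel. indicator {a..b} x * h (x - s) * W s)"
    unfolding conv_def by (simp add: mult.assoc)
  also have "\<dots> = (LINT s|lborel. J s * W s)" unfolding swap by (simp add: J)
  finally have e1: "(LINT x|lborel. indicator {a..b} x * conv h W x) = (LINT s|lborel. J s * W s)" .
  have e2: "(LINT x|lborel. indicator {a..b} x * h x) = (LINT s|lborel. J 0 * W s)"
    using W(2) by (simp add: J_def)
  have Jd: "\<bar>J s - J 0\<bar> \<le> M * min (4 * \<bar>s\<bar>) (2 * (b - a))" for s
  proof -
    have sh: "(\<lambda>x. indicator {a..b} (x + s) :: real) = indicator {a - s..b - s}"
      by (auto simp: indicator_def fun_eq_iff)
    have "integrable lborel (\<lambda>x. indicator {a..b} (x + s) * h x)"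
      using indicator_mult_integrable[OF h, of "a - s" "b - s"] by (simp add: sh[THEN fun_cong])
    then have "J s - J 0 = (LINT x|lborel. (indicator {a..b} (x + s) - indicator {a..b} x) * h x)"
      unfolding J_def using indicator_mult_integrable[OF h, of a b] by (simp add: left_diff_distrib)
    then have "norm (J s - J 0) = norm (LINT x|lborel. (indicator {a..b} (x + s) - indicator {a..b} x) * h x)" by simp
    also have "\<dots> \<le> (LINT x|lborel. M * \<bar>indicator {a..b} (x + s) - indicator {a..b} x\<bar>)"
    proof (rule integral_norm_le)
      show "integrable lborel (\<lambda>x. M * \<bar>indicator {a..b} (x + s) - indicator {a..b} x\<bar>)"
        using indicator_integrable[of "a - s" "b - s"] indicator_integrable[of a b] unfolding sh[symmetric] by simp
      show "norm ((indicator {a..b} (x + s) - indicator {a..b} x) * h x) \<le> M * \<bar>indicator {a..b} (x + s) - indicator {a..b} x\<bar>" for x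
        using mult_right_mono[OF M[of x], of "\<bar>indicator {a..b} (x + s) - indicator {a..b} x\<bar>"] by (simp add: abs_mult mult.commute)
    qed
    also have "\<dots> \<le> M * min (4 * \<bar>s\<bar>) (2 * (b - a))"
      using indicator_shift_L1[OF ab, of s] M0 by (simp add: mult_left_mono)
    finally show ?thesis by simp
  qed
  have mint: "integrable lborel (\<lambda>s. M * min (4 * \<bar>s\<bar>) (2 * (b - a)) * W s)"
  proof (rule Bochner_Integration.integrable_bound)
    show "integrable lborel (\<lambda>s. M * (2 * (b - a)) * W s)" using pos_kernelD(2)[OF W(1)] by simp
    show "AE s in lborel. norm (M * min (4 * \<bar>s\<bar>) (2 * (b - a)) * W s) \<le> norm (M * (2 * (b - a)) * W s)"
      using M0 ab pos_kernelD(4)[OF W(1)] by (intro AE_I2) (auto simp: abs_mult intro!: mult_right_mono mult_left_mono)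
  qed measurable
  have "(LINT x|lborel. indicator {a..b} x * conv h W x) - (LINT x|lborel. indicator {a..b} x * h x) = (LINT s|lborel. (J s - J 0) * W s)"
    unfolding e1 e2 using int' pos_kernelD(2)[OF W(1)] by (simp add: left_diff_distrib)
  then have "norm ((LINT x|lborel. indicator {a..b} x * conv h W x) - (LINT x|lborel. indicator {a..b} x * h x)) = norm (LINT s|lborel. (J s - J 0) * W s)"
    by simp
  also have "\<dots> \<le> (LINT s|lborel. M * min (4 * \<bar>s\<bar>) (2 * (b - a)) * W s)"
    using Jd pos_kernelD(4)[OF W(1)] by (intro integral_norm_le mint) (auto simp: abs_mult intro!: mult_right_mono)
  also have "\<dots> = M * spread w (b - a) e"
    unfolding spread_def W_def
    using lborel_integral_real_affine[of e "\<lambda>s. M * min (4 * \<bar>s\<bar>) (2 * (b - a)) * scaled w e s" 0] e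
    by (simp add: scaled_def abs_mult mult_ac)
  finally show ?thesis by (simp add: W_def)
qed

text \<open>
  On \<open>[-R, R]\<close> the densities \<open>u + M\<close> and \<open>M\<close> are nonnegative and define finite measures that agree on
  half lines.
\<close>
lemma AE_zero_if_interval_integrals_zero:
  assumes u: "bdd_borel u" and z: "\<And>a b. a \<le> b \<Longrightarrow> (LINT x|lborel. indicator {a..b} x * u x) = 0"
  shows "AE x in lborel. u x = 0"
proof -
  obtain M where M: "\<And>x. \<bar>u x\<bar> \<le> M" "0 \<le> M" using bdd_borelE[OF u] by blast
  have [measurable]: "u \<in> borel_measurable borel" using u by (simp add: bdd_borel_def)
  have R: "AE x in lborel. x \<in> {- R..R} \<longrightarrow> u x = 0" if R: "0 \<le> R" for R :: real
  proof -
    define p where "p x = ennreal (indicator {- R..R} x * (u x + M))" for x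
    define q where "q x = ennreal (indicator {- R..R} x * M)" for x
    have nn: "0 \<le> u x + M" for x using M(1)[of x] by linarith
    have [measurable]: "p \<in> borel_measurable borel" "q \<in> borel_measurable borel"
      unfolding p_def[abs_def] q_def[abs_def] by measurable
    have em: "emeasure (density lborel p) {x<..} = ennreal (LINT y|lborel. indicator {max x (- R)..R} y * (u y + M))"
      "emeasure (density lborel q) {x<..} = ennreal (LINT y|lborel. indicator {max x (- R)..R} y * M)" for x
    proof -
      have eq': "AE y in lborel. p y * indicator {x<..} y = ennreal (indicator {max x (- R)..R} y * (u y + M))"
        using AE_lborel_singleton[of x] by eventually_elim (auto simp: p_def indicator_def)
      have eq'': "AE y in lborel. q y * indicator {x<..} y = ennreal (indicator {max x (- R)..R} y * M)"
        using AE_lborel_singleton[of x] by eventually_elim (auto simp: q_def indicator_def)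
      have "emeasure (density lborel p) {x<..} = (\<integral>\<^sup>+y. ennreal (indicator {max x (- R)..R} y * (u y + M)) \<partial>lborel)"
        by (simp add: emeasure_density nn_integral_cong_AE[OF eq'])
      also have "\<dots> = ennreal (LINT y|lborel. indicator {max x (- R)..R} y * (u y + M))"
      proof (rule nn_integral_eq_integral)
        show "integrable lborel (\<lambda>y. indicator {max x (- R)..R} y * (u y + M))"
          using indicator_mult_integrable[OF u] indicator_integrable by (simp add: distrib_left)
        show "AE y in lborel. 0 \<le> indicator {max x (- R)..R} y * (u y + M)"
          by (intro AE_I2 mult_nonneg_nonneg nn) simp
      qed
      finally show "emeasure (density lborel p) {x<..} = ennreal (LINT y|lborel. indicator {max x (- R)..R} y * (u y + M))" .
      have "emeasure (density lborel q) {x<..} = (\<integral>\<^sup>+y. ennreal (indicator {max x (- R)..R} y * M) \<partial>lborel)"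
        by (simp add: emeasure_density nn_integral_cong_AE[OF eq''])
      also have "\<dots> = ennreal (LINT y|lborel. indicator {max x (- R)..R} y * M)"
        using M indicator_integrable by (intro nn_integral_eq_integral) auto
      finally show "emeasure (density lborel q) {x<..} = ennreal (LINT y|lborel. indicator {max x (- R)..R} y * M)" .
    qed
    have z': "(LINT y|lborel. indicator {max x (- R)..R} y * u y) = 0" for x
    proof (cases "max x (- R) \<le> R")
      case False
      then have "{max x (- R)..R} = {}" by auto
      then show ?thesis by simp
    qed (rule z)
    have "density lborel p = density lborel q"
    proof (rule measure_eqI_lessThan)
      show "emeasure (density lborel p) {x<..} = emeasure (density lborel q) {x<..}" for x
        unfolding em using z'[of x] indicator_mult_integrable[OF u] indicator_integrable
        by (simp add: distrib_left)
      show "emeasure (density lborel p) {x<..} < \<infinity>" for x unfolding em by simp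
    qed simp_all
    then have "AE x in lborel. p x = q x"
      by (intro sigma_finite_measure.density_unique[OF sigma_finite_lborel]) auto
    then show ?thesis
    proof (rule AE_mp, intro AE_I2 impI)
      fix x assume "p x = q x" "x \<in> {- R..R}"
      then have "ennreal (u x + M) = ennreal M" by (simp add: p_def q_def)
      then show "u x = 0" using nn[of x] M(2) by simp
    qed
  qed
  have "AE x in lborel. \<forall>n::nat. x \<in> {- real n..real n} \<longrightarrow> u x = 0"
    unfolding AE_all_countable using R by simp
  then show ?thesis
  proof (rule AE_mp, intro AE_I2 impI)
    fix x :: real assume *: "\<forall>n::nat. x \<in> {- real n..real n} \<longrightarrow> u x = 0"
    obtain n :: nat where "\<bar>x\<bar> \<le> real n" using real_arch_simple by blast
    then show "u x = 0" using * by (auto simp: abs_le_iff)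
  qed
qed

lemma continuous_AE_bound:
  fixes u :: "real \<Rightarrow> real"
  assumes u: "continuous_on UNIV u" and ae: "AE x in lborel. \<bar>u x\<bar> \<le> M"
  shows "\<bar>u x\<bar> \<le> M"
proof -
  have [measurable]: "u \<in> borel_measurable borel" by (rule borel_measurable_continuous_onI[OF u])
  have "AE s in lborel. \<bar>u (x + 1 * s)\<bar> \<le> M"
    by (rule AE_borel_affine[OF _ _ ae]) auto
  then obtain s where s: "\<And>n. \<bar>u (x + 1 * s n)\<bar> \<le> M" "s \<longlonglongrightarrow> 0"
    using AE_lborel_sequence[of "\<lambda>s. \<bar>u (x + 1 * s)\<bar> \<le> M"] by blast
  have "(\<lambda>n. x + 1 * s n) \<longlonglongrightarrow> x + 1 * 0" by (intro tendsto_intros s)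
  then have "(\<lambda>n. u (x + 1 * s n)) \<longlonglongrightarrow> u x"
    using continuous_on_tendsto_compose[OF u, of "\<lambda>n. x + 1 * s n" x sequentially] by simp
  from tendsto_rabs[OF this] show ?thesis by (rule LIMSEQ_le_const2) (use s in auto)
qed

lemma bdd_borel_minus: "bdd_borel f \<Longrightarrow> bdd_borel (\<lambda>x. - f x)"
  by (auto simp: bdd_borel_def)

text \<open>
  The three factors have different tasks: the inner Poisson kernel makes the function increasing, the outer one
  puts it into \<open>K_class\<close>, and the Gaussian makes it entire. Since convolutions commute, each of them may be regarded as the last.
\<close>
definition mollify :: "(real \<Rightarrow> real) \<Rightarrow> nat \<Rightarrow> real \<Rightarrow> real" where
  "mollify f n = (let e = 1 / real (Suc n) in conv (conv (conv f (poisson e)) (scaled gauss e)) (poisson e))"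

lemma pos_kernel_scaled_gauss: "0 < e \<Longrightarrow> pos_kernel (scaled gauss e)"
  using pos_kernel_scaled(1)[OF pos_kernel_gauss] .

lemma conv_bound_prob:
  assumes "bdd_borel f" "pos_kernel w" "(LINT t|lborel. w t) = 1" "\<And>x. \<bar>f x\<bar> \<le> M"
  shows "\<bar>conv f w x\<bar> \<le> M"
  using conv_bound[OF assms(1,2,4)] assms(3) by simp

lemma mollify_props:
  assumes f: "bdd_borel f" and M: "\<And>x. \<bar>f x\<bar> \<le> M"
  shows "bdd_borel (mollify f n)" "\<bar>mollify f n x\<bar> \<le> M" "restriction_of_entire (mollify f n)"
    and "(\<And>T. 0 < T \<Longrightarrow> mono (conv f (poisson T))) \<Longrightarrow> mollify f n \<in> K_class (1 / real (Suc n))"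
    and "a \<le> b \<Longrightarrow> (\<lambda>n. LINT x|lborel. indicator {a..b} x * mollify f n x) \<longlonglongrightarrow> (LINT x|lborel. indicator {a..b} x * f x)"
proof -
  have e: "0 < 1 / real (Suc n)" for n by simp
  have kp: "pos_kernel (poisson (1 / real (Suc n)))" and kg: "pos_kernel (scaled gauss (1 / real (Suc n)))" for n
    by (intro pos_kernel_poisson pos_kernel_scaled_gauss e)+
  have ip: "(LINT t|lborel. poisson (1 / real (Suc n)) t) = 1" and ig: "(LINT t|lborel. scaled gauss (1 / real (Suc n)) t) = 1" for n
    using poisson_integral(2)[OF e] pos_kernel_scaled(2)[OF pos_kernel_gauss e] gauss_integral by simp_all
  define f1 where "f1 n = conv f (poisson (1 / real (Suc n)))" for n
  define f2 where "f2 n = conv (f1 n) (scaled gauss (1 / real (Suc n)))" for n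
  have f1: "bdd_borel (f1 n)" "\<bar>f1 n x\<bar> \<le> M" for n x
    unfolding f1_def using bdd_borel_conv[OF f kp] conv_bound_prob[OF f kp ip M] by auto
  have f2: "bdd_borel (f2 n)" "\<bar>f2 n x\<bar> \<le> M" for n x
    unfolding f2_def using bdd_borel_conv[OF f1(1) kg] conv_bound_prob[OF f1(1) kg ig f1(2)] by auto
  have m: "mollify f n = conv (f2 n) (poisson (1 / real (Suc n)))" for n
    by (simp add: mollify_def Let_def f2_def f1_def)
  show "bdd_borel (mollify f n)" "\<bar>mollify f n x\<bar> \<le> M"
    unfolding m using bdd_borel_conv[OF f2(1) kp] conv_bound_prob[OF f2(1) kp ip f2(2)] by auto
  have "mollify f n = conv (conv (f1 n) (poisson (1 / real (Suc n)))) (scaled gauss (1 / real (Suc n)))"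
    unfolding m f2_def by (rule conv_commute[OF f1(1) kg kp])
  then show "restriction_of_entire (mollify f n)"
    using conv_gauss_entire[OF bdd_borel_conv[OF f1(1) kp] e] by simp
  show "mollify f n \<in> K_class (1 / real (Suc n))" if "\<And>T. 0 < T \<Longrightarrow> mono (conv f (poisson T))"
    unfolding m
  proof (rule conv_poisson_K_class[OF f2(1) _ e])
    have "mono (f1 n)" unfolding f1_def by (rule that[OF e])
    then show "mono (f2 n)" unfolding f2_def by (rule conv_mono[OF f1(1) kg])
  qed
  show "(\<lambda>n. LINT x|lborel. indicator {a..b} x * mollify f n x) \<longlonglongrightarrow> (LINT x|lborel. indicator {a..b} x * f x)"
    if ab: "a \<le> b"
  proof -
    let ?I = "\<lambda>h. LINT x|lborel. indicator {a..b} x * h x"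
    let ?sp = "\<lambda>n. spread (poisson 1) (b - a) (1 / real (Suc n))" and ?sg = "\<lambda>n. spread gauss (b - a) (1 / real (Suc n))"
    have k1: "pos_kernel (poisson 1)" "(LINT t|lborel. poisson 1 t) = 1"
      using pos_kernel_poisson[of 1] poisson_integral(2)[of 1] by simp_all
    have "\<bar>?I (mollify f n) - ?I f\<bar> \<le> M * ?sp n + M * ?sg n + M * ?sp n" for n
    proof -
      have "\<bar>?I (mollify f n) - ?I (f2 n)\<bar> \<le> M * ?sp n"
        unfolding m poisson_scaled[OF e] by (rule conv_weak[OF f2 k1 e ab])
      moreover have "\<bar>?I (f2 n) - ?I (f1 n)\<bar> \<le> M * ?sg n"
        unfolding f2_def by (rule conv_weak[OF f1 pos_kernel_gauss gauss_integral e ab])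
      moreover have "\<bar>?I (f1 n) - ?I f\<bar> \<le> M * ?sp n"
        unfolding f1_def poisson_scaled[OF e] by (rule conv_weak[OF f M k1 e ab])
      ultimately show ?thesis by linarith
    qed
    then have le: "\<forall>n. norm (?I (mollify f n) - ?I f) \<le> M * ?sp n + M * ?sg n + M * ?sp n" by simp
    have "(\<lambda>n. M * ?sp n + M * ?sg n + M * ?sp n) \<longlonglongrightarrow> M * 0 + M * 0 + M * 0"
      using ab by (intro tendsto_intros spread_tendsto pos_kernel_gauss k1) auto
    then have "(\<lambda>n. ?I (mollify f n) - ?I f) \<longlonglongrightarrow> 0"
      by (intro Lim_null_comparison[OF always_eventually[OF le]]) simp
    then show ?thesis by (simp add: LIM_zero_iff)
  qed
qed

text \<open>
  Convolutions act on the first function only, so the pair is swapped in between.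
\<close>
lemma mollify_cpos:
  assumes f: "bdd_borel f" and g: "bdd_borel g" and pos: "cpos f g" and nz: "\<not> czero f g"
  shows "cpos (mollify f n) (mollify g n)" "\<not> czero (mollify f n) (mollify g n)"
proof -
  define e where "e = 1 / real (Suc n)"
  have e: "0 < e" by (simp add: e_def)
  note kp = pos_kernel_poisson[OF e] and kg = pos_kernel_scaled_gauss[OF e]
  have step: "bdd_borel (conv (conv (conv u (poisson e)) (scaled gauss e)) (poisson e)) \<and>
      cpos (conv (conv (conv u (poisson e)) (scaled gauss e)) (poisson e)) v \<and>
      \<not> czero (conv (conv (conv u (poisson e)) (scaled gauss e)) (poisson e)) v"
    if "bdd_borel u" "bdd_borel v" "cpos u v" "\<not> czero u v" for u v
  proof -
    note b1 = bdd_borel_conv[OF that(1) kp]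
    note b2 = bdd_borel_conv[OF b1 kg]
    note p1 = cpos_conv[OF that(1,2) kp that(3)]
    note p2 = cpos_conv[OF b1 that(2) kg p1]
    show ?thesis
      using bdd_borel_conv[OF b2 kp] cpos_conv[OF b2 that(2) kp p2] czero_conv[OF b2 that(2) kp p2]
        czero_conv[OF b1 that(2) kg p1] czero_conv[OF that(1,2) kp that(3)] that(4) by blast
  qed
  have m: "mollify u n = conv (conv (conv u (poisson e)) (scaled gauss e)) (poisson e)" for u
    by (simp add: mollify_def Let_def e_def)
  have 1: "bdd_borel (mollify f n)" "cpos (mollify f n) g" "\<not> czero (mollify f n) g"
    using step[OF f g pos nz] by (auto simp: m)
  have 2: "cpos g (mollify f n)" "\<not> czero g (mollify f n)"
    using cpos_swap[OF 1(1) g 1(2)] czero_swap[OF g 1(1)] 1(3) by blast+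
  have 3: "bdd_borel (mollify g n)" "cpos (mollify g n) (mollify f n)" "\<not> czero (mollify g n) (mollify f n)"
    using step[OF g 1(1) 2] by (auto simp: m)
  show "cpos (mollify f n) (mollify g n)" "\<not> czero (mollify f n) (mollify g n)"
    using cpos_swap[OF 3(1) 1(1) 3(2)] czero_swap[OF 1(1) 3(1)] 3(3) by blast+
qed

text \<open>
  Convergence of the integrals over intervals suffices to identify the pointwise limit, which avoids
  almost everywhere convergence of the mollifications.
\<close>
lemma weak_pointwise_limit_AE:
  assumes f: "bdd_borel f"
    and weak: "\<And>a b. a \<le> b \<Longrightarrow> (\<lambda>n. LINT x|lborel. indicator {a..b} x * F n x) \<longlonglongrightarrow> (LINT x|lborel. indicator {a..b} x * f x)"
    and Fm: "\<And>n. bdd_borel (F n)" and u: "\<And>n. continuous_on UNIV (u n)" "\<And>n x. \<bar>u n x\<bar> \<le> M"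
    and ae: "\<And>n. AE x in lborel. F n x = \<sigma> * u n x" and r: "strict_mono r"
    and lim: "\<And>x. (\<lambda>n. u (r n) x) \<longlonglongrightarrow> l x"
  shows "AE x in lborel. f x = \<sigma> * l x"
proof -
  have [measurable]: "u n \<in> borel_measurable borel" for n by (rule borel_measurable_continuous_onI[OF u(1)])
  have lm [measurable]: "l \<in> borel_measurable borel"
    by (rule borel_measurable_LIMSEQ_metric[OF _ lim]) measurable
  have [measurable]: "F n \<in> borel_measurable borel" for n using Fm by (simp add: bdd_borel_def)
  have lb: "\<bar>l x\<bar> \<le> M" for x
    by (rule LIMSEQ_le_const2[OF tendsto_rabs[OF lim]]) (use u in auto)
  have bl: "bdd_borel l" using lm lb by (auto simp: bdd_borel_def)
  obtain N where N: "\<And>x. \<bar>f x\<bar> \<le> N" using bdd_borelE[OF f] by blast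
  have bd: "bdd_borel (\<lambda>x. f x - \<sigma> * l x)"
    unfolding bdd_borel_def
  proof
    show "(\<lambda>x. f x - \<sigma> * l x) \<in> borel_measurable borel" using bdd_borel_measurable[OF f] by measurable
    have "\<bar>f x - \<sigma> * l x\<bar> \<le> N + \<bar>\<sigma>\<bar> * M" for x
      using abs_triangle_ineq4[of "f x" "\<sigma> * l x"] N[of x] mult_left_mono[OF lb, of "\<bar>\<sigma>\<bar>" x] by (simp add: abs_mult)
    then show "\<exists>M. \<forall>x. \<bar>f x - \<sigma> * l x\<bar> \<le> M" by blast
  qed
  have "AE x in lborel. f x - \<sigma> * l x = 0"
  proof (rule AE_zero_if_interval_integrals_zero[OF bd])
    fix a b :: real assume ab: "a \<le> b"
    have eq: "(LINT x|lborel. indicator {a..b} x * F n x) = (LINT x|lborel. indicator {a..b} x * (\<sigma> * u n x))" for n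
      by (rule integral_cong_AE) (use ae[of n] in \<open>auto elim: AE_mp\<close>)
    have "(\<lambda>n. LINT x|lborel. indicator {a..b} x * (\<sigma> * u (r n) x)) \<longlonglongrightarrow> (LINT x|lborel. indicator {a..b} x * (\<sigma> * l x))"
    proof (rule integral_dominated_convergence[where w = "\<lambda>x. \<bar>\<sigma>\<bar> * M * indicator {a..b} x"])
      show "AE x in lborel. (\<lambda>n. indicator {a..b} x * (\<sigma> * u (r n) x)) \<longlonglongrightarrow> indicator {a..b} x * (\<sigma> * l x)"
        by (intro AE_I2 tendsto_intros lim)
      show "AE x in lborel. norm (indicator {a..b} x * (\<sigma> * u (r n) x)) \<le> \<bar>\<sigma>\<bar> * M * indicator {a..b} x" for n
        using u(2) by (intro AE_I2) (auto simp: indicator_def abs_mult intro!: mult_left_mono)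
      show "integrable lborel (\<lambda>x. \<bar>\<sigma>\<bar> * M * indicator {a..b} x)"
        using indicator_integrable by (intro integrable_mult_right) 
    qed measurable
    moreover have "(\<lambda>n. LINT x|lborel. indicator {a..b} x * (\<sigma> * u (r n) x)) \<longlonglongrightarrow> (LINT x|lborel. indicator {a..b} x * f x)"
      using LIMSEQ_subseq_LIMSEQ[OF weak[OF ab] r] by (simp add: o_def eq)
    ultimately have "(LINT x|lborel. indicator {a..b} x * f x) = (LINT x|lborel. indicator {a..b} x * (\<sigma> * l x))"
      using LIMSEQ_unique by blast
    moreover have "integrable lborel (\<lambda>x. indicator {a..b} x * (\<sigma> * l x))"
      using indicator_mult_integrable[OF bl, of a b] by (simp add: mult.left_commute)
    ultimately show "(LINT x|lborel. indicator {a..b} x * (f x - \<sigma> * l x)) = 0"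
      using indicator_mult_integrable[OF f, of a b] by (simp add: right_diff_distrib)
  qed
  then show ?thesis by simp
qed

section \<open>The limit of the strips\<close>

lemma czero_if_AE_const:
  "bdd_borel f \<Longrightarrow> bdd_borel g \<Longrightarrow> AE x in lborel. f x = c \<Longrightarrow> czero f g"
  unfolding czero_def using cform_AE_const by blast

text \<open>
  The reciprocal widths of the strips for \<open>f\<close> are assumed to be bounded, hence converge along a subsequence. A
  limit \<open>0\<close> would make \<open>f\<close> constant; as it is positive, the widths for \<open>g\<close> converge as well.
\<close>
lemma K_class_limit_pair:
  assumes f: "bdd_borel f" and g: "bdd_borel g" and nz: "\<not> czero f g"
    and F: "\<And>n. bdd_borel (F n)" and G: "\<And>n. bdd_borel (G n)"
    and Fw: "\<And>a b. a \<le> b \<Longrightarrow> (\<lambda>n. LINT x|lborel. indicator {a..b} x * F n x) \<longlonglongrightarrow> (LINT x|lborel. indicator {a..b} x * f x)"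
    and Gw: "\<And>a b. a \<le> b \<Longrightarrow> (\<lambda>n. LINT x|lborel. indicator {a..b} x * G n x) \<longlonglongrightarrow> (LINT x|lborel. indicator {a..b} x * g x)"
    and u: "\<And>n. u n \<in> K_class (\<alpha> n)" "\<And>n x. \<bar>u n x\<bar> \<le> M" and v: "\<And>n. v n \<in> K_class (\<beta> n)" "\<And>n x. \<bar>v n x\<bar> \<le> M"
    and Fu: "\<And>n. AE x in lborel. F n x = \<sigma> * u n x" and Gv: "\<And>n. AE x in lborel. G n x = \<sigma> * v n x"
    and ab: "\<And>n. 1 \<le> \<alpha> n" "\<And>n. 0 < \<beta> n" "\<And>n. \<alpha> n * \<beta> n = pi / 2"
  obtains k l a b where "0 < a" "0 < b" "a * b = pi / 2" "k \<in> K_class a" "l \<in> K_class b"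
    "AE x in lborel. f x = \<sigma> * k x" "AE x in lborel. g x = \<sigma> * l x"
proof -
  have a0: "0 < \<alpha> n" for n using ab(1)[of n] by linarith
  have uc: "continuous_on UNIV (u n)" and vc: "continuous_on UNIV (v n)" for n
    using K_class_continuous[OF u(1) a0] K_class_continuous[OF v(1) ab(2)] by auto
  have "\<forall>n. 1 / \<alpha> n \<in> {0..1}" using ab(1) a0 by (simp add: less_imp_le)
  then obtain \<theta> r1 where r1: "\<theta> \<in> {0..1}" "strict_mono r1" "((\<lambda>n. 1 / \<alpha> n) \<circ> r1) \<longlonglongrightarrow> \<theta>"
    using seq_compactE[OF compact_imp_seq_compact[OF compact_Icc[of 0 "1 :: real"]], of "\<lambda>n. 1 / \<alpha> n"] by blast
  obtain r2 k where r2: "strict_mono (r2 :: nat \<Rightarrow> nat)" "k \<in> K_class 1" "\<And>x. (\<lambda>n. u (r1 (r2 n)) x) \<longlonglongrightarrow> k (\<theta> * x)"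
    using K_class_limit[of "\<lambda>n. u (r1 n)" "\<lambda>n. \<alpha> (r1 n)" M \<theta>, OF u(1) a0 u(2) r1(3)[unfolded o_def]] by blast
  define r where "r = r1 \<circ> r2"
  have r: "strict_mono r" unfolding r_def by (rule strict_mono_o[OF r1(2) r2(1)])
  have fk: "AE x in lborel. f x = \<sigma> * k (\<theta> * x)"
    by (rule weak_pointwise_limit_AE[OF f Fw F uc u(2) Fu r]) (simp_all add: r_def r2(3))
  have \<theta>0: "0 < \<theta>"
  proof (rule ccontr)
    assume "\<not> 0 < \<theta>"
    then have "\<theta> = 0" using r1(1) by simp
    then have "AE x in lborel. f x = \<sigma> * k 0" using fk by simp
    then show False using czero_if_AE_const[OF f g] nz by blast
  qed
  define \<eta> where "\<eta> = 2 / pi / \<theta>"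
  have \<eta>0: "0 < \<eta>" using \<theta>0 by (simp add: \<eta>_def)
  have inv: "1 / \<beta> n = 2 / pi / (1 / \<alpha> n)" for n
    using ab(3)[of n] a0[of n] ab(2)[of n] by (simp add: field_simps)
  have "(\<lambda>n. 1 / \<alpha> (r n)) \<longlonglongrightarrow> \<theta>"
    using LIMSEQ_subseq_LIMSEQ[OF r1(3) r2(1)] by (simp add: o_def r_def)
  then have "(\<lambda>n. 1 / \<beta> (r n)) \<longlonglongrightarrow> \<eta>"
    unfolding inv \<eta>_def using \<theta>0 by (intro tendsto_intros) auto
  note \<eta>lim = this
  obtain r3 l where r3: "strict_mono (r3 :: nat \<Rightarrow> nat)" "l \<in> K_class 1" "\<And>x. (\<lambda>n. v (r (r3 n)) x) \<longlonglongrightarrow> l (\<eta> * x)"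
    using K_class_limit[of "\<lambda>n. v (r n)" "\<lambda>n. \<beta> (r n)" M \<eta>, OF v(1) ab(2) v(2) \<eta>lim] by blast
  have gl: "AE x in lborel. g x = \<sigma> * l (\<eta> * x)"
    by (rule weak_pointwise_limit_AE[OF g Gw G vc v(2) Gv strict_mono_o[OF r r3(1)]]) (simp_all add: r3(3))
  show thesis
  proof (rule that[of "1 / \<theta>" "1 / \<eta>" "\<lambda>x. k (\<theta> * x)" "\<lambda>x. l (\<eta> * x)"])
    show "1 / \<theta> * (1 / \<eta>) = pi / 2" using \<theta>0 by (simp add: \<eta>_def)
  qed (use \<theta>0 \<eta>0 K_class_scale[OF r2(2) \<theta>0] K_class_scale[OF r3(2) \<eta>0] fk gl in auto)
qed

lemma infinitely_often_subseq:
  assumes "\<exists>\<^sub>\<infinity>n. P n" obtains r where "strict_mono (r :: nat \<Rightarrow> nat)" "\<And>n. P (r n)"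
proof -
  have inf: "infinite {n. P n}" using assms by (simp add: INFM_iff_infinite)
  show thesis
    using that[of "enumerate {n. P n}"] strict_mono_enumerate[OF inf] enumerate_in_set[OF inf] by auto
qed

lemma KC_iff_sign:
  "KC f g \<longleftrightarrow> (\<exists>\<sigma> a b k l. (\<sigma> = 1 \<or> \<sigma> = - 1) \<and> 0 < a \<and> 0 < b \<and> a * b = pi / 2 \<and> k \<in> K_class a \<and> l \<in> K_class b \<and>
     (AE x in lborel. f x = \<sigma> * k x) \<and> (AE x in lborel. g x = \<sigma> * l x))"
proof
  assume "KC f g"
  then obtain f' g' a b where *: "AE x in lborel. f x = f' x" "AE x in lborel. g x = g' x" "0 < a" "0 < b" "a * b = pi / 2"
    "f' \<in> K_class a \<and> g' \<in> K_class b \<or> (\<lambda>x. - f' x) \<in> K_class a \<and> (\<lambda>x. - g' x) \<in> K_class b"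
    by (auto simp: KC_def AE_completion_iff)
  from *(6) show "\<exists>\<sigma> a b k l. (\<sigma> = 1 \<or> \<sigma> = - 1) \<and> 0 < a \<and> 0 < b \<and> a * b = pi / 2 \<and> k \<in> K_class a \<and> l \<in> K_class b \<and>
     (AE x in lborel. f x = \<sigma> * k x) \<and> (AE x in lborel. g x = \<sigma> * l x)"
  proof
    assume "f' \<in> K_class a \<and> g' \<in> K_class b"
    with * show ?thesis by (intro exI[of _ 1] exI[of _ a] exI[of _ b] exI[of _ f'] exI[of _ g']) simp
  next
    assume "(\<lambda>x. - f' x) \<in> K_class a \<and> (\<lambda>x. - g' x) \<in> K_class b"
    with * show ?thesis
      by (intro exI[of _ "- 1"] exI[of _ a] exI[of _ b] exI[of _ "\<lambda>x. - f' x"] exI[of _ "\<lambda>x. - g' x"]) simp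
  qed
next
  assume "\<exists>\<sigma> a b k l. (\<sigma> = 1 \<or> \<sigma> = - 1) \<and> 0 < a \<and> 0 < b \<and> a * b = pi / 2 \<and> k \<in> K_class a \<and> l \<in> K_class b \<and>
     (AE x in lborel. f x = \<sigma> * k x) \<and> (AE x in lborel. g x = \<sigma> * l x)"
  then obtain \<sigma> a b k l where *: "\<sigma> = 1 \<or> \<sigma> = - 1" "0 < a" "0 < b" "a * b = pi / 2" "k \<in> K_class a" "l \<in> K_class b"
     "AE x in lborel. f x = \<sigma> * k x" "AE x in lborel. g x = \<sigma> * l x" by blast
  have "\<sigma> * (\<sigma> * x) = x" for x using *(1) by auto
  then show "KC f g"
    unfolding KC_def AE_completion_iff
    by (intro exI[of _ "\<lambda>x. \<sigma> * k x"] exI[of _ "\<lambda>x. \<sigma> * l x"] conjI exI[of _ a] exI[of _ b])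
      (use * in auto)
qed

text \<open>
  As \<open>\<alpha>\<beta> = \<pi>/2 > 1\<close>, one of the two widths is at least \<open>1\<close> infinitely often, so
  \<open>K_class_limit_pair\<close> applies to \<open>(f, g)\<close> or to \<open>(g, f)\<close>.
\<close>
lemma KC_limit:
  assumes f: "bdd_borel f" and g: "bdd_borel g" and nz: "\<not> czero f g"
    and F: "\<And>n. bdd_borel (F n)" "\<And>n x. \<bar>F n x\<bar> \<le> M" and G: "\<And>n. bdd_borel (G n)" "\<And>n x. \<bar>G n x\<bar> \<le> M"
    and Fw: "\<And>a b. a \<le> b \<Longrightarrow> (\<lambda>n. LINT x|lborel. indicator {a..b} x * F n x) \<longlonglongrightarrow> (LINT x|lborel. indicator {a..b} x * f x)"
    and Gw: "\<And>a b. a \<le> b \<Longrightarrow> (\<lambda>n. LINT x|lborel. indicator {a..b} x * G n x) \<longlonglongrightarrow> (LINT x|lborel. indicator {a..b} x * g x)"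
    and KC: "\<And>n. KC (F n) (G n)"
  shows "KC f g"
proof -
  define witness where "witness n \<sigma> a b k l \<longleftrightarrow> (\<sigma> = 1 \<or> \<sigma> = - 1) \<and> 0 < a \<and> 0 < b \<and> a * b = pi / 2 \<and>
     k \<in> K_class a \<and> l \<in> K_class b \<and> (AE x in lborel. F n x = \<sigma> * k x) \<and> (AE x in lborel. G n x = \<sigma> * l x)"
    for n \<sigma> a b k l
  have "\<exists>\<sigma> a b k l. witness n \<sigma> a b k l" for n
    using KC[of n] unfolding KC_iff_sign witness_def .
  then obtain \<sigma> \<alpha> \<beta> u v where "\<And>n. witness n (\<sigma> n) (\<alpha> n) (\<beta> n) (u n) (v n)"
    by metis
  then have *: "\<And>n. \<sigma> n = 1 \<or> \<sigma> n = (- 1 :: real)" "\<And>n. 0 < \<alpha> n" "\<And>n. 0 < \<beta> n"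
    "\<And>n. \<alpha> n * \<beta> n = pi / 2" "\<And>n. u n \<in> K_class (\<alpha> n)" "\<And>n. v n \<in> K_class (\<beta> n)"
    "\<And>n. AE x in lborel. F n x = \<sigma> n * u n x" "\<And>n. AE x in lborel. G n x = \<sigma> n * v n x"
    unfolding witness_def by blast+
  have abs1: "\<bar>\<sigma> n\<bar> = 1" for n using *(1)[of n] by auto
  have ub: "\<bar>u n x\<bar> \<le> M" for n x
  proof (rule continuous_AE_bound[OF K_class_continuous[OF *(5,2)]])
    show "AE x in lborel. \<bar>u n x\<bar> \<le> M"
      using *(7)[of n] by eventually_elim (metis F(2) abs1 abs_mult mult_1)
  qed
  have vb: "\<bar>v n x\<bar> \<le> M" for n x
  proof (rule continuous_AE_bound[OF K_class_continuous[OF *(6,3)]])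
    show "AE x in lborel. \<bar>v n x\<bar> \<le> M"
      using *(8)[of n] by eventually_elim (metis G(2) abs1 abs_mult mult_1)
  qed
  \<comment> \<open>Along a subsequence the sign is constant and one of the two widths stays away from 0.\<close>
  have "\<exists>\<^sub>\<infinity>n. (\<sigma> n = 1 \<or> \<sigma> n = - 1) \<and> (1 \<le> \<alpha> n \<or> 1 \<le> \<beta> n)"
    unfolding INFM_nat
  proof
    fix N
    have "1 \<le> \<alpha> N' \<or> 1 \<le> \<beta> N'" for N'
    proof (rule ccontr)
      assume "\<not> (1 \<le> \<alpha> N' \<or> 1 \<le> \<beta> N')"
      then have "\<alpha> N' * \<beta> N' < 1 * 1" using *(2,3)[of N'] by (intro mult_strict_mono) auto
      then show False using *(4)[of N'] pi_gt3 by simp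
    qed
    then show "\<exists>n>N. (\<sigma> n = 1 \<or> \<sigma> n = - 1) \<and> (1 \<le> \<alpha> n \<or> 1 \<le> \<beta> n)"
      using *(1) by (intro exI[of _ "Suc N"]) auto
  qed
  then have "\<exists>s. (s = 1 \<or> s = - 1) \<and> ((\<exists>\<^sub>\<infinity>n. \<sigma> n = s \<and> 1 \<le> \<alpha> n) \<or> (\<exists>\<^sub>\<infinity>n. \<sigma> n = s \<and> 1 \<le> \<beta> n))"
    unfolding conj_disj_distribL conj_disj_distribR INFM_disj_distrib by blast
  then obtain s where s: "s = 1 \<or> s = - 1" "(\<exists>\<^sub>\<infinity>n. \<sigma> n = s \<and> 1 \<le> \<alpha> n) \<or> (\<exists>\<^sub>\<infinity>n. \<sigma> n = s \<and> 1 \<le> \<beta> n)" by blast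
  have sub: "(\<lambda>n. LINT x|lborel. indicator {a..b} x * F (r n) x) \<longlonglongrightarrow> (LINT x|lborel. indicator {a..b} x * f x)"
    "(\<lambda>n. LINT x|lborel. indicator {a..b} x * G (r n) x) \<longlonglongrightarrow> (LINT x|lborel. indicator {a..b} x * g x)"
    if "strict_mono r" "a \<le> b" for r :: "nat \<Rightarrow> nat" and a b
    using LIMSEQ_subseq_LIMSEQ[OF Fw[OF that(2)] that(1)] LIMSEQ_subseq_LIMSEQ[OF Gw[OF that(2)] that(1)] by (simp_all add: o_def)
  from s(2) show ?thesis
  proof
    assume io: "\<exists>\<^sub>\<infinity>n. \<sigma> n = s \<and> 1 \<le> \<alpha> n"
    obtain r where r: "strict_mono (r :: nat \<Rightarrow> nat)" "\<And>n. \<sigma> (r n) = s \<and> 1 \<le> \<alpha> (r n)"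
      using infinitely_often_subseq[OF io] by blast
    show ?thesis
    proof (rule K_class_limit_pair[OF f g nz F(1) G(1) sub[OF r(1)] *(5) ub *(6) vb])
      show "AE x in lborel. F (r n) x = s * u (r n) x" "AE x in lborel. G (r n) x = s * v (r n) x" for n
        using *(7,8)[of "r n"] r(2)[of n] by simp_all
      show "1 \<le> \<alpha> (r n)" "0 < \<beta> (r n)" "\<alpha> (r n) * \<beta> (r n) = pi / 2" for n
        using r(2)[of n] *(3,4)[of "r n"] by simp_all
    next
      fix k l a b
      assume "0 < a" "0 < b" "a * b = pi / 2" "k \<in> K_class a" "l \<in> K_class b"
        "AE x in lborel. f x = s * k x" "AE x in lborel. g x = s * l x"
      then show ?thesis using s(1) unfolding KC_iff_sign by blast
    qed
  next
    assume io: "\<exists>\<^sub>\<infinity>n. \<sigma> n = s \<and> 1 \<le> \<beta> n"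
    obtain r where r: "strict_mono (r :: nat \<Rightarrow> nat)" "\<And>n. \<sigma> (r n) = s \<and> 1 \<le> \<beta> (r n)"
      using infinitely_often_subseq[OF io] by blast
    have nz': "\<not> czero g f" using czero_swap[OF g f] nz by blast
    show ?thesis
    proof (rule K_class_limit_pair[OF g f nz' G(1) F(1) sub(2,1)[OF r(1)] *(6) vb *(5) ub])
      show "AE x in lborel. G (r n) x = s * v (r n) x" "AE x in lborel. F (r n) x = s * u (r n) x" for n
        using *(7,8)[of "r n"] r(2)[of n] by simp_all
      show "1 \<le> \<beta> (r n)" "0 < \<alpha> (r n)" "\<beta> (r n) * \<alpha> (r n) = pi / 2" for n
        using r(2)[of n] *(2,4)[of "r n"] by (simp_all add: mult.commute)
    next
      fix k l a b
      assume "0 < a" "0 < b" "a * b = pi / 2" "k \<in> K_class a" "l \<in> K_class b"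
        "AE x in lborel. g x = s * k x" "AE x in lborel. f x = s * l x"
      then show ?thesis using s(1) unfolding KC_iff_sign
        by (intro exI[of _ s] exI[of _ b] exI[of _ a] exI[of _ l] exI[of _ k]) (simp add: mult.commute)
    qed
  qed
qed

theorem theorem1p6:
  assumes "\<forall>(f::real \<Rightarrow> real) (g::real \<Rightarrow> real).
     bounded (range f) \<longrightarrow> bounded (range g) \<longrightarrow>
     restriction_of_entire f \<longrightarrow> restriction_of_entire g \<longrightarrow>
     (\<exists>a>0. \<exists>b>0. f \<in> K_class a \<and> g \<in> K_class b) \<longrightarrow>
     positive_op (i_commutator_PQ f g) \<longrightarrow> \<not> zero_op (i_commutator_PQ f g) \<longrightarrow>
     KC f g"
  shows "\<forall>(f::real \<Rightarrow> real) (g::real \<Rightarrow> real).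
     bounded (range f) \<longrightarrow> bounded (range g) \<longrightarrow>
     f \<in> borel_measurable lebesgue \<longrightarrow> g \<in> borel_measurable lebesgue \<longrightarrow>
     positive_op (i_commutator_PQ f g) \<longrightarrow> \<not> zero_op (i_commutator_PQ f g) \<longrightarrow>
     KC f g"
proof (intro allI impI)
  fix f g :: "real \<Rightarrow> real"
  assume bf: "bounded (range f)" and bg: "bounded (range g)"
    and mf: "f \<in> borel_measurable lebesgue" and mg: "g \<in> borel_measurable lebesgue"
    and pos: "positive_op (i_commutator_PQ f g)" and nz: "\<not> zero_op (i_commutator_PQ f g)"
  obtain Mf Mg where Mf: "\<And>x. \<bar>f x\<bar> \<le> Mf" and Mg: "\<And>x. \<bar>g x\<bar> \<le> Mg"
    using bf bg by (auto simp: bounded_iff)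
  define M where "M = max Mf Mg"
  have M: "\<bar>f x\<bar> \<le> M" "\<bar>g x\<bar> \<le> M" for x
    using Mf[of x] Mg[of x] by (auto simp: M_def)
  obtain f' where f': "f' \<in> borel_measurable borel" "\<And>x. \<bar>f' x\<bar> \<le> M" "AE x in lborel. f x = f' x"
    using real_borel_rep[OF mf M(1)] by blast
  obtain g' where g': "g' \<in> borel_measurable borel" "\<And>x. \<bar>g' x\<bar> \<le> M" "AE x in lborel. g x = g' x"
    using real_borel_rep[OF mg M(2)] by blast
  have bf': "bdd_borel f'" and bg': "bdd_borel g'" using f' g' by (auto simp: bdd_borel_def)
  have pos': "cpos f' g'" using positive_op_iff_cform[OF bf' f'(3) bg' g'(3)] pos by (simp add: cpos_def)
  have nz': "\<not> czero f' g'" using zero_op_iff_cform[OF bf' f'(3) bg' g'(3)] nz by (simp add: czero_def)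
  obtain c where c: "c = 1 \<or> c = (- 1 :: real)" "\<And>T a. 0 < T \<Longrightarrow> 0 \<le> c * slope T a f'"
    "\<And>T a. 0 < T \<Longrightarrow> 0 \<le> c * slope T a g'"
    using slope_sign[OF bf' bg' pos' nz'] by blast
  define p where "p x = c * f' x" for x
  define q where "q x = c * g' x" for x
  have bp: "bdd_borel p" "\<And>x. \<bar>p x\<bar> \<le> M" and bq: "bdd_borel q" "\<And>x. \<bar>q x\<bar> \<le> M"
    using c(1) bf' bg' f'(2) g'(2) bdd_borel_minus by (auto simp: p_def[abs_def] q_def[abs_def])
  have cf: "cform p q \<psi> = cform f' g' \<psi>" if "\<psi> \<in> sqint" for \<psi>
    using c(1) cform_minus[OF bg' that bf'] by (auto simp: p_def[abs_def] q_def[abs_def])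
  have cp: "cpos p q" and cz: "\<not> czero p q"
    using pos' nz' cf by (auto simp: cpos_def czero_def)
  have slope_c: "slope T a (\<lambda>x. c * h x) = c * slope T a h" for T a h
    unfolding slope_def by (simp add: mult.assoc)
  have mono: "mono (conv p (poisson T))" "mono (conv q (poisson T))" if "0 < T" for T
    using c(2,3)[OF that] conv_poisson_mono[OF bp(1) that] conv_poisson_mono[OF bq(1) that]
    by (simp_all add: p_def[abs_def] q_def[abs_def] slope_c)
  note mp = mollify_props[OF bp] and mq = mollify_props[OF bq]
  have KCn: "KC (mollify p n) (mollify q n)" for n
  proof -
    have "bounded (range (mollify p n))" "bounded (range (mollify q n))"
      using mp(2) mq(2) by (auto simp: bounded_iff intro!: exI[of _ M])
    moreover have "mollify p n \<in> K_class (1 / real (Suc n))" "mollify q n \<in> K_class (1 / real (Suc n))"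
      using mp(4) mq(4) mono by blast+
    moreover have "positive_op (i_commutator_PQ (mollify p n) (mollify q n))"
      "\<not> zero_op (i_commutator_PQ (mollify p n) (mollify q n))"
      using mollify_cpos[OF bp(1) bq(1) cp cz, of n]
      unfolding positive_op_iff_cform[OF mp(1)[of n] AE_I2[OF refl] mq(1)[of n] AE_I2[OF refl]]
        zero_op_iff_cform[OF mp(1)[of n] AE_I2[OF refl] mq(1)[of n] AE_I2[OF refl]] cpos_def czero_def
      by simp_all
    moreover have "0 < 1 / real (Suc n)" by simp
    ultimately show ?thesis using assms mp(3) mq(3) by blast
  qed
  have "KC p q"
    by (rule KC_limit[OF bp(1) bq(1) cz mp(1,2) mq(1,2) mp(5) mq(5) KCn])
  then obtain \<sigma> a b k l where *: "\<sigma> = 1 \<or> \<sigma> = - 1" "0 < a" "0 < b" "a * b = pi / 2" "k \<in> K_class a" "l \<in> K_class b"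
     "AE x in lborel. p x = \<sigma> * k x" "AE x in lborel. q x = \<sigma> * l x" unfolding KC_iff_sign by blast
  have "AE x in lborel. f x = (c * \<sigma>) * k x"
    using *(7) f'(3) by eventually_elim (use c(1) in \<open>auto simp: p_def\<close>)
  moreover have "AE x in lborel. g x = (c * \<sigma>) * l x"
    using *(8) g'(3) by eventually_elim (use c(1) in \<open>auto simp: q_def\<close>)
  moreover have "c * \<sigma> = 1 \<or> c * \<sigma> = - 1" using c(1) *(1) by auto
  ultimately show "KC f g" unfolding KC_iff_sign using *(2-6) by blast
qed

end
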